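(* Let $M$ be a 3-dimensional manifold and let $f\colon M\rightarrow\mathbb{R}^{4}$ be a $\widetilde{J}$-tangent affine hypersphere with an involutive distribution $\mathcal{D}$. Then, up to a $\widetilde{J}$-invariant affine transformation, $f$ is locally equivalent to one of the following hypersurfaces: $$f_1(x,y,z)=\begin{pmatrix}\cos x+\cos y\\ \sin x+\sin y\\ \cos x-\cos y\\ \sin x-\sin y\end{pmatrix}\cosh z-\begin{pmatrix}\cos x-\cos y\\ \sin x-\sin y\\ \cos x+\cos y\\ \sin x+\sin y\end{pmatrix}\sinh z,$$ $$f_2(x,y,z)=\begin{pmatrix}\cosh x+\cosh y\\ \sinh x+\sinh y\\ \cosh x-\cosh y\\ \sinh x-\sinh y\end{pmatrix}\cosh z-\begin{pmatrix}\cosh x-\cosh y\\ \sinh x-\sinh y\\ \cosh x+\cosh y\\ \sinh x+\sinh y\end{pmatrix}\sinh z,$$ $$f_3(x,y,z)=\begin{pmatrix}\cos x+\cosh y\\ \sin x+\sinh y\\ \cos x-\cosh y\\ \sin x-\sinh y\end{pmatrix}\cosh z-\begin{pmatrix}\cos x-\cosh y\\ \sin x-\sinh y\\ \cos x+\cosh y\\ \sin x+\sinh y\end{pmatrix}\sinh z,$$ $$f_4(x,y,z)=\begin{pmatrix}\cosh x+\cos y\\ \sinh x+\sin y\\ \cosh x-\cos y\\ \sinh x-\sin y\end{pmatrix}\cosh z-\begin{pmatrix}\cosh x-\cos y\\ \sinh x-\sin y\\ \cosh x+\cos y\\ \sinh x+\sin y\end{pmatrix}\sinh z.$$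
   Context: $\widetilde{J}$ is the standard para-complex structure on $\mathbb{R}^4$: $\widetilde{J}(x_1,x_2,y_1,y_2)=(y_1,y_2,x_1,x_2)$. An affine transformation of $\mathbb{R}^4$ is $\widetilde{J}$-invariant if its linear part commutes with $\widetilde{J}$. "Locally equivalent up to such a transformation" means that near every point of $M$ there are local coordinates $(x,y,z)$ in which $f=A\circ f_i$ for some invertible $\widetilde{J}$-invariant affine transformation $A$ and some $i\in\{1,2,3,4\}$. For an immersion $f\colon M^{N}\to\mathbb{R}^{N+1}$ ($M$ connected, orientable) with transversal field $C$, the objects $\nabla,h,S,\tau$ are defined by $\mathrm{D}_Xf_*Y=f_*(\nabla_XY)+h(X,Y)C$, $\mathrm{D}_XC=-f_*(SX)+\tau(X)C$, with $\mathrm{D}$ the flat connection. $f$ is nondegenerate if $h$ is. For nondegenerate $f$ the affine normal (Blaschke) field is the transversal field $C$, unique up to sign, such that the metric volume form $\omega_h(X_1,\ldots,X_N)=|\det[h(X_i,X_j)]|^{1/2}$ (bases positively oriented with respect to $\Theta$) is $\nabla$-parallel and equals $\Theta(X_1,\ldots,X_N)=\det[f_*X_1,\ldots,f_*X_N,C]$. With this $C$, $f$ is an affine hypersphere if $S=\lambda I$, $\lambda$ constant. $C$ is $\widetilde{J}$-tangent if $\widetilde{J}C_x\in f_*(T_xM)$ for all $x$; a $\widetilde{J}$-tangent affine hypersphere is an affine hypersphere whose Blaschke field is $\widetilde{J}$-tangent. The distribution $\mathcal{D}$ is $\mathcal{D}_x=f_*^{-1}(f_*(T_xM)\cap\widetilde{J}(f_*(T_xM)))$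 (here of constant dimension 2). *)

theory Defs
  imports "HOL-Analysis.Analysis"
begin

section \<open>Smooth manifolds\<close>

text \<open>\<open>Ck_on k f U\<close> is meant for open \<open>U\<close>.\<close>

primrec Ck_on :: "nat \<Rightarrow> ('a::euclidean_space \<Rightarrow> 'b::real_normed_vector) \<Rightarrow> 'a set \<Rightarrow> bool" where
  "Ck_on 0 f U \<longleftrightarrow> continuous_on U f"
| "Ck_on (Suc k) f U \<longleftrightarrow>
     (\<forall>x\<in>U. f differentiable (at x)) \<and> (\<forall>v. Ck_on k (\<lambda>x. frechet_derivative f (at x) v) U)"

definition smooth_on :: "'a::euclidean_space set \<Rightarrow> ('a \<Rightarrow> 'b::real_normed_vector) \<Rightarrow> bool" where
  "smooth_on U f \<longleftrightarrow> (\<forall>k. Ck_on k f U)"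

text \<open>A chart \<open>(U, \<phi>)\<close> is a homeomorphism \<open>\<phi>\<close> of an open set \<open>U\<close> onto an open subset of
  \<open>\<real>\<^sup>n\<close>; the values of \<open>\<phi>\<close> outside \<open>U\<close> are irrelevant.\<close>

type_synonym ('m, 'n) chart = "'m set \<times> ('m \<Rightarrow> real^'n)"

definition is_chart :: "('m::topological_space, 'n::finite) chart \<Rightarrow> bool" where
  "is_chart c \<longleftrightarrow> (case c of (U, \<phi>) \<Rightarrow>
     open U \<and> open (\<phi> ` U) \<and> homeomorphism U (\<phi> ` U) \<phi> (inv_into U \<phi>))"

definition transition :: "('m, 'n::finite) chart \<Rightarrow> ('m, 'n) chart \<Rightarrow> real^'n \<Rightarrow> real^'n" where
  "transition c d = snd d \<circ> inv_into (fst c) (snd c)"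

definition compatible :: "('m, 'n::finite) chart \<Rightarrow> ('m, 'n) chart \<Rightarrow> bool" where
  "compatible c d \<longleftrightarrow>
     smooth_on (snd c ` (fst c \<inter> fst d)) (transition c d) \<and>
     smooth_on (snd d ` (fst c \<inter> fst d)) (transition d c)"

text \<open>A smooth structure on the space \<open>'m\<close> is a maximal smooth atlas.  Hence "for all charts
  in \<open>\<A>\<close>" below means "in all local coordinate systems".\<close>

definition smooth_structure ::
    "('m::{t2_space,second_countable_topology}, 'n::finite) chart set \<Rightarrow> bool" where
  "smooth_structure \<A> \<longleftrightarrow>
     (\<forall>c\<in>\<A>. is_chart c) \<and>
     (\<Union>c\<in>\<A>. fst c) = UNIV \<and>
     (\<forall>c\<in>\<A>. \<forall>d\<in>\<A>. compatible c d) \<and>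
     (\<forall>c. is_chart c \<longrightarrow> (\<forall>d\<in>\<A>. compatible c d) \<longrightarrow> c \<in> \<A>)"

definition orientable :: "('m, 'n::finite) chart set \<Rightarrow> bool" where
  "orientable \<A> \<longleftrightarrow> (\<exists>\<B>\<subseteq>\<A>. (\<Union>c\<in>\<B>. fst c) = UNIV \<and>
     (\<forall>c\<in>\<B>. \<forall>d\<in>\<B>. \<forall>x \<in> snd c ` (fst c \<inter> fst d).
        det (matrix (frechet_derivative (transition c d) (at x))) > 0))"

text \<open>The expression of a map on the manifold in a chart, and the part of \<open>\<real>\<^sup>n\<close> on which it
  is meaningful.\<close>

definition in_chart :: "('m, 'n::finite) chart \<Rightarrow> ('m \<Rightarrow> 'b) \<Rightarrow> real^'n \<Rightarrow> 'b" where
  "in_chart c f = f \<circ> inv_into (fst c) (snd c)"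

definition coord_dom :: "('m, 'n::finite) chart \<Rightarrow> (real^'n) set" where
  "coord_dom c = snd c ` fst c"

definition smooth_map :: "('m, 'n::finite) chart set \<Rightarrow> ('m \<Rightarrow> 'b::real_normed_vector) \<Rightarrow> bool" where
  "smooth_map \<A> f \<longleftrightarrow> (\<forall>c\<in>\<A>. smooth_on (coord_dom c) (in_chart c f))"

definition immersion :: "('m, 'n::finite) chart set \<Rightarrow> ('m \<Rightarrow> 'b::real_normed_vector) \<Rightarrow> bool" where
  "immersion \<A> f \<longleftrightarrow> smooth_map \<A> f \<and>
     (\<forall>c\<in>\<A>. \<forall>x\<in>coord_dom c. inj (frechet_derivative (in_chart c f) (at x)))"


section \<open>Affine geometry of a hypersurface in local coordinates\<close>

text \<open>Below, \<open>F\<close> and \<open>C\<close> are the coordinate expressions, on an open \<open>V \<subseteq> \<real>\<^sup>3\<close>, of an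
  immersion into \<open>\<real>\<^sup>4\<close> and of a vector field along it; a vector field \<open>X\<close> on \<open>V\<close> is given by
  its components.  \<open>deriv_along X G\<close> is \<open>D\<^sub>X G\<close>, \<open>push F X\<close> is \<open>F\<^sub>* X\<close>, and \<open>lie X Y\<close> is \<open>[X, Y]\<close>.\<close>

type_synonym vfield = "real^3 \<Rightarrow> real^3"

definition deriv_along :: "vfield \<Rightarrow> (real^3 \<Rightarrow> 'b::real_normed_vector) \<Rightarrow> real^3 \<Rightarrow> 'b" where
  "deriv_along X G x = frechet_derivative G (at x) (X x)"

definition push :: "(real^3 \<Rightarrow> real^4) \<Rightarrow> vfield \<Rightarrow> real^3 \<Rightarrow> real^4" where
  "push F X x = frechet_derivative F (at x) (X x)"

definition lie :: "vfield \<Rightarrow> vfield \<Rightarrow> vfield" where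
  "lie X Y x = deriv_along X Y x - deriv_along Y X x"

definition tangent_image :: "(real^3 \<Rightarrow> real^4) \<Rightarrow> real^3 \<Rightarrow> (real^4) set" where
  "tangent_image F x = range (frechet_derivative F (at x))"

text \<open>The components \<open>v\<close> and \<open>a\<close> of \<open>w = F\<^sub>* v + a C\<close> at \<open>x\<close>; they are unique when
  \<open>F\<^sub>*\<close> is injective and \<open>C\<close> is transversal at \<open>x\<close>.\<close>

definition tangential :: "(real^3 \<Rightarrow> real^4) \<Rightarrow> (real^3 \<Rightarrow> real^4) \<Rightarrow> real^3 \<Rightarrow> real^4 \<Rightarrow> real^3" where
  "tangential F C x w = (THE v. \<exists>a. w = frechet_derivative F (at x) v + a *\<^sub>R C x)"

definition transversal :: "(real^3 \<Rightarrow> real^4) \<Rightarrow> (real^3 \<Rightarrow> real^4) \<Rightarrow> real^3 \<Rightarrow> real^4 \<Rightarrow> real" where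
  "transversal F C x w = (THE a. \<exists>v. w = frechet_derivative F (at x) v + a *\<^sub>R C x)"

text \<open>The formulas of Gauss, \<open>D\<^sub>X F\<^sub>* Y = F\<^sub>* (\<nabla>\<^sub>X Y) + h(X, Y) C\<close>, and of Weingarten,
  \<open>D\<^sub>X C = - F\<^sub>* (S X) + \<tau>(X) C\<close>, define the connection, \<open>h\<close> and \<open>S\<close>.\<close>

definition conn :: "(real^3 \<Rightarrow> real^4) \<Rightarrow> (real^3 \<Rightarrow> real^4) \<Rightarrow> vfield \<Rightarrow> vfield \<Rightarrow> vfield" where
  "conn F C X Y x = tangential F C x (deriv_along X (push F Y) x)"

definition aff_metric ::
    "(real^3 \<Rightarrow> real^4) \<Rightarrow> (real^3 \<Rightarrow> real^4) \<Rightarrow> vfield \<Rightarrow> vfield \<Rightarrow> real^3 \<Rightarrow> real" where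
  "aff_metric F C X Y x = transversal F C x (deriv_along X (push F Y) x)"

definition shape :: "(real^3 \<Rightarrow> real^4) \<Rightarrow> (real^3 \<Rightarrow> real^4) \<Rightarrow> vfield \<Rightarrow> vfield" where
  "shape F C X x = - tangential F C x (deriv_along X C x)"

definition nondegenerate_on ::
    "(real^3) set \<Rightarrow> (real^3 \<Rightarrow> real^4) \<Rightarrow> (real^3 \<Rightarrow> real^4) \<Rightarrow> bool" where
  "nondegenerate_on V F C \<longleftrightarrow> (\<forall>x\<in>V. \<forall>X. smooth_on V X \<longrightarrow>
     (\<forall>Y. smooth_on V Y \<longrightarrow> aff_metric F C X Y x = 0) \<longrightarrow> X x = 0)"

text \<open>The induced volume form \<open>\<Theta>\<close>, evaluated on a triple of vector fields.\<close>

definition ind_vol :: "(real^3 \<Rightarrow> real^4) \<Rightarrow> (real^3 \<Rightarrow> real^4) \<Rightarrow> (3 \<Rightarrow> vfield) \<Rightarrow> real^3 \<Rightarrow> real" where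
  "ind_vol F C X x =
     det (vector [push F (X 1) x, push F (X 2) x, push F (X 3) x, C x] :: real^4^4)"

text \<open>The metric volume form \<open>\<omega>\<^sub>h\<close>: on bases that are positively oriented with respect to
  \<open>\<Theta>\<close> it is \<open>\<bar>det [h(X\<^sub>i, X\<^sub>j)]\<bar>\<^sup>1\<^sup>/\<^sup>2\<close>, and the sign extends this to an alternating form.\<close>

definition metric_vol :: "(real^3 \<Rightarrow> real^4) \<Rightarrow> (real^3 \<Rightarrow> real^4) \<Rightarrow> (3 \<Rightarrow> vfield) \<Rightarrow> real^3 \<Rightarrow> real" where
  "metric_vol F C X x = sgn (ind_vol F C X x) *
     sqrt \<bar>det (\<chi> i j. aff_metric F C (X i) (X j) x :: real^3^3)\<bar>"

text \<open>\<open>(\<nabla>\<^sub>X \<omega>)(Y\<^sub>1, Y\<^sub>2, Y\<^sub>3)\<close> for a form \<open>\<omega>\<close> of degree three.\<close>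

definition cov_deriv_vol :: "(real^3 \<Rightarrow> real^4) \<Rightarrow> (real^3 \<Rightarrow> real^4) \<Rightarrow>
    ((3 \<Rightarrow> vfield) \<Rightarrow> real^3 \<Rightarrow> real) \<Rightarrow> vfield \<Rightarrow> (3 \<Rightarrow> vfield) \<Rightarrow> real^3 \<Rightarrow> real" where
  "cov_deriv_vol F C \<omega> X Y x =
     deriv_along X (\<omega> Y) x - (\<Sum>i\<in>UNIV. \<omega> (Y(i := conn F C X (Y i))) x)"

definition blaschke_on :: "(real^3) set \<Rightarrow> (real^3 \<Rightarrow> real^4) \<Rightarrow> (real^3 \<Rightarrow> real^4) \<Rightarrow> bool" where
  "blaschke_on V F C \<longleftrightarrow>
     (\<forall>x\<in>V. C x \<notin> tangent_image F x) \<and>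
     nondegenerate_on V F C \<and>
     (\<forall>X Y. smooth_on V X \<longrightarrow> (\<forall>i. smooth_on V (Y i)) \<longrightarrow>
        (\<forall>x\<in>V. cov_deriv_vol F C (metric_vol F C) X Y x = 0)) \<and>
     (\<forall>Y. (\<forall>i. smooth_on V (Y i)) \<longrightarrow>
        (\<forall>x\<in>V. metric_vol F C Y x = ind_vol F C Y x))"


section \<open>Para-complex tangent affine hyperspheres\<close>

text \<open>Coordinates of \<open>\<real>\<^sup>4\<close> are ordered as \<open>(x\<^sub>1, x\<^sub>2, y\<^sub>1, y\<^sub>2)\<close>.\<close>

definition Jt :: "real^4 \<Rightarrow> real^4" where
  "Jt w = vector [w$3, w$4, w$1, w$2]"

definition Jt_affine :: "(real^4 \<Rightarrow> real^4) \<Rightarrow> bool" where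
  "Jt_affine A \<longleftrightarrow> (\<exists>L b. linear L \<and> bij L \<and> L \<circ> Jt = Jt \<circ> L \<and> A = (\<lambda>w. L w + b))"

definition blaschke_field ::
    "('m, 3) chart set \<Rightarrow> ('m \<Rightarrow> real^4) \<Rightarrow> ('m \<Rightarrow> real^4) \<Rightarrow> bool" where
  "blaschke_field \<A> f C \<longleftrightarrow> smooth_map \<A> C \<and>
     (\<forall>c\<in>\<A>. blaschke_on (coord_dom c) (in_chart c f) (in_chart c C))"

definition shape_is_scalar ::
    "('m, 3) chart set \<Rightarrow> ('m \<Rightarrow> real^4) \<Rightarrow> ('m \<Rightarrow> real^4) \<Rightarrow> real \<Rightarrow> bool" where
  "shape_is_scalar \<A> f C l \<longleftrightarrow> (\<forall>c\<in>\<A>. \<forall>X. smooth_on (coord_dom c) X \<longrightarrow>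
     (\<forall>x\<in>coord_dom c. shape (in_chart c f) (in_chart c C) X x = l *\<^sub>R X x))"

definition Jt_tangent_field ::
    "('m, 3) chart set \<Rightarrow> ('m \<Rightarrow> real^4) \<Rightarrow> ('m \<Rightarrow> real^4) \<Rightarrow> bool" where
  "Jt_tangent_field \<A> f C \<longleftrightarrow> (\<forall>c\<in>\<A>. \<forall>x\<in>coord_dom c.
     Jt (in_chart c C x) \<in> tangent_image (in_chart c f) x)"

definition Jt_tangent_affine_hypersphere :: "('m, 3) chart set \<Rightarrow> ('m \<Rightarrow> real^4) \<Rightarrow> bool" where
  "Jt_tangent_affine_hypersphere \<A> f \<longleftrightarrow> immersion \<A> f \<and>
     (\<exists>C. blaschke_field \<A> f C \<and> (\<exists>l. shape_is_scalar \<A> f C l) \<and> Jt_tangent_field \<A> f C)"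

text \<open>The distribution \<open>\<D>\<close> in local coordinates.  Involutivity is tested on the vector fields
  on coordinate domains that are sections of \<open>\<D>\<close>.\<close>

definition distr :: "(real^3 \<Rightarrow> real^4) \<Rightarrow> real^3 \<Rightarrow> (real^3) set" where
  "distr F x = frechet_derivative F (at x) -` (tangent_image F x \<inter> Jt ` tangent_image F x)"

definition involutive_distr :: "('m, 3) chart set \<Rightarrow> ('m \<Rightarrow> real^4) \<Rightarrow> bool" where
  "involutive_distr \<A> f \<longleftrightarrow> (\<forall>c\<in>\<A>. \<forall>X Y.
     smooth_on (coord_dom c) X \<longrightarrow> smooth_on (coord_dom c) Y \<longrightarrow>
     (\<forall>x\<in>coord_dom c. X x \<in> distr (in_chart c f) x \<and> Y x \<in> distr (in_chart c f) x) \<longrightarrow>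
     (\<forall>x\<in>coord_dom c. lie X Y x \<in> distr (in_chart c f) x))"


section \<open>The model hypersurfaces\<close>

definition f1 :: "real \<Rightarrow> real \<Rightarrow> real \<Rightarrow> real^4" where
  "f1 x y z =
     cosh z *\<^sub>R vector [cos x + cos y, sin x + sin y, cos x - cos y, sin x - sin y]
   - sinh z *\<^sub>R vector [cos x - cos y, sin x - sin y, cos x + cos y, sin x + sin y]"

definition f2 :: "real \<Rightarrow> real \<Rightarrow> real \<Rightarrow> real^4" where
  "f2 x y z =
     cosh z *\<^sub>R vector [cosh x + cosh y, sinh x + sinh y, cosh x - cosh y, sinh x - sinh y]
   - sinh z *\<^sub>R vector [cosh x - cosh y, sinh x - sinh y, cosh x + cosh y, sinh x + sinh y]"

definition f3 :: "real \<Rightarrow> real \<Rightarrow> real \<Rightarrow> real^4" where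
  "f3 x y z =
     cosh z *\<^sub>R vector [cos x + cosh y, sin x + sinh y, cos x - cosh y, sin x - sinh y]
   - sinh z *\<^sub>R vector [cos x - cosh y, sin x - sinh y, cos x + cosh y, sin x + sinh y]"

definition f4 :: "real \<Rightarrow> real \<Rightarrow> real \<Rightarrow> real^4" where
  "f4 x y z =
     cosh z *\<^sub>R vector [cosh x + cos y, sinh x + sin y, cosh x - cos y, sinh x - sin y]
   - sinh z *\<^sub>R vector [cosh x - cos y, sinh x - sin y, cosh x + cos y, sinh x + sin y]"

end

(*
  Identify \<real>^4 with \<real>^2 \<times> \<real>^2 by splitting it into the eigenspaces of Jt.  The Jt-invariant affine
  maps are then the pairs of affine maps of the two planes, and each model is a pair of central
  conics (exp (- z) \<gamma>(x), exp z \<eta>(y)).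

  Since \<nabla>\<Theta> = 0 forces \<tau> = 0, the Blaschke field satisfies D C = - l D f.  If l = 0, then C and hence the
  tangent vector Jt C are constant, which makes h degenerate.  So C = - l (f - b) locally, and f - b = (u, v)
  is transversal while Jt (f - b) = (u, - v) is tangent.  Let s and t be the slopes of u and v, and let \<sigma>
  be half the logarithm of the quotient u_1 / v_1.  These are coordinates on M, in which

    u = exp (B + \<sigma>) (1, s),   v = exp (B - \<sigma>) (1, t).

  Tangency of Jt (f - b) says \<partial>B/\<partial>\<sigma> = 0, involutivity of the distribution says \<partial>\<^sup>2B/\<partial>s\<partial>t = 0, and equality
  of the volume forms says that |(B_ss - 2 B_s^2) (B_tt - 2 B_t^2)| = const exp (8 B).  Hence exp (- 4 B) is a
  product p(s) q(t) where 2 p p'' - p'^2 is a nonzero constant; differentiating gives p''' = 0, so that p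
  and likewise q are nondegenerate quadratic polynomials and u and v run over scaled conics.
*)

theory Submission
  imports Defs
begin

section \<open>Calculus of smooth maps\<close>

text \<open>The exponent -4 is forced. For q = exp (c B) in one variable, q q'' - q'^2 / 2 = c (B''
  + (c/2) B'^2) q^2. Matching B'' - 2 B'^2 gives c = -4, and then q^2 = exp (-8 B) cancels the
  factor exp (8 B) of the volume equation. That equation fixes only an absolute value, so the sign
  of the discriminant of each quadratic stays free; it decides between circle and hyperbola in each
  plane, whence four models. The conclusion asks for charts of the maximal atlas, and two changes of
  coordinates lead to them: to (s, t, \<sigma>), then to the parameters of the conics. This takes a
  smooth inverse function theorem and a lemma that produces charts. The hypotheses on f hold in
  every chart, so after the first change they are not transformed but read again in the new chart.
  Slopes and logarithms need u_1 and v_1 to be positive; a \<open>Jt\<close>-linear map applied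
  beforehand brings the base point to u = v = (1, 0), that is, to s = t = \<sigma> = 0.\<close>

lemma Ck_on_cong:
  assumes "open U" "\<And>x. x \<in> U \<Longrightarrow> f x = g x" "Ck_on k f U"
  shows "Ck_on k g U"
  using assms
proof (induction k arbitrary: f g)
  case 0
  have "continuous_on U f \<longleftrightarrow> continuous_on U g"
    by (rule continuous_on_cong[OF refl]) (rule 0(2))
  then show ?case using 0(3) by simp
next
  case (Suc k)
  have eq: "frechet_derivative f (at x) = frechet_derivative g (at x)" if "x \<in> U" for x
    by (rule frechet_derivative_transform_within_open[of f x U g]) (use Suc that in auto)
  have "g differentiable (at x)" if "x \<in> U" for x
    using has_derivative_transform_within_open[of f _ x UNIV U g] Suc.prems that
    by (fastforce simp: differentiable_def)
  moreover have "Ck_on k (\<lambda>x. frechet_derivative g (at x) v) U" for v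
    by (rule Suc.IH[of "\<lambda>x. frechet_derivative f (at x) v"]) (use Suc.prems eq in auto)
  ultimately show ?case by simp
qed

lemma Ck_on_subset: "Ck_on k f U \<Longrightarrow> V \<subseteq> U \<Longrightarrow> Ck_on k f V"
  by (induction k arbitrary: f) (auto intro: continuous_on_subset)

lemma Ck_on_SucD: "Ck_on (Suc k) f U \<Longrightarrow> Ck_on k f U"
proof (induction k arbitrary: f)
  case 0
  then have "isCont f x" if "x \<in> U" for x
    using that by (auto intro: differentiable_imp_continuous_within)
  then show ?case by (simp add: continuous_at_imp_continuous_on)
next
  case (Suc k)
  have "Ck_on k (\<lambda>x. frechet_derivative f (at x) v) U" for v
    by (rule Suc.IH) (use Suc.prems in auto)
  then show ?case using Suc.prems by (subst Ck_on.simps(2)) (subst (asm) Ck_on.simps(2), blast)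
qed

text \<open>Uniqueness of derivatives lets any explicit formula stand in for
  \<open>frechet_derivative\<close>; sums, products and the chain rule are all proved through
  it.\<close>

lemma Ck_on_SucI:
  assumes "open U" "\<And>x. x \<in> U \<Longrightarrow> (f has_derivative f' x) (at x)"
    and "\<And>v. Ck_on k (\<lambda>x. f' x v) U"
  shows "Ck_on (Suc k) f U"
proof -
  have eq: "frechet_derivative f (at x) = f' x" if "x \<in> U" for x
    using frechet_derivative_at[OF assms(2)[OF that]] by simp
  have "Ck_on k (\<lambda>x. frechet_derivative f (at x) v) U" for v
    by (rule Ck_on_cong[OF assms(1) _ assms(3)[of v]]) (use eq in auto)
  then show ?thesis using assms(2) by (auto simp: differentiable_def)
qed

lemma Ck_on_const [simp]: "Ck_on k (\<lambda>x. c) U"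
  by (induction k arbitrary: c) auto

lemma Ck_on_has_derivative:
  "Ck_on (Suc k) f U \<Longrightarrow> x \<in> U \<Longrightarrow> (f has_derivative frechet_derivative f (at x)) (at x)"
  using frechet_derivative_works by auto

lemma Ck_on_bounded_linear:
  assumes "bounded_linear L" "open U" "Ck_on k f U"
  shows "Ck_on k (\<lambda>x. L (f x)) U"
  using assms(3)
proof (induction k arbitrary: f)
  case 0
  then show ?case using assms(1) by (auto intro: bounded_linear.continuous_on)
next
  case (Suc k)
  show ?case
  proof (rule Ck_on_SucI[OF assms(2)])
    show "((\<lambda>x. L (f x)) has_derivative (\<lambda>v. L (frechet_derivative f (at x) v))) (at x)"
      if "x \<in> U" for x
      using bounded_linear.has_derivative[OF assms(1) Ck_on_has_derivative[OF Suc.prems that]] .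
    show "Ck_on k (\<lambda>x. L (frechet_derivative f (at x) v)) U" for v
      using Suc by simp
  qed
qed

lemma Ck_on_add:
  assumes "open U" "Ck_on k f U" "Ck_on k g U"
  shows "Ck_on k (\<lambda>x. f x + g x) U"
  using assms(2,3)
proof (induction k arbitrary: f g)
  case 0
  then show ?case by (auto intro: continuous_on_add)
next
  case (Suc k)
  show ?case
  proof (rule Ck_on_SucI[OF assms(1)])
    show "((\<lambda>x. f x + g x) has_derivative
        (\<lambda>v. frechet_derivative f (at x) v + frechet_derivative g (at x) v)) (at x)"
      if "x \<in> U" for x
      by (rule has_derivative_add[OF Suc.prems[THEN Ck_on_has_derivative, OF that]])
    show "Ck_on k (\<lambda>x. frechet_derivative f (at x) v + frechet_derivative g (at x) v) U" for v
      using Suc by simp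
  qed
qed

lemma Ck_on_bilinear:
  assumes "bounded_bilinear P" "open U" "Ck_on k f U" "Ck_on k g U"
  shows "Ck_on k (\<lambda>x. P (f x) (g x)) U"
  using assms(3,4)
proof (induction k arbitrary: f g)
  case 0
  then show ?case using assms(1) by (auto intro: bounded_bilinear.continuous_on)
next
  case (Suc k)
  show ?case
  proof (rule Ck_on_SucI[OF assms(2)])
    show "((\<lambda>x. P (f x) (g x)) has_derivative
        (\<lambda>v. P (f x) (frechet_derivative g (at x) v) + P (frechet_derivative f (at x) v) (g x))) (at x)"
      if "x \<in> U" for x
      by (rule bounded_bilinear.FDERIV[OF assms(1) Suc.prems[THEN Ck_on_has_derivative, OF that]])
    \<comment> \<open>Each summand keeps one factor undifferentiated, whose order has to be lowered
      from k + 1 to k.\<close>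
    show "Ck_on k (\<lambda>x. P (f x) (frechet_derivative g (at x) v) +
        P (frechet_derivative f (at x) v) (g x)) U" for v
      using Suc.prems Suc.IH[of f "\<lambda>x. frechet_derivative g (at x) v"]
        Suc.IH[of "\<lambda>x. frechet_derivative f (at x) v" g] Ck_on_SucD[OF Suc.prems(1)] Ck_on_SucD[OF Suc.prems(2)]
      by (intro Ck_on_add assms(2)) auto
  qed
qed

lemma Ck_on_sum:
  assumes "open U" "\<And>i. i \<in> I \<Longrightarrow> Ck_on k (f i) U"
  shows "Ck_on k (\<lambda>x. \<Sum>i\<in>I. f i x) U"
  using assms(2)
proof (induction I rule: infinite_finite_induct)
  case (insert i I)
  then show ?case using Ck_on_add[OF assms(1), of k "f i" "\<lambda>x. \<Sum>i\<in>I. f i x"] by simp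
qed simp_all

lemma Ck_on_prod:
  fixes f :: "'i \<Rightarrow> 'a::euclidean_space \<Rightarrow> real"
  assumes "open U" "\<And>i. i \<in> I \<Longrightarrow> Ck_on k (f i) U"
  shows "Ck_on k (\<lambda>x. \<Prod>i\<in>I. f i x) U"
  using assms(2)
proof (induction I rule: infinite_finite_induct)
  case (insert i I)
  then show ?case
    using Ck_on_bilinear[OF bounded_bilinear_mult assms(1), of k "f i" "\<lambda>x. \<Prod>i\<in>I. f i x"] by simp
qed simp_all

lemma Ck_on_compose:
  fixes f :: "'a::euclidean_space \<Rightarrow> 'b::euclidean_space" and g :: "'b \<Rightarrow> 'c::real_normed_vector"
  assumes "open U" "open V" "Ck_on k f U" "Ck_on k g V" "f ` U \<subseteq> V"
  shows "Ck_on k (\<lambda>x. g (f x)) U"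
  using assms(3-5)
proof (induction k arbitrary: f g)
  case 0
  then show ?case using continuous_on_compose2[of V g U f] by simp
next
  case (Suc k)
  let ?f' = "\<lambda>x. frechet_derivative f (at x)" and ?g' = "\<lambda>y. frechet_derivative g (at y)"
  show ?case
  proof (rule Ck_on_SucI[OF assms(1)])
    \<comment> \<open>The chain rule gives \<open>?g' (f x) (?f' x v)\<close>, whose direction
      varies with x. Expanding it in the basis leaves derivatives of g in fixed directions, to which
      the induction hypothesis applies.\<close>
    show "((\<lambda>x. g (f x)) has_derivative (\<lambda>v. \<Sum>b\<in>Basis. (?f' x v \<bullet> b) *\<^sub>R ?g' (f x) b)) (at x)"
      if "x \<in> U" for x
    proof -
      have fx: "f x \<in> V" using that Suc.prems(3) by auto
      have g: "(g has_derivative ?g' (f x)) (at (f x))"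
        by (rule Ck_on_has_derivative[OF Suc.prems(2) fx])
      have "?g' (f x) w = (\<Sum>b\<in>Basis. (w \<bullet> b) *\<^sub>R ?g' (f x) b)" for w
        using linear_sum[OF has_derivative_linear[OF g], of "\<lambda>b. (w \<bullet> b) *\<^sub>R b" Basis]
          linear_scale[OF has_derivative_linear[OF g]] by (simp add: euclidean_representation)
      then have "(\<lambda>v. ?g' (f x) (?f' x v)) = (\<lambda>v. \<Sum>b\<in>Basis. (?f' x v \<bullet> b) *\<^sub>R ?g' (f x) b)"
        by blast
      then show ?thesis
        using has_derivative_compose[OF Ck_on_has_derivative[OF Suc.prems(1) that] g] by simp
    qed
    show "Ck_on k (\<lambda>x. \<Sum>b\<in>Basis. (?f' x v \<bullet> b) *\<^sub>R ?g' (f x) b) U" for v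
      by (intro Ck_on_sum Ck_on_bilinear[OF bounded_bilinear_scaleR]
          Ck_on_bounded_linear[OF bounded_linear_inner_left] assms(1) Suc.IH)
        (use Suc.prems Ck_on_SucD[OF Suc.prems(1)] in auto)
  qed
qed

lemma smooth_on_cong:
  "open U \<Longrightarrow> (\<And>x. x \<in> U \<Longrightarrow> f x = g x) \<Longrightarrow> smooth_on U f \<Longrightarrow> smooth_on U g"
  unfolding smooth_on_def by (metis Ck_on_cong)

lemma smooth_on_subset: "smooth_on U f \<Longrightarrow> V \<subseteq> U \<Longrightarrow> smooth_on V f"
  unfolding smooth_on_def by (metis Ck_on_subset)

lemma smooth_on_const [simp]: "smooth_on U (\<lambda>x. c)"
  unfolding smooth_on_def by simp

lemma smooth_on_bounded_linear:
  "bounded_linear L \<Longrightarrow> open U \<Longrightarrow> smooth_on U f \<Longrightarrow> smooth_on U (\<lambda>x. L (f x))"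
  unfolding smooth_on_def by (metis Ck_on_bounded_linear)

lemma smooth_on_add:
  "open U \<Longrightarrow> smooth_on U f \<Longrightarrow> smooth_on U g \<Longrightarrow> smooth_on U (\<lambda>x. f x + g x)"
  unfolding smooth_on_def by (metis Ck_on_add)

lemma smooth_on_bilinear:
  "bounded_bilinear P \<Longrightarrow> open U \<Longrightarrow> smooth_on U f \<Longrightarrow> smooth_on U g \<Longrightarrow> smooth_on U (\<lambda>x. P (f x) (g x))"
  unfolding smooth_on_def by (metis Ck_on_bilinear)

lemmas smooth_on_mult = smooth_on_bilinear[OF bounded_bilinear_mult]
lemmas smooth_on_scaleR = smooth_on_bilinear[OF bounded_bilinear_scaleR]

lemma smooth_on_compose:
  fixes f :: "'a::euclidean_space \<Rightarrow> 'b::euclidean_space" and g :: "'b \<Rightarrow> 'c::real_normed_vector"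
  shows "open U \<Longrightarrow> open V \<Longrightarrow> smooth_on U f \<Longrightarrow> smooth_on V g \<Longrightarrow> f ` U \<subseteq> V
    \<Longrightarrow> smooth_on U (\<lambda>x. g (f x))"
  unfolding smooth_on_def by (metis Ck_on_compose)

lemma smooth_on_minus:
  fixes f :: "'a::euclidean_space \<Rightarrow> 'b::real_normed_vector"
  shows "open U \<Longrightarrow> smooth_on U f \<Longrightarrow> smooth_on U (\<lambda>x. - f x)"
  using smooth_on_bounded_linear[OF bounded_linear_minus[OF bounded_linear_ident]] by blast

lemma smooth_on_diff:
  fixes f :: "'a::euclidean_space \<Rightarrow> 'b::real_normed_vector"
  shows "open U \<Longrightarrow> smooth_on U f \<Longrightarrow> smooth_on U g \<Longrightarrow> smooth_on U (\<lambda>x. f x - g x)"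
  using smooth_on_add[OF _ _ smooth_on_minus, of U f g] by simp

lemma smooth_on_ident: "open U \<Longrightarrow> smooth_on U (\<lambda>x. x)"
  unfolding smooth_on_def
proof
  fix k assume "open U"
  then show "Ck_on k (\<lambda>x. x) U"
    by (cases k) (auto intro: Ck_on_SucI[where f' = "\<lambda>x v. v"] )
qed

lemma smooth_on_vec_nth:
  fixes f :: "'a::euclidean_space \<Rightarrow> real^'n"
  shows "open U \<Longrightarrow> smooth_on U f \<Longrightarrow> smooth_on U (\<lambda>x. f x $ i)"
  using smooth_on_bounded_linear[OF bounded_linear_vec_nth] by blast

lemma Ck_on_vec_lambda:
  fixes f :: "'n::finite \<Rightarrow> 'a::euclidean_space \<Rightarrow> real"
  assumes "open U" "\<And>i. Ck_on k (f i) U"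
  shows "Ck_on k (\<lambda>x. \<chi> i. f i x) U"
proof -
  have "(\<chi> i. f i x) = (\<Sum>i\<in>UNIV. f i x *\<^sub>R axis i 1)" for x
    using basis_expansion[of "\<chi> i. f i x"] by (simp add: scalar_mult_eq_scaleR)
  moreover have "Ck_on k (\<lambda>x. \<Sum>i\<in>UNIV. f i x *\<^sub>R (axis i 1 :: real^'n)) U"
    by (intro Ck_on_sum Ck_on_bilinear[OF bounded_bilinear_scaleR] assms Ck_on_const)
  ultimately show ?thesis by simp
qed

lemma smooth_on_vec_lambda:
  fixes f :: "'n::finite \<Rightarrow> 'a::euclidean_space \<Rightarrow> real"
  shows "open U \<Longrightarrow> (\<And>i. smooth_on U (f i)) \<Longrightarrow> smooth_on U (\<lambda>x. \<chi> i. f i x)"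
  unfolding smooth_on_def by (blast intro: Ck_on_vec_lambda)

lemma smooth_on_frechet_derivative:
  "smooth_on U f \<Longrightarrow> smooth_on U (\<lambda>x. frechet_derivative f (at x) v)"
  unfolding smooth_on_def by (metis Ck_on.simps(2))

lemma smooth_on_has_derivative:
  "smooth_on U f \<Longrightarrow> x \<in> U \<Longrightarrow> (f has_derivative frechet_derivative f (at x)) (at x)"
  unfolding smooth_on_def by (metis Ck_on_has_derivative)

lemma smooth_on_continuous_on: "smooth_on U f \<Longrightarrow> continuous_on U f"
  unfolding smooth_on_def by (metis Ck_on.simps(1))

section \<open>Elementary functions, quotients and linear systems\<close>

lemma smooth_on_real_derivI:
  fixes f f' :: "real \<Rightarrow> real"
  assumes "open U" "\<And>x. x \<in> U \<Longrightarrow> (f has_real_derivative f' x) (at x)" "smooth_on U f'"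
  shows "smooth_on U f"
  unfolding smooth_on_def
proof
  fix k
  have *: "Ck_on (Suc k) f U"
  proof (rule Ck_on_SucI[OF assms(1)])
    show "(f has_derivative (\<lambda>v. f' x * v)) (at x)" if "x \<in> U" for x
      using assms(2)[OF that] by (simp add: has_field_derivative_def)
    show "Ck_on k (\<lambda>x. f' x * v) U" for v
      using assms(3) Ck_on_bilinear[OF bounded_bilinear_mult assms(1), of k f' "\<lambda>x. v"]
      by (simp add: smooth_on_def)
  qed
  then show "Ck_on k f U" by (rule Ck_on_SucD)
qed

text \<open>The derivative is a polynomial in \<open>inverse\<close> itself, so the induction on k
  closes without a formula for the higher derivatives.\<close>

lemma smooth_on_real_inverse: "smooth_on (- {0}) (inverse :: real \<Rightarrow> real)"
  unfolding smooth_on_def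
proof
  have op: "open (- {0::real})" by auto
  fix k show "Ck_on k (inverse :: real \<Rightarrow> real) (- {0})"
  proof (induction k)
    case 0
    then show ?case by (auto intro!: continuous_intros)
  next
    case (Suc k)
    show ?case
    proof (rule Ck_on_SucI[OF op])
      show "(inverse has_derivative (\<lambda>v::real. - (inverse x * inverse x) * v)) (at x)"
        if "x \<in> - {0}" for x
      proof -
        have "(inverse has_real_derivative - (inverse x * inverse x)) (at x)"
          using DERIV_inverse'[OF DERIV_ident, of x UNIV] that by simp
        then show ?thesis unfolding has_field_derivative_def by this
      qed
      show "Ck_on k (\<lambda>x::real. - (inverse x * inverse x) * v) (- {0})" for v
        using Ck_on_bilinear[OF bounded_bilinear_mult op Ck_on_bilinear[OF bounded_bilinear_mult op Suc Suc] Ck_on_const, of "- v"]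
        by simp
    qed
  qed
qed

lemma Ck_on_divide:
  fixes f g :: "'a::euclidean_space \<Rightarrow> real"
  assumes "open U" "Ck_on k f U" "Ck_on k g U" "\<And>x. x \<in> U \<Longrightarrow> g x \<noteq> 0"
  shows "Ck_on k (\<lambda>x. f x / g x) U"
proof -
  have "Ck_on k (\<lambda>x. inverse (g x)) U"
    by (rule Ck_on_compose[OF assms(1) _ assms(3), of "- {0}"])
      (use smooth_on_real_inverse assms(4) in \<open>auto simp: smooth_on_def\<close>)
  then show ?thesis
    using Ck_on_bilinear[OF bounded_bilinear_mult assms(1,2)] by (simp add: divide_inverse)
qed

lemma smooth_on_divide:
  fixes f g :: "'a::euclidean_space \<Rightarrow> real"
  shows "open U \<Longrightarrow> smooth_on U f \<Longrightarrow> smooth_on U g \<Longrightarrow> (\<And>x. x \<in> U \<Longrightarrow> g x \<noteq> 0)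
    \<Longrightarrow> smooth_on U (\<lambda>x. f x / g x)"
  unfolding smooth_on_def by (blast intro: Ck_on_divide)

lemma smooth_on_inverse:
  fixes f :: "'a::euclidean_space \<Rightarrow> real"
  shows "open U \<Longrightarrow> smooth_on U f \<Longrightarrow> (\<And>x. x \<in> U \<Longrightarrow> f x \<noteq> 0)
    \<Longrightarrow> smooth_on U (\<lambda>x. inverse (f x))"
  using smooth_on_divide[OF _ smooth_on_const, of U f 1] by (simp add: divide_inverse)

lemma smooth_on_ln:
  fixes f :: "'a::euclidean_space \<Rightarrow> real"
  assumes "open U" "smooth_on U f" "\<And>x. x \<in> U \<Longrightarrow> f x > 0"
  shows "smooth_on U (\<lambda>x. ln (f x))"
proof (rule smooth_on_compose[OF assms(1) _ assms(2)])
  show "smooth_on {0<..} (ln :: real \<Rightarrow> real)"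
    by (rule smooth_on_real_derivI[where f' = inverse])
      (auto intro: DERIV_ln smooth_on_subset[OF smooth_on_real_inverse])
qed (use assms(3) in auto)

lemma smooth_on_arctan:
  fixes f :: "'a::euclidean_space \<Rightarrow> real"
  assumes "open U" "smooth_on U f"
  shows "smooth_on U (\<lambda>x. arctan (f x))"
proof (rule smooth_on_compose[OF assms(1) open_UNIV assms(2)])
  show "smooth_on UNIV arctan"
  proof (rule smooth_on_real_derivI[OF open_UNIV DERIV_arctan])
    have "1 + x * x \<noteq> 0" for x :: real
      using add_pos_nonneg[of 1 "x * x"] by simp
    then show "smooth_on UNIV (\<lambda>x::real. inverse (1 + x\<^sup>2))"
      unfolding power2_eq_square
      by (intro smooth_on_inverse smooth_on_add smooth_on_mult smooth_on_ident) auto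
  qed
qed auto

lemma Ck_on_det:
  fixes M :: "'a::euclidean_space \<Rightarrow> real^'n^'n"
  assumes "open U" "\<And>i j. Ck_on k (\<lambda>x. M x $ i $ j) U"
  shows "Ck_on k (\<lambda>x. det (M x)) U"
  unfolding det_def
  by (intro Ck_on_sum Ck_on_bilinear[OF bounded_bilinear_mult] Ck_on_prod assms Ck_on_const)

text \<open>By Cramer's rule.\<close>

lemma Ck_on_linear_solve:
  fixes M :: "'a::euclidean_space \<Rightarrow> real^'n^'n" and s b :: "'a \<Rightarrow> real^'n"
  assumes "open U" "\<And>i j. Ck_on k (\<lambda>x. M x $ i $ j) U" "\<And>i. Ck_on k (\<lambda>x. b x $ i) U"
    and "\<And>x. x \<in> U \<Longrightarrow> det (M x) \<noteq> 0" "\<And>x. x \<in> U \<Longrightarrow> M x *v s x = b x"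
  shows "Ck_on k s U"
proof -
  let ?t = "\<lambda>x. \<chi> k. det (\<chi> i j. if j = k then b x $ i else M x $ i $ j) / det (M x)"
  have "Ck_on k ?t U"
  proof (intro Ck_on_vec_lambda Ck_on_divide Ck_on_det assms)
    fix l i j
    show "Ck_on k (\<lambda>x. (\<chi> i j. if j = l then b x $ i else M x $ i $ j) $ i $ j) U"
      using assms(2,3) by (cases "j = l") simp_all
  qed
  moreover have "?t x = s x" if "x \<in> U" for x
    using cramer[OF assms(4)[OF that], of "s x" "b x"] assms(5)[OF that] by simp
  ultimately show ?thesis by (rule Ck_on_cong[OF assms(1), rotated])
qed

lemma smooth_on_linear_solve:
  fixes M :: "'a::euclidean_space \<Rightarrow> real^'n^'n" and s b :: "'a \<Rightarrow> real^'n"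
  assumes "open U" "\<And>i j. smooth_on U (\<lambda>x. M x $ i $ j)" "smooth_on U b"
    and "\<And>x. x \<in> U \<Longrightarrow> det (M x) \<noteq> 0" "\<And>x. x \<in> U \<Longrightarrow> M x *v s x = b x"
  shows "smooth_on U s"
  using assms(2) smooth_on_vec_nth[OF assms(1,3)] Ck_on_linear_solve[of U _ M b s] assms(1,4,5)
  unfolding smooth_on_def by blast

text \<open>Two applications of the mean value theorem, first in direction v and then in direction
  w. The second difference is symmetric in v and w while the derivative on the right is not a
  priori; symmetry of second derivatives will come from this.\<close>

lemma second_difference:
  fixes f :: "'a::euclidean_space \<Rightarrow> real"
  assumes "smooth_on U f" "ball x d \<subseteq> U" "t > 0" "t * (norm v + norm w) < d"
  obtains y where "y \<in> ball x d"
    "f (x + t *\<^sub>R v + t *\<^sub>R w) - f (x + t *\<^sub>R v) - f (x + t *\<^sub>R w) + f x =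
      t * t * frechet_derivative (\<lambda>z. frechet_derivative f (at z) v) (at y) w"
proof -
  let ?D = "\<lambda>z. frechet_derivative f (at z)"
  let ?P = "\<lambda>y. frechet_derivative (\<lambda>z. ?D z v) (at y)"
  have inball: "x + a *\<^sub>R v + b *\<^sub>R w \<in> ball x d" if "0 \<le> a" "a \<le> t" "0 \<le> b" "b \<le> t" for a b
  proof -
    have "norm (a *\<^sub>R v + b *\<^sub>R w) \<le> a * norm v + b * norm w"
      using norm_triangle_ineq[of "a *\<^sub>R v" "b *\<^sub>R w"] that by simp
    also have "\<dots> \<le> t * (norm v + norm w)"
      using that by (simp add: distrib_left add_mono mult_right_mono)
    finally show ?thesis using assms(4)
      by (metis add.assoc add_diff_cancel_left' dist_norm dist_commute mem_ball order_le_less_trans)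
  qed
  have d1: "((\<lambda>a. f (x + a *\<^sub>R v + b *\<^sub>R w)) has_real_derivative ?D (x + a *\<^sub>R v + b *\<^sub>R w) v) (at a)"
    if "0 \<le> a" "a \<le> t" "0 \<le> b" "b \<le> t" for a b
  proof -
    have "((\<lambda>a. x + a *\<^sub>R v + b *\<^sub>R w) has_derivative (\<lambda>h. h *\<^sub>R v)) (at a)"
      by (auto intro!: derivative_eq_intros)
    moreover have "x + a *\<^sub>R v + b *\<^sub>R w \<in> U" using inball[OF that] assms(2) by blast
    ultimately have "((\<lambda>a. f (x + a *\<^sub>R v + b *\<^sub>R w)) has_derivative
        (\<lambda>h. ?D (x + a *\<^sub>R v + b *\<^sub>R w) (h *\<^sub>R v))) (at a)"
      using has_derivative_compose smooth_on_has_derivative[OF assms(1)] by blast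
    moreover have "linear (?D (x + a *\<^sub>R v + b *\<^sub>R w))"
      using smooth_on_has_derivative[OF assms(1) \<open>_ \<in> U\<close>] has_derivative_linear by blast
    ultimately show ?thesis
      by (simp add: has_field_derivative_def linear_scale mult_commute_abs)
  qed
  have d2: "((\<lambda>b. ?D (x + a *\<^sub>R v + b *\<^sub>R w) v) has_real_derivative ?P (x + a *\<^sub>R v + b *\<^sub>R w) w) (at b)"
    if "0 \<le> a" "a \<le> t" "0 \<le> b" "b \<le> t" for a b
  proof -
    have "((\<lambda>b. x + a *\<^sub>R v + b *\<^sub>R w) has_derivative (\<lambda>h. h *\<^sub>R w)) (at b)"
      by (auto intro!: derivative_eq_intros)
    moreover have "x + a *\<^sub>R v + b *\<^sub>R w \<in> U" using inball[OF that] assms(2) by blast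
    moreover note * = smooth_on_has_derivative[OF smooth_on_frechet_derivative[OF assms(1), of v]]
    ultimately have "((\<lambda>b. ?D (x + a *\<^sub>R v + b *\<^sub>R w) v) has_derivative
        (\<lambda>h. ?P (x + a *\<^sub>R v + b *\<^sub>R w) (h *\<^sub>R w))) (at b)"
      using has_derivative_compose[of "\<lambda>b. x + a *\<^sub>R v + b *\<^sub>R w" _ b UNIV "\<lambda>z. ?D z v"] by blast
    moreover have "linear (?P (x + a *\<^sub>R v + b *\<^sub>R w))"
      using *[OF \<open>_ \<in> U\<close>] has_derivative_linear by blast
    ultimately show ?thesis
      by (simp add: has_field_derivative_def linear_scale mult_commute_abs)
  qed
  obtain a where a: "0 < a" "a < t"
    "(f (x + t *\<^sub>R v + t *\<^sub>R w) - f (x + t *\<^sub>R v)) - (f (x + t *\<^sub>R w) - f x) =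
      t * (?D (x + a *\<^sub>R v + t *\<^sub>R w) v - ?D (x + a *\<^sub>R v) v)"
    using MVT2[OF \<open>t > 0\<close>, of "\<lambda>a. f (x + a *\<^sub>R v + t *\<^sub>R w) - f (x + a *\<^sub>R v + 0 *\<^sub>R w)"
        "\<lambda>a. ?D (x + a *\<^sub>R v + t *\<^sub>R w) v - ?D (x + a *\<^sub>R v + 0 *\<^sub>R w) v"] DERIV_diff[OF d1[of _ t] d1[of _ 0]] \<open>t > 0\<close>
    by auto
  obtain b where b: "0 < b" "b < t"
    "?D (x + a *\<^sub>R v + t *\<^sub>R w) v - ?D (x + a *\<^sub>R v) v = t * ?P (x + a *\<^sub>R v + b *\<^sub>R w) w"
    using MVT2[OF \<open>t > 0\<close>, of "\<lambda>b. ?D (x + a *\<^sub>R v + b *\<^sub>R w) v" "\<lambda>b. ?P (x + a *\<^sub>R v + b *\<^sub>R w) w"]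
      d2[of a] a(1,2) by auto
  show thesis
    by (rule that[of "x + a *\<^sub>R v + b *\<^sub>R w"]) (use a b inball[of a b] in auto)
qed

text \<open>Both orders of differentiation express the same second difference, so they agree at two
  points near x. Were they different at x, continuity would keep them apart there.\<close>

lemma smooth_on_second_derivative_symmetric:
  fixes f :: "'a::euclidean_space \<Rightarrow> real"
  assumes "open U" "smooth_on U f" "x \<in> U"
  shows "frechet_derivative (\<lambda>z. frechet_derivative f (at z) v) (at x) w =
    frechet_derivative (\<lambda>z. frechet_derivative f (at z) w) (at x) v"
    (is "?P x = ?Q x")
proof (rule ccontr)
  define e where "e = \<bar>?P x - ?Q x\<bar> / 2"
  assume "?P x \<noteq> ?Q x"
  then have e: "e > 0" by (simp add: e_def)
  have "continuous_on U ?P" "continuous_on U ?Q"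
    using smooth_on_continuous_on smooth_on_frechet_derivative assms(2) by blast+
  then have "isCont ?P x" "isCont ?Q x"
    using assms(1,3) continuous_on_eq_continuous_at by blast+
  then obtain d1 d2 where d: "d1 > 0" "\<And>y. dist y x < d1 \<Longrightarrow> dist (?P y) (?P x) < e"
    "d2 > 0" "\<And>y. dist y x < d2 \<Longrightarrow> dist (?Q y) (?Q x) < e"
    using e unfolding continuous_at_eps_delta by (metis dist_norm)
  obtain d3 where d3: "d3 > 0" "ball x d3 \<subseteq> U" using assms(1,3) openE by blast
  define d where "d = min d1 (min d2 d3)"
  have d0: "d > 0" "ball x d \<subseteq> U" using d d3 by (auto simp: d_def)
  \<comment> \<open>The summand 1 keeps the denominator positive when v = w = 0 and puts the
    parallelogram strictly inside the ball.\<close>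
  define t where "t = d / (norm v + norm w + 1)"
  have n: "norm v + norm w + 1 > 0" by (smt (verit) norm_ge_zero)
  then have t: "t > 0" "t * (norm v + norm w + 1) = d" using d0 by (auto simp: t_def)
  then have tl: "t * (norm v + norm w) < d" "t * (norm w + norm v) < d" by (auto simp: algebra_simps)
  obtain y1 where y1: "y1 \<in> ball x d" "f (x + t *\<^sub>R v + t *\<^sub>R w) - f (x + t *\<^sub>R v) - f (x + t *\<^sub>R w) + f x = t * t * ?P y1"
    by (rule second_difference[OF assms(2) d0(2) t(1) tl(1)])
  obtain y2 where y2: "y2 \<in> ball x d" "f (x + t *\<^sub>R w + t *\<^sub>R v) - f (x + t *\<^sub>R w) - f (x + t *\<^sub>R v) + f x = t * t * ?Q y2"
    by (rule second_difference[OF assms(2) d0(2) t(1) tl(2)])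
  have "t * t * ?P y1 = t * t * ?Q y2" using y1(2) y2(2) by (simp add: algebra_simps)
  then have "?P y1 = ?Q y2" using t(1) by simp
  moreover have "dist y1 x < d1" "dist y2 x < d2"
    using y1(1) y2(1) by (auto simp: d_def dist_commute)
  then have "dist (?P y1) (?P x) < e" "dist (?Q y2) (?Q x) < e"
    using d(2,4) by blast+
  ultimately show False by (simp add: dist_real_def e_def field_simps abs_if split: if_splits)
qed

text \<open>Smoothness of the inverse is a bootstrap: the derivative of g at y is the inverse of the
  derivative of \<psi> at g y, so its values solve linear systems whose entries are as regular as g,
  and Cramer's rule gains one order.\<close>

lemma smooth_inverse_function:
  fixes \<psi> :: "real^'n \<Rightarrow> real^'n"
  assumes "open W" "smooth_on W \<psi>" "p \<in> W" "inj (frechet_derivative \<psi> (at p))"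
  obtains U V g where "open U" "U \<subseteq> W" "p \<in> U" "open V" "\<psi> p \<in> V" "homeomorphism U V \<psi> g"
    "smooth_on V g"
proof -
  let ?D = "\<lambda>x. frechet_derivative \<psi> (at x)"
  have der: "(\<psi> has_derivative ?D x) (at x)" if "x \<in> W" for x
    using smooth_on_has_derivative[OF assms(2) that] .
  have bl: "bounded_linear (?D x)" if "x \<in> W" for x
    using der[OF that] has_derivative_bounded_linear by blast
  then have ap: "blinfun_apply (Blinfun (?D x)) = ?D x" if "x \<in> W" for x
    using bounded_linear_Blinfun_apply that by blast
  have lin: "linear (?D x)" if "x \<in> W" for x
    using bl[OF that] bounded_linear.linear by blast
  obtain h where h: "linear h" "h \<circ> ?D p = id"
    using linear_injective_left_inverse[OF lin[OF assms(3)] assms(4)] by blast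
  have hb: "bounded_linear h" using h(1) linear_conv_bounded_linear by blast
  have inv: "Blinfun h o\<^sub>L Blinfun (?D p) = id_blinfun"
    by (rule blinfun_eqI) (use h(2) ap[OF assms(3)] in \<open>simp add: bounded_linear_Blinfun_apply[OF hb] fun_eq_iff\<close>)
  have cont: "continuous_on W (\<lambda>x. Blinfun (?D x))"
  proof (rule continuous_on_blinfun_componentwise)
    fix i :: "real^'n"
    have "continuous_on W (\<lambda>x. ?D x i)"
      by (rule smooth_on_continuous_on[OF smooth_on_frechet_derivative[OF assms(2)]])
    then show "continuous_on W (\<lambda>x. blinfun_apply (Blinfun (?D x)) i)"
      using ap by (simp cong: continuous_on_cong)
  qed
  have der': "(\<psi> has_derivative blinfun_apply (Blinfun (?D x))) (at x)" if "x \<in> W" for x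
    using der ap that by simp
  from inverse_function_theorem[OF assms(1) der' cont assms(3) inv]
  obtain U V g g' where uv: "open U" "U \<subseteq> W" "p \<in> U" "open V" "\<psi> p \<in> V" "homeomorphism U V \<psi> g"
    and g: "\<And>y. y \<in> V \<Longrightarrow> (g has_derivative (g' y)) (at y)"
      "\<And>y. y \<in> V \<Longrightarrow> g' y = inv (blinfun_apply (Blinfun (?D (g y))))"
      "\<And>y. y \<in> V \<Longrightarrow> bij (blinfun_apply (Blinfun (?D (g y))))" by metis
  have gU: "g y \<in> U" if "y \<in> V" for y using uv(6) that by (auto simp: homeomorphism_def)
  have gW: "g y \<in> W" if "y \<in> V" for y using gU[OF that] uv(2) by blast
  have bij: "bij (?D (g y))" if "y \<in> V" for y using g(3)[OF that] ap[OF gW[OF that]] by simp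
  have "Ck_on k g V" for k
  proof (induction k)
    case 0
    then show ?case using uv(6) by (simp add: homeomorphism_def)
  next
    case (Suc k)
    show ?case
    proof (rule Ck_on_SucI[OF uv(4) g(1)])
      fix v
      show "Ck_on k (\<lambda>x. g' x v) V"
      proof (rule Ck_on_linear_solve[OF uv(4), where M = "\<lambda>y. matrix (?D (g y))" and b = "\<lambda>y. v"])
        fix i j
        have "Ck_on k (\<lambda>y. ?D (g y) (axis j 1)) V"
          by (rule Ck_on_compose[OF uv(4) assms(1) Suc])
            (use smooth_on_frechet_derivative[OF assms(2)] gW in \<open>auto simp: smooth_on_def\<close>)
        from Ck_on_bounded_linear[OF bounded_linear_vec_nth uv(4) this]
        show "Ck_on k (\<lambda>y. matrix (?D (g y)) $ i $ j) V" by (simp add: matrix_def)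
      next
        fix y assume y: "y \<in> V"
        have mat: "(*v) (matrix (?D (g y))) = ?D (g y)"
          using matrix_vector_mul(2)[OF lin[OF gW[OF y]]] .
        then show "matrix (?D (g y)) *v g' y v = v"
          using bij[OF y] g(2)[OF y] ap[OF gW[OF y]] by (simp add: bij_def surj_f_inv_f)
        show "det (matrix (?D (g y))) \<noteq> 0"
          using bij[OF y] mat by (simp flip: invertible_det_nz add: invertible_eq_bij)
      qed simp
    qed
  qed
  then have "smooth_on V g" by (simp add: smooth_on_def)
  with uv that show thesis by blast
qed

section \<open>Charts\<close>

lemma chart_inv:
  assumes "is_chart c"
  shows "q \<in> fst c \<Longrightarrow> inv_into (fst c) (snd c) (snd c q) = q"
    and "x \<in> coord_dom c \<Longrightarrow> inv_into (fst c) (snd c) x \<in> fst c"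
    and "x \<in> coord_dom c \<Longrightarrow> snd c (inv_into (fst c) (snd c) x) = x"
  using assms unfolding is_chart_def coord_dom_def
  by (auto simp: homeomorphism_def inv_into_into f_inv_into_f split: prod.splits)

lemma chart_open:
  assumes "is_chart c"
  shows "open (fst c)" "open (coord_dom c)" "homeomorphism (fst c) (coord_dom c) (snd c) (inv_into (fst c) (snd c))"
  using assms unfolding is_chart_def coord_dom_def by (auto split: prod.splits)

lemma chart_image_open:
  assumes "is_chart c" "open T" "T \<subseteq> fst c"
  shows "open (snd c ` T)"
proof -
  have "openin (top_of_set (coord_dom c)) (snd c ` T)"
    by (rule homeomorphism_imp_open_map[OF chart_open(3)[OF assms(1)]])
      (use assms(2,3) in \<open>auto simp: openin_open\<close>)
  then show ?thesis using chart_open(2)[OF assms(1)] openin_open_trans by blast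
qed

lemma in_chart_apply:
  "is_chart c \<Longrightarrow> q \<in> fst c \<Longrightarrow> in_chart c f (snd c q) = f q"
  by (simp add: in_chart_def chart_inv(1))

text \<open>Every change of coordinates goes through this lemma: once \<psi> is cut down to a
  diffeomorphism, maximality of the atlas admits \<psi> after c as a chart. Passing to the preimage
  of a ball makes the new coordinate domain convex, which later allows integration along
  segments.\<close>

lemma new_chart:
  fixes \<A> :: "('m::{t2_space,second_countable_topology}, 'n::finite) chart set"
  assumes "smooth_structure \<A>" "c \<in> \<A>" "p \<in> fst c"
    and "open W" "snd c p \<in> W" "W \<subseteq> coord_dom c"
    and "smooth_on W \<psi>" "inj (frechet_derivative \<psi> (at (snd c p)))"
  obtains d r where "d \<in> \<A>" "p \<in> fst d" "fst d \<subseteq> fst c" "snd c ` fst d \<subseteq> W"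
    "snd d = \<psi> \<circ> snd c" "r > 0" "coord_dom d = ball (\<psi> (snd c p)) r"
proof -
  have charts: "is_chart e" if "e \<in> \<A>" for e
    using assms(1) that by (auto simp: smooth_structure_def)
  note c = charts[OF assms(2)]
  obtain U V g where uv: "open U" "U \<subseteq> W" "snd c p \<in> U" "open V" "\<psi> (snd c p) \<in> V"
    "homeomorphism U V \<psi> g" "smooth_on V g"
    using smooth_inverse_function[OF assms(4,7,5,8)] by metis
  obtain r where r: "r > 0" "ball (\<psi> (snd c p)) r \<subseteq> V" using uv(4,5) openE by blast
  define B where "B = ball (\<psi> (snd c p)) r"
  define U1 where "U1 = U \<inter> \<psi> -` B"
  define T where "T = fst c \<inter> snd c -` U1"
  define d where "d = (T, \<psi> \<circ> snd c)"
  define \<iota> where "\<iota> = inv_into (fst c) (snd c)"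
  have gB: "g y \<in> U1" "\<psi> (g y) = y" if "y \<in> B" for y
    using uv(6) r(2) that by (auto simp: homeomorphism_def U1_def B_def)
  have g\<psi>: "g (\<psi> x) = x" if "x \<in> U1" for x
    using uv(6) that by (auto simp: homeomorphism_def U1_def)
  have U1W: "U1 \<subseteq> W" "U1 \<subseteq> coord_dom c" using uv(2) assms(6) by (auto simp: U1_def)
  have imU1: "\<psi> ` U1 = B" using gB by (force simp: U1_def)
  have hom1: "homeomorphism U1 B \<psi> g"
    by (rule homeomorphism_of_subsets[OF uv(6)]) (use r imU1 in \<open>auto simp: U1_def B_def\<close>)
  have contW: "continuous_on U \<psi>" using uv(6) by (simp add: homeomorphism_def)
  have oU1: "open U1"
    unfolding U1_def by (rule continuous_open_preimage[OF contW uv(1)]) (simp add: B_def)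
  have "continuous_on (fst c) (snd c)" using chart_open(3)[OF c] by (simp add: homeomorphism_def)
  then have oT: "open T"
    unfolding T_def by (rule continuous_open_preimage[OF _ chart_open(1)[OF c] oU1])
  have imT: "snd c ` T = U1"
    using U1W(2) unfolding T_def coord_dom_def by auto
  have hom2: "homeomorphism T U1 (snd c) \<iota>"
    by (rule homeomorphism_of_subsets[OF chart_open(3)[OF c, folded \<iota>_def]])
      (use imT U1W(2) in \<open>auto simp: T_def\<close>)
  have hom: "homeomorphism T B (\<psi> \<circ> snd c) (\<iota> \<circ> g)"
    by (rule homeomorphism_compose[OF hom2 hom1])
  have dom_d: "coord_dom d = B" using hom by (simp add: coord_dom_def d_def homeomorphism_def)
  have inj: "inj_on (\<psi> \<circ> snd c) T"
    by (rule inj_on_inverseI[of T "\<iota> \<circ> g"]) (use hom in \<open>auto simp: homeomorphism_def\<close>)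
  have inv_d: "inv_into T (\<psi> \<circ> snd c) y = \<iota> (g y)" if "y \<in> B" for y
    by (rule inv_into_f_eq[OF inj]) (use hom that in \<open>auto simp: homeomorphism_def\<close>)
  have "homeomorphism T B (\<psi> \<circ> snd c) (inv_into T (\<psi> \<circ> snd c))"
    using homeomorphism_cong[OF hom refl refl] inv_d by simp
  then have d: "is_chart d"
    using oT dom_d by (simp add: is_chart_def d_def coord_dom_def B_def)
  have compat: "compatible d e" if e: "e \<in> \<A>" for e
    unfolding compatible_def
  proof
    note ec = charts[OF e]
    have ce: "compatible c e" using assms(1,2) e by (auto simp: smooth_structure_def)
    have TC: "T \<subseteq> fst c" by (auto simp: T_def)
    let ?S = "snd d ` (fst d \<inter> fst e)"
    have oS: "open ?S"
      by (rule chart_image_open[OF d]) (use oT chart_open(1)[OF ec] in \<open>auto simp: d_def\<close>)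
    have SB: "?S \<subseteq> B" using dom_d by (auto simp: coord_dom_def)
    \<comment> \<open>The way back from d to the coordinates of c is g, so this transition map is
      the one from c to e after g.\<close>
    show "smooth_on ?S (transition d e)"
    proof (rule smooth_on_cong[OF oS])
      show "transition c e (g y) = transition d e y" if "y \<in> ?S" for y
        using inv_d SB that by (auto simp: transition_def d_def \<iota>_def)
      show "smooth_on ?S (\<lambda>y. transition c e (g y))"
      proof (rule smooth_on_compose[OF oS, where f = g and g = "transition c e"
            and V = "snd c ` (fst c \<inter> fst e)"])
        show "open (snd c ` (fst c \<inter> fst e))"
          by (rule chart_image_open[OF c]) (use chart_open(1)[OF ec] chart_open(1)[OF c] in auto)
        show "smooth_on ?S g" using smooth_on_subset[OF uv(7)] SB r(2) by (auto simp: B_def)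
        show "smooth_on (snd c ` (fst c \<inter> fst e)) (transition c e)"
          using ce by (simp add: compatible_def)
        show "g ` ?S \<subseteq> snd c ` (fst c \<inter> fst e)"
          using g\<psi> by (auto simp: d_def T_def)
      qed
    qed
    let ?R = "snd e ` (fst d \<inter> fst e)"
    have oR: "open ?R"
      by (rule chart_image_open[OF ec]) (use oT chart_open(1)[OF ec] in \<open>auto simp: d_def\<close>)
    show "smooth_on ?R (transition e d)"
    proof (rule smooth_on_cong[OF oR])
      show "\<psi> (transition e c y) = transition e d y" for y
        by (simp add: transition_def d_def)
      show "smooth_on ?R (\<lambda>y. \<psi> (transition e c y))"
      proof (rule smooth_on_compose[OF oR assms(4) _ assms(7), where f = "transition e c"])
        have "smooth_on (snd e ` (fst c \<inter> fst e)) (transition e c)"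
          using ce by (simp add: compatible_def)
        then show "smooth_on ?R (transition e c)"
          by (rule smooth_on_subset) (use TC in \<open>auto simp: d_def\<close>)
        show "transition e c ` ?R \<subseteq> W"
          using chart_inv(1)[OF ec] U1W(1) by (auto simp: transition_def d_def T_def)
      qed
    qed
  qed
  have "d \<in> \<A>" using assms(1) d compat unfolding smooth_structure_def by blast
  moreover have "p \<in> fst d"
    using assms(3) uv(3) r(1) by (simp add: d_def T_def U1_def B_def)
  moreover have "snd c ` fst d \<subseteq> W" using imT U1W(1) by (auto simp: d_def)
  ultimately show thesis
    using that[of d r] dom_d r(1) by (auto simp: d_def B_def T_def)
qed

section \<open>Immersions with a transversal field\<close>

lemma vector_4 [simp]:
  "(vector [x,y,z,w] :: ('a::zero)^4)$1 = x"
  "(vector [x,y,z,w] :: ('a::zero)^4)$2 = y"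
  "(vector [x,y,z,w] :: ('a::zero)^4)$3 = z"
  "(vector [x,y,z,w] :: ('a::zero)^4)$4 = w"
  unfolding vector_def by simp_all

lemma vec_eq_4: "(v::'a^4) = w \<longleftrightarrow> v$1 = w$1 \<and> v$2 = w$2 \<and> v$3 = w$3 \<and> v$4 = w$4"
  by (simp add: vec_eq_iff forall_4)

lemma det_4:
  "det (A::'a::comm_ring_1^4^4) =
     A$1$1 * (A$2$2 * A$3$3 * A$4$4 + A$2$3 * A$3$4 * A$4$2 + A$2$4 * A$3$2 * A$4$3
            - A$2$2 * A$3$4 * A$4$3 - A$2$3 * A$3$2 * A$4$4 - A$2$4 * A$3$3 * A$4$2)
   - A$1$2 * (A$2$1 * A$3$3 * A$4$4 + A$2$3 * A$3$4 * A$4$1 + A$2$4 * A$3$1 * A$4$3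
            - A$2$1 * A$3$4 * A$4$3 - A$2$3 * A$3$1 * A$4$4 - A$2$4 * A$3$3 * A$4$1)
   + A$1$3 * (A$2$1 * A$3$2 * A$4$4 + A$2$2 * A$3$4 * A$4$1 + A$2$4 * A$3$1 * A$4$2
            - A$2$1 * A$3$4 * A$4$2 - A$2$2 * A$3$1 * A$4$4 - A$2$4 * A$3$2 * A$4$1)
   - A$1$4 * (A$2$1 * A$3$2 * A$4$3 + A$2$2 * A$3$3 * A$4$1 + A$2$3 * A$3$1 * A$4$2
            - A$2$1 * A$3$3 * A$4$2 - A$2$2 * A$3$1 * A$4$3 - A$2$3 * A$3$2 * A$4$1)"
proof -
  have f1234: "finite {2::4, 3, 4}" "1 \<notin> {2::4, 3, 4}" by auto
  have f234: "finite {3::4, 4}" "2 \<notin> {3::4, 4}" by auto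
  have f34: "finite {4::4}" "3 \<notin> {4::4}" by auto
  have f4: "finite {}" "4 \<notin> ({}::4 set)" by auto
  show ?thesis
    unfolding det_def UNIV_4
    unfolding sum_over_permutations_insert[OF f1234]
    unfolding sum_over_permutations_insert[OF f234]
    unfolding sum_over_permutations_insert[OF f34]
    unfolding permutes_sing
    by (simp add: sign_swap_id permutation_swap_id sign_compose permutation_compose sign_id
        swap_id_eq algebra_simps)
qed

definition pd :: "3 \<Rightarrow> (real^3 \<Rightarrow> 'b::real_normed_vector) \<Rightarrow> real^3 \<Rightarrow> 'b" where
  "pd i f x = frechet_derivative f (at x) (axis i 1)"

lemma smooth_on_pd: "smooth_on V f \<Longrightarrow> smooth_on V (pd i f)"
  unfolding pd_def by (rule smooth_on_frechet_derivative)

lemma linear_on_R3: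
  fixes L :: "real^3 \<Rightarrow> 'b::real_vector"
  assumes "linear L"
  shows "L v = v$1 *\<^sub>R L (axis 1 1) + v$2 *\<^sub>R L (axis 2 1) + v$3 *\<^sub>R L (axis 3 1)"
proof -
  have "v = v$1 *\<^sub>R axis 1 1 + v$2 *\<^sub>R axis 2 1 + v$3 *\<^sub>R axis 3 1"
    by (simp add: vec_eq_iff forall_3 axis_def)
  then have "L v = L (v$1 *\<^sub>R axis 1 1 + v$2 *\<^sub>R axis 2 1 + v$3 *\<^sub>R axis 3 1)" by simp
  then show ?thesis using assms by (simp add: linear_add linear_scale)
qed

lemma smooth_on_linear_derivative:
  "smooth_on V f \<Longrightarrow> x \<in> V \<Longrightarrow> linear (frechet_derivative f (at x))"
  using smooth_on_has_derivative has_derivative_linear by blast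

lemma frechet_derivative_pd:
  fixes f :: "real^3 \<Rightarrow> 'b::real_normed_vector"
  assumes "smooth_on V f" "x \<in> V"
  shows "frechet_derivative f (at x) v = v$1 *\<^sub>R pd 1 f x + v$2 *\<^sub>R pd 2 f x + v$3 *\<^sub>R pd 3 f x"
  unfolding pd_def by (rule linear_on_R3[OF smooth_on_linear_derivative[OF assms]])

abbreviation rows4 :: "real^4 \<Rightarrow> real^4 \<Rightarrow> real^4 \<Rightarrow> real^4 \<Rightarrow> real" where
  "rows4 a b c d \<equiv> det (vector [a, b, c, d] :: real^4^4)"

lemma frame_apply:
  "transpose (vector [a, b, c, d] :: real^4^4) *v s = s$1 *\<^sub>R a + s$2 *\<^sub>R b + s$3 *\<^sub>R c + s$4 *\<^sub>R d"
  by (simp add: vec_eq_4 matrix_vector_mult_def transpose_def sum_4 mult.commute)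

text \<open>Used for derivatives of a frame written in that same frame: one component survives in
  each determinant, so the derivative of a volume becomes a trace.\<close>

lemma rows4_row1: "rows4 (w1 *\<^sub>R a + w2 *\<^sub>R b + w3 *\<^sub>R c + h *\<^sub>R d) b c d = w1 * rows4 a b c d"
  by (simp add: det_4 algebra_simps)

lemma rows4_row2: "rows4 a (w1 *\<^sub>R a + w2 *\<^sub>R b + w3 *\<^sub>R c + h *\<^sub>R d) c d = w2 * rows4 a b c d"
  by (simp add: det_4 algebra_simps)

lemma rows4_row3: "rows4 a b (w1 *\<^sub>R a + w2 *\<^sub>R b + w3 *\<^sub>R c + h *\<^sub>R d) d = w3 * rows4 a b c d"
  by (simp add: det_4 algebra_simps)

lemma rows4_row4: "rows4 a b c (w1 *\<^sub>R a + w2 *\<^sub>R b + w3 *\<^sub>R c + h *\<^sub>R d) = h * rows4 a b c d"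
  by (simp add: det_4 algebra_simps)

lemma rows4_expand4:
  "rows4 a b c (x *\<^sub>R p + y *\<^sub>R q + z *\<^sub>R r) = x * rows4 a b c p + y * rows4 a b c q + z * rows4 a b c r"
  by (simp add: det_4 algebra_simps)

lemma rows4_swap4: "rows4 d b c a = - rows4 a b c d" "rows4 a d c b = - rows4 a b c d"
    "rows4 a b d c = - rows4 a b c d"
  by (simp_all add: det_4 algebra_simps)

lemma rows4_eq4: "rows4 a b c a = 0" "rows4 a b c b = 0" "rows4 a b c c = 0"
  by (simp_all add: det_4 algebra_simps)

text \<open>Here the last row is a combination of a, b and c, so the determinant would vanish if no
  other row were changed. With one of them replaced by a new vector, only the component of that
  vector along d contributes; a swap of rows brings it to the last place.\<close>

lemma rows4_exchange:
  "rows4 (w1 *\<^sub>R a + w2 *\<^sub>R b + w3 *\<^sub>R c + h *\<^sub>R d) b c (x *\<^sub>R a + y *\<^sub>R b + z *\<^sub>R c) = - h * x * rows4 a b c d"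
  "rows4 a (w1 *\<^sub>R a + w2 *\<^sub>R b + w3 *\<^sub>R c + h *\<^sub>R d) c (x *\<^sub>R a + y *\<^sub>R b + z *\<^sub>R c) = - h * y * rows4 a b c d"
  "rows4 a b (w1 *\<^sub>R a + w2 *\<^sub>R b + w3 *\<^sub>R c + h *\<^sub>R d) (x *\<^sub>R a + y *\<^sub>R b + z *\<^sub>R c) = - h * z * rows4 a b c d"
proof -
  let ?w = "w1 *\<^sub>R a + w2 *\<^sub>R b + w3 *\<^sub>R c + h *\<^sub>R d"
  have *: "rows4 ?w b c a = - h * rows4 a b c d" "rows4 a ?w c b = - h * rows4 a b c d"
    "rows4 a b ?w c = - h * rows4 a b c d"
    by (simp_all only: rows4_swap4[where d = ?w] rows4_row4 mult_minus_left)
  show "rows4 ?w b c (x *\<^sub>R a + y *\<^sub>R b + z *\<^sub>R c) = - h * x * rows4 a b c d"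
    "rows4 a ?w c (x *\<^sub>R a + y *\<^sub>R b + z *\<^sub>R c) = - h * y * rows4 a b c d"
    "rows4 a b ?w (x *\<^sub>R a + y *\<^sub>R b + z *\<^sub>R c) = - h * z * rows4 a b c d"
    unfolding rows4_expand4 by (simp_all only: * rows4_eq4 mult_zero_right add_0_left add_0_right mult_ac)
qed

lemma rows4_linear:
  fixes T :: "real^4 \<Rightarrow> real^4"
  assumes "linear T"
  shows "rows4 (T a) (T b) (T c) (T d) = det (matrix T) * rows4 a b c d"
proof -
  have "vector [T a, T b, T c, T d] = (vector [a, b, c, d] :: real^4^4) ** transpose (matrix T)"
  proof -
    have *: "T v = matrix T *v v" for v
      using fun_cong[OF matrix_vector_mul(2)[OF assms], of v] by simp
    have row: "(A ** transpose M) $ i = M *v (A $ i)" for A M :: "real^4^4" and i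
      by (simp add: vec_eq_iff matrix_matrix_mult_def matrix_vector_mult_def transpose_def mult.commute)
    show ?thesis
      unfolding vec_eq_4 row vector_4 *[symmetric] by (intro conjI refl)
  qed
  then show ?thesis by (simp add: det_mul mult.commute)
qed

lemma has_derivative_rows4:
  fixes a b c d :: "'a::real_normed_vector \<Rightarrow> real^4"
  assumes "(a has_derivative a') (at x)" "(b has_derivative b') (at x)"
    "(c has_derivative c') (at x)" "(d has_derivative d') (at x)"
  shows "((\<lambda>x. rows4 (a x) (b x) (c x) (d x)) has_derivative
    (\<lambda>v. rows4 (a' v) (b x) (c x) (d x) + rows4 (a x) (b' v) (c x) (d x) +
         rows4 (a x) (b x) (c' v) (d x) + rows4 (a x) (b x) (c x) (d' v))) (at x)"
proof -
  have comp: "((\<lambda>x. f x $ i) has_derivative (\<lambda>v. f' v $ i)) (at x)"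
    if "(f has_derivative f') (at x)" for f :: "'a \<Rightarrow> real^4" and f' i
    using bounded_linear.has_derivative[OF bounded_linear_vec_nth that] .
  note d = comp[OF assms(1)] comp[OF assms(2)] comp[OF assms(3)] comp[OF assms(4)]
  show ?thesis
    unfolding det_4 vector_4
    by (rule has_derivative_eq_rhs, (rule derivative_intros d)+) (simp add: algebra_simps fun_eq_iff)
qed

lemma rows4_nonzero:
  assumes "\<And>s :: real^4. s$1 *\<^sub>R a + s$2 *\<^sub>R b + s$3 *\<^sub>R c + s$4 *\<^sub>R d = 0 \<Longrightarrow> s = 0"
  shows "rows4 a b c d \<noteq> 0"
proof -
  let ?M = "transpose (vector [a, b, c, d] :: real^4^4)"
  have "\<forall>s. ?M *v s = 0 \<longrightarrow> s = 0" unfolding frame_apply using assms by blast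
  then have "\<exists>B. B ** ?M = mat 1" by (simp only: matrix_left_invertible_ker)
  then have "invertible ?M" by (simp only: invertible_left_inverse)
  then have "det ?M \<noteq> 0" by (simp add: invertible_det_nz)
  then show ?thesis by (simp add: det_transpose)
qed

lemma rows4_decompose:
  assumes "rows4 a b c d \<noteq> 0"
  obtains s :: "real^4" where "w = s$1 *\<^sub>R a + s$2 *\<^sub>R b + s$3 *\<^sub>R c + s$4 *\<^sub>R d"
proof -
  let ?M = "transpose (vector [a, b, c, d] :: real^4^4)"
  have "invertible ?M" using assms by (simp add: invertible_det_nz det_transpose)
  then obtain B where "?M ** B = mat 1" by (auto simp: invertible_def)
  then have "?M *v (B *v w) = w" by (simp only: matrix_vector_mul_assoc matrix_vector_mul_lid)
  then show thesis using that[of "B *v w"] unfolding frame_apply by metis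
qed

lemma linear_Jt: "linear Jt"
  by (rule linearI) (simp_all add: Jt_def vec_eq_4)

lemma Jt_Jt [simp]: "Jt (Jt w) = w"
  by (simp add: Jt_def vec_eq_4)

section \<open>The splitting along an immersion with a transversal field\<close>

locale transversal_immersion =
  fixes V :: "(real^3) set" and F C :: "real^3 \<Rightarrow> real^4"
  assumes open_V: "open V" and smooth_F: "smooth_on V F" and smooth_C: "smooth_on V C"
    and inj_D: "\<And>x. x \<in> V \<Longrightarrow> inj (frechet_derivative F (at x))"
    and transv: "\<And>x. x \<in> V \<Longrightarrow> C x \<notin> tangent_image F x"
begin

abbreviation D where "D x \<equiv> frechet_derivative F (at x)"
abbreviation vol where "vol x \<equiv> rows4 (pd 1 F x) (pd 2 F x) (pd 3 F x) (C x)"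

lemma linear_D: "x \<in> V \<Longrightarrow> linear (D x)"
  by (rule smooth_on_linear_derivative[OF smooth_F])

lemma D_eq: "x \<in> V \<Longrightarrow> D x v = v$1 *\<^sub>R pd 1 F x + v$2 *\<^sub>R pd 2 F x + v$3 *\<^sub>R pd 3 F x"
  by (rule frechet_derivative_pd[OF smooth_F])

lemma unique:
  assumes "x \<in> V" "D x v + a *\<^sub>R C x = D x w + b *\<^sub>R C x"
  shows "v = w" "a = b"
proof -
  have "D x (w - v) = (a - b) *\<^sub>R C x"
    using assms(2) by (simp add: linear_diff[OF linear_D[OF assms(1)]] algebra_simps)
  moreover have False if "a \<noteq> b" "D x (w - v) = (a - b) *\<^sub>R C x"
  proof -
    have "C x = D x ((1 / (a - b)) *\<^sub>R (w - v))"
      using that linear_scale[OF linear_D[OF assms(1)]] by simp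
    then show False using transv[OF assms(1)] unfolding tangent_image_def by blast
  qed
  ultimately show "a = b" by blast
  then show "v = w" using assms(2) inj_D[OF assms(1)] by (simp add: inj_def)
qed

lemma tangential_eq: "x \<in> V \<Longrightarrow> w = D x v + a *\<^sub>R C x \<Longrightarrow> tangential F C x w = v"
  unfolding tangential_def by (rule the_equality) (use unique in blast)+

lemma transversal_eq: "x \<in> V \<Longrightarrow> w = D x v + a *\<^sub>R C x \<Longrightarrow> transversal F C x w = a"
  unfolding transversal_def by (rule the_equality) (use unique in blast)+

lemma vol_nonzero: "x \<in> V \<Longrightarrow> vol x \<noteq> 0"
proof (rule rows4_nonzero)
  fix s :: "real^4"
  assume x: "x \<in> V" and s: "s$1 *\<^sub>R pd 1 F x + s$2 *\<^sub>R pd 2 F x + s$3 *\<^sub>R pd 3 F x + s$4 *\<^sub>R C x = 0"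
  have "D x (vector [s$1, s$2, s$3]) + s$4 *\<^sub>R C x = D x 0 + 0 *\<^sub>R C x"
    using s D_eq[OF x] by simp
  from unique[OF x this] show "s = 0"
    by (simp add: vec_eq_iff forall_3 forall_4)
qed

text \<open>Existence in the splitting; together with \<open>unique\<close> it turns the definite
  descriptions \<open>tangential\<close> and \<open>transversal\<close> into actual
  components.\<close>

lemma decompose: "x \<in> V \<Longrightarrow> w = D x (tangential F C x w) + transversal F C x w *\<^sub>R C x"
proof -
  assume x: "x \<in> V"
  obtain s :: "real^4" where
    "w = s$1 *\<^sub>R pd 1 F x + s$2 *\<^sub>R pd 2 F x + s$3 *\<^sub>R pd 3 F x + s$4 *\<^sub>R C x"
    using rows4_decompose[OF vol_nonzero[OF x]] by metis
  then have "w = D x (vector [s$1, s$2, s$3]) + s$4 *\<^sub>R C x" using D_eq[OF x] by simp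
  then show ?thesis using tangential_eq[OF x] transversal_eq[OF x] by metis
qed

text \<open>The components in the frame solve a linear system with smooth entries and nonzero
  determinant. The Blaschke conditions speak of smooth fields only, and they will be applied to
  covariant derivatives.\<close>

lemma smooth_tangential:
  assumes "smooth_on V w"
  shows "smooth_on V (\<lambda>x. tangential F C x (w x))"
proof -
  define s :: "real^3 \<Rightarrow> real^4" where "s = (\<lambda>x. let t = tangential F C x (w x) in
    vector [t$1, t$2, t$3, transversal F C x (w x)])"
  have "smooth_on V s"
  proof (rule smooth_on_linear_solve[OF open_V _ assms])
    fix i j :: 4
    have "smooth_on V (\<lambda>x. (vector [pd 1 F x, pd 2 F x, pd 3 F x, C x] :: real^4^4) $ j $ i)"
      using exhaust_4[of j] smooth_on_vec_nth[OF open_V smooth_on_pd[OF smooth_F]]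
        smooth_on_vec_nth[OF open_V smooth_C] by auto
    then show "smooth_on V (\<lambda>x. transpose (vector [pd 1 F x, pd 2 F x, pd 3 F x, C x] :: real^4^4) $ i $ j)"
      by (simp add: transpose_def)
  next
    fix x assume x: "x \<in> V"
    show "det (transpose (vector [pd 1 F x, pd 2 F x, pd 3 F x, C x] :: real^4^4)) \<noteq> 0"
      using vol_nonzero[OF x] by (simp add: det_transpose)
    show "transpose (vector [pd 1 F x, pd 2 F x, pd 3 F x, C x] :: real^4^4) *v s x = w x"
      unfolding frame_apply using decompose[OF x, of "w x"] D_eq[OF x] by (simp add: s_def Let_def)
  qed
  then have s: "smooth_on V (\<lambda>x. s x $ i)" for i by (rule smooth_on_vec_nth[OF open_V])
  have "smooth_on V (\<lambda>x. tangential F C x (w x) $ i)" for i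
    using s[of 1] s[of 2] s[of 3] exhaust_3[of i] by (auto simp: s_def Let_def)
  from smooth_on_vec_lambda[where f = "\<lambda>i x. tangential F C x (w x) $ i", OF open_V this]
  show ?thesis by (simp only: vec_nth_inverse)
qed

text \<open>The volume forms agree and are parallel, so differentiating \<open>\<Theta>\<close> along \<open>v\<close> leaves exactly the
  term \<open>\<tau>(v) \<Theta>\<close>, which therefore vanishes.\<close>

lemma equiaffine:
  assumes "blaschke_on V F C" "x \<in> V"
  shows "transversal F C x (frechet_derivative C (at x) v) = 0"
proof -
  \<comment> \<open>Constant fields: a fixed direction and the coordinate frame. Their covariant
    derivatives are in general not constant, which is why smoothness has to be checked.\<close>
  let ?X = "\<lambda>_::real^3. v" and ?Y = "\<lambda>i _::real^3. axis i (1::real) :: real^3"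
  define T where "T j = tangential F C x (frechet_derivative (pd j F) (at x) v)" for j
  define h where "h j = transversal F C x (frechet_derivative (pd j F) (at x) v)" for j
  let ?w = "frechet_derivative C (at x) v"
  note bl = assms(1)[unfolded blaschke_on_def]
  have eq: "metric_vol F C Z y = ind_vol F C Z y" if "\<And>i. smooth_on V (Z i)" "y \<in> V" for Z y
    using bl that by blast
  have push: "push F (?Y j) = pd j F" for j
    by (simp add: push_def pd_def fun_eq_iff)
  have ind: "ind_vol F C ?Y = vol" by (simp add: ind_vol_def push fun_eq_iff)
  have conn: "conn F C ?X (?Y j) = (\<lambda>y. tangential F C y (frechet_derivative (pd j F) (at y) v))" for j
    by (simp add: conn_def push deriv_along_def fun_eq_iff)
  have sm_conn: "smooth_on V (conn F C ?X (?Y j))" for j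
    unfolding conn
    by (rule smooth_tangential[OF smooth_on_frechet_derivative[OF smooth_on_pd[OF smooth_F]]])
  have sm_upd: "smooth_on V ((?Y(j := conn F C ?X (?Y j))) i)" for i j
    using sm_conn by (cases "i = j") auto
  have der: "(vol has_derivative (\<lambda>v.
      rows4 (frechet_derivative (pd 1 F) (at x) v) (pd 2 F x) (pd 3 F x) (C x) +
      rows4 (pd 1 F x) (frechet_derivative (pd 2 F) (at x) v) (pd 3 F x) (C x) +
      rows4 (pd 1 F x) (pd 2 F x) (frechet_derivative (pd 3 F) (at x) v) (C x) +
      rows4 (pd 1 F x) (pd 2 F x) (pd 3 F x) (frechet_derivative C (at x) v))) (at x)"
    by (intro has_derivative_rows4 smooth_on_has_derivative[OF _ assms(2)] smooth_on_pd smooth_F smooth_C)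
  \<comment> \<open>\<open>metric_vol\<close> contains a sign and a root; it is differentiated only
    through its equality with the frame determinant on V.\<close>
  have mv: "frechet_derivative (metric_vol F C ?Y) (at x) = frechet_derivative vol (at x)"
  proof (rule sym, rule frechet_derivative_transform_within_open[OF _ open_V assms(2)])
    show "vol differentiable (at x)" using der differentiable_def by blast
    show "vol y = metric_vol F C ?Y y" if "y \<in> V" for y
      using eq[of ?Y y] that ind by simp
  qed
  have d1: "deriv_along ?X (metric_vol F C ?Y) x =
      rows4 (frechet_derivative (pd 1 F) (at x) v) (pd 2 F x) (pd 3 F x) (C x) +
      rows4 (pd 1 F x) (frechet_derivative (pd 2 F) (at x) v) (pd 3 F x) (C x) +
      rows4 (pd 1 F x) (pd 2 F x) (frechet_derivative (pd 3 F) (at x) v) (C x) +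
      rows4 (pd 1 F x) (pd 2 F x) (pd 3 F x) ?w"
    unfolding deriv_along_def mv by (rule fun_cong[OF frechet_derivative_at[OF der], of v, symmetric])
  have dec: "frechet_derivative (pd j F) (at x) v =
      T j $ 1 *\<^sub>R pd 1 F x + T j $ 2 *\<^sub>R pd 2 F x + T j $ 3 *\<^sub>R pd 3 F x + h j *\<^sub>R C x" for j
    using decompose[OF assms(2), of "frechet_derivative (pd j F) (at x) v"] D_eq[OF assms(2)]
    unfolding T_def h_def by simp
  have decw: "?w = tangential F C x ?w $ 1 *\<^sub>R pd 1 F x + tangential F C x ?w $ 2 *\<^sub>R pd 2 F x
      + tangential F C x ?w $ 3 *\<^sub>R pd 3 F x + transversal F C x ?w *\<^sub>R C x"
    using decompose[OF assms(2), of ?w] D_eq[OF assms(2)] by simp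
  \<comment> \<open>The trace of the connection plus \<tau>(v), times the volume. The covariant
    derivative of the form subtracts exactly the trace.\<close>
  have d2: "deriv_along ?X (metric_vol F C ?Y) x =
      T 1 $ 1 * vol x + T 2 $ 2 * vol x + T 3 $ 3 * vol x + transversal F C x ?w * vol x"
    unfolding d1 by (subst (1 2 3) dec, subst decw) (simp only: rows4_row1 rows4_row2 rows4_row3 rows4_row4)
  have pushc: "push F (conn F C ?X (?Y j)) x =
      T j $ 1 *\<^sub>R pd 1 F x + T j $ 2 *\<^sub>R pd 2 F x + T j $ 3 *\<^sub>R pd 3 F x + 0 *\<^sub>R C x" for j
    by (simp add: push_def conn T_def D_eq[OF assms(2)])
  have r: "metric_vol F C (?Y(j := conn F C ?X (?Y j))) x = T j $ j * vol x" for j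
  proof -
    have "metric_vol F C (?Y(j := conn F C ?X (?Y j))) x = ind_vol F C (?Y(j := conn F C ?X (?Y j))) x"
      by (rule eq[OF sm_upd assms(2)])
    also have "\<dots> = T j $ j * vol x"
      using exhaust_3[of j]
    proof (elim disjE)
      assume j: "j = 1"
      show ?thesis unfolding j ind_vol_def fun_upd_same pushc
        by (simp add: push rows4_row1[of _ _ _ _ _ _ 0, simplified])
    next
      assume j: "j = 2"
      show ?thesis unfolding j ind_vol_def fun_upd_same pushc
        by (simp add: push rows4_row2[of _ _ _ _ _ _ 0, simplified])
    next
      assume j: "j = 3"
      show ?thesis unfolding j ind_vol_def fun_upd_same pushc
        by (simp add: push rows4_row3[of _ _ _ _ _ _ 0, simplified])
    qed
    finally show ?thesis .
  qed
  have "cov_deriv_vol F C (metric_vol F C) ?X ?Y x = 0"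
    using bl assms(2) by simp
  then have "transversal F C x ?w * vol x = 0"
    unfolding cov_deriv_vol_def d2 r by (simp add: sum_3)
  then show ?thesis using vol_nonzero[OF assms(2)] by simp
qed

text \<open>Equality of the two volume forms on the coordinate frame, squared to remove the sign and
  the root of \<open>metric_vol\<close>.\<close>

lemma metric_det:
  assumes "blaschke_on V F C" "x \<in> V"
  shows "\<bar>det (\<chi> i j. transversal F C x (pd i (pd j F) x) :: real^3^3)\<bar> = (vol x)\<^sup>2"
proof -
  let ?Y = "\<lambda>i _::real^3. axis i (1::real) :: real^3"
  have push: "push F (?Y j) = pd j F" for j
    by (simp add: push_def pd_def fun_eq_iff)
  have ind: "ind_vol F C ?Y x = vol x" by (simp add: ind_vol_def push)
  have "metric_vol F C ?Y x = vol x"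
    using assms ind unfolding blaschke_on_def by (metis smooth_on_const)
  moreover have "aff_metric F C (?Y i) (?Y j) x = transversal F C x (pd i (pd j F) x)" for i j
    unfolding aff_metric_def push by (simp add: deriv_along_def pd_def[of i])
  ultimately have "sgn (vol x) * sqrt \<bar>det (\<chi> i j. transversal F C x (pd i (pd j F) x) :: real^3^3)\<bar> = vol x"
    by (simp add: metric_vol_def ind)
  then have "(sgn (vol x) * sqrt \<bar>det (\<chi> i j. transversal F C x (pd i (pd j F) x) :: real^3^3)\<bar>)\<^sup>2 = (vol x)\<^sup>2"
    by (rule arg_cong)
  then have "(sgn (vol x))\<^sup>2 * \<bar>det (\<chi> i j. transversal F C x (pd i (pd j F) x) :: real^3^3)\<bar> = (vol x)\<^sup>2"
    unfolding power_mult_distrib real_sqrt_pow2[OF abs_ge_zero] .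
  moreover have "(sgn (vol x))\<^sup>2 = 1"
    using vol_nonzero[OF assms(2)] by (simp only: sgn_if) simp
  ultimately show ?thesis by simp
qed

lemma derivative_C:
  assumes "blaschke_on V F C" "x \<in> V"
    and "\<And>X x. smooth_on V X \<Longrightarrow> x \<in> V \<Longrightarrow> shape F C X x = l *\<^sub>R X x"
  shows "frechet_derivative C (at x) v = - l *\<^sub>R D x v"
proof -
  have "- tangential F C x (frechet_derivative C (at x) v) = l *\<^sub>R v"
    using assms(3)[of "\<lambda>_. v" x] assms(2) by (simp add: shape_def deriv_along_def)
  then have "tangential F C x (frechet_derivative C (at x) v) = - l *\<^sub>R v"
    by (metis minus_minus scaleR_minus_left)
  then have "frechet_derivative C (at x) v = D x (- l *\<^sub>R v)"
    using decompose[OF assms(2), of "frechet_derivative C (at x) v"] equiaffine[OF assms(1,2), of v] by simp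
  then show ?thesis by (simp only: linear_scale[OF linear_D[OF assms(2)]])
qed

text \<open>Excludes l = 0. As \<open>Jt\<close> C is tangent, the determinant of the coordinate
  frame followed by \<open>Jt\<close> C vanishes on V. At a point where D C = 0, differentiating it
  leaves h(v, \<xi>) = 0 for all v, where \<xi> is the tangent vector mapped to \<open>Jt\<close> C.
  Since h is nondegenerate by \<open>metric_det\<close>, \<xi> = 0, so C would vanish and not be
  transversal.\<close>

lemma C_not_parallel:
  assumes "blaschke_on V F C" "x \<in> V" "\<And>y. y \<in> V \<Longrightarrow> Jt (C y) \<in> tangent_image F y"
    and C0: "\<And>v. frechet_derivative C (at x) v = 0"
  shows False
proof -
  define h where "h j v = transversal F C x (frechet_derivative (pd j F) (at x) v)" for j v
  define T where "T j v = tangential F C x (frechet_derivative (pd j F) (at x) v)" for j v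
  obtain \<xi> where \<xi>: "Jt (C x) = D x \<xi>" using assms(2,3) unfolding tangent_image_def by blast
  let ?N = "\<lambda>y. rows4 (pd 1 F y) (pd 2 F y) (pd 3 F y) (Jt (C y))"
  have N0: "?N y = 0" if y: "y \<in> V" for y
  proof -
    obtain \<eta> where "Jt (C y) = D y \<eta>" using assms(3)[OF y] unfolding tangent_image_def by blast
    then have "Jt (C y) = \<eta>$1 *\<^sub>R pd 1 F y + \<eta>$2 *\<^sub>R pd 2 F y + \<eta>$3 *\<^sub>R pd 3 F y + 0 *\<^sub>R C y"
      using D_eq[OF y] by simp
    then show ?thesis by (simp only: rows4_row4)
  qed
  have derJ: "((\<lambda>y. Jt (C y)) has_derivative (\<lambda>v. Jt (frechet_derivative C (at x) v))) (at x)"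
    using bounded_linear.has_derivative[OF linear_Jt[unfolded linear_conv_bounded_linear]
        smooth_on_has_derivative[OF smooth_C assms(2)]] .
  have der: "(?N has_derivative (\<lambda>v.
      rows4 (frechet_derivative (pd 1 F) (at x) v) (pd 2 F x) (pd 3 F x) (Jt (C x)) +
      rows4 (pd 1 F x) (frechet_derivative (pd 2 F) (at x) v) (pd 3 F x) (Jt (C x)) +
      rows4 (pd 1 F x) (pd 2 F x) (frechet_derivative (pd 3 F) (at x) v) (Jt (C x)) +
      rows4 (pd 1 F x) (pd 2 F x) (pd 3 F x) (Jt (frechet_derivative C (at x) v)))) (at x)"
    by (intro has_derivative_rows4 smooth_on_has_derivative[OF _ assms(2)] smooth_on_pd smooth_F derJ)
  have "(?N has_derivative (\<lambda>v. 0)) (at x)"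
    by (rule has_derivative_transform_within_open[OF has_derivative_const open_V assms(2)])
      (use N0 in simp)
  note zero = fun_cong[OF has_derivative_unique[OF der this]]
  have dec: "frechet_derivative (pd j F) (at x) v =
      T j v $ 1 *\<^sub>R pd 1 F x + T j v $ 2 *\<^sub>R pd 2 F x + T j v $ 3 *\<^sub>R pd 3 F x + h j v *\<^sub>R C x" for j v
    using decompose[OF assms(2), of "frechet_derivative (pd j F) (at x) v"] D_eq[OF assms(2)]
    unfolding T_def h_def by simp
  have J0: "Jt (frechet_derivative C (at x) v) = 0 *\<^sub>R pd 1 F x + 0 *\<^sub>R pd 2 F x + 0 *\<^sub>R pd 3 F x + 0 *\<^sub>R C x" for v
    using linear_0[OF linear_Jt] by (simp add: C0)
  have hsum: "h 1 v * \<xi>$1 + h 2 v * \<xi>$2 + h 3 v * \<xi>$3 = 0" for v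
  proof -
    have "- h 1 v * \<xi>$1 * vol x + - h 2 v * \<xi>$2 * vol x + - h 3 v * \<xi>$3 * vol x + 0 * vol x = 0"
      using zero[of v] unfolding dec J0 \<xi> D_eq[OF assms(2), of \<xi>] by (simp only: rows4_exchange rows4_row4)
    then have "(h 1 v * \<xi>$1 + h 2 v * \<xi>$2 + h 3 v * \<xi>$3) * vol x = 0" by (simp add: algebra_simps)
    then show ?thesis using vol_nonzero[OF assms(2)] by simp
  qed
  have hpd: "transversal F C x (pd i (pd j F) x) = h j (axis i 1)" for i j
    by (simp add: h_def pd_def[of i])
  have ker: "(\<chi> i j. transversal F C x (pd i (pd j F) x) :: real^3^3) *v \<xi> = 0"
    by (simp add: vec_eq_iff matrix_vector_mult_def sum_3 hpd hsum)
  have "det (\<chi> i j. transversal F C x (pd i (pd j F) x) :: real^3^3) \<noteq> 0"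
    using metric_det[OF assms(1,2)] vol_nonzero[OF assms(2)] by auto
  then have "\<exists>B. B ** (\<chi> i j. transversal F C x (pd i (pd j F) x) :: real^3^3) = mat 1"
    by (simp only: flip: invertible_det_nz invertible_left_inverse)
  then have "\<xi> = 0" using ker unfolding matrix_left_invertible_ker by blast
  then have "Jt (C x) = 0" using \<xi> linear_0[OF linear_D[OF assms(2)]] by simp
  then have "C x = D x 0"
    using Jt_Jt[of "C x"] linear_0[OF linear_Jt] linear_0[OF linear_D[OF assms(2)]] by simp
  then show False using transv[OF assms(2)] unfolding tangent_image_def by blast
qed

end

section \<open>Central immersions\<close>

text \<open>G serves as its own transversal field. The affine metric enters as any matrix h for
  which the Gauss formula holds modulo the tangent space, so that h can later be exhibited instead
  of being computed from a definite description. All scaling constants are collected in k.\<close>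

definition centroaffine_sphere :: "real \<Rightarrow> (real^3) set \<Rightarrow> (real^3 \<Rightarrow> real^4) \<Rightarrow> bool" where
  "centroaffine_sphere k V G \<longleftrightarrow> open V \<and> smooth_on V G \<and>
     (\<forall>x\<in>V. inj (frechet_derivative G (at x)) \<and> G x \<notin> tangent_image G x \<and> Jt (G x) \<in> tangent_image G x) \<and>
     (\<forall>x\<in>V. \<forall>h :: real^3^3. (\<forall>i j. pd i (pd j G) x - h $ i $ j *\<^sub>R G x \<in> tangent_image G x) \<longrightarrow>
        \<bar>det h\<bar> = k * (rows4 (pd 1 G x) (pd 2 G x) (pd 3 G x) (G x))\<^sup>2) \<and>
     (\<forall>X Y. smooth_on V X \<longrightarrow> smooth_on V Y \<longrightarrow> (\<forall>x\<in>V. X x \<in> distr G x \<and> Y x \<in> distr G x) \<longrightarrow>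
        (\<forall>x\<in>V. lie X Y x \<in> distr G x))"

lemma has_derivative_linear_diff:
  fixes T :: "'b::euclidean_space \<Rightarrow> 'c::real_normed_vector"
  assumes "linear T" "(f has_derivative f') (at x)"
  shows "((\<lambda>y. T (f y - b)) has_derivative (\<lambda>v. T (f' v))) (at x)"
proof -
  have "((\<lambda>y. f y - b) has_derivative f') (at x)"
    using has_derivative_diff[OF assms(2) has_derivative_const[of b]] by simp
  from bounded_linear.has_derivative[OF assms(1)[unfolded linear_conv_bounded_linear] this]
  show ?thesis .
qed

text \<open>Origin of the constant: taking F - b in place of C multiplies the metric by - l, hence
  its determinant by l^3 up to sign, while the squared volume for C is l^2 times the one for F - b.
  Finally T multiplies the volume by its determinant.\<close>

lemma (in transversal_immersion) centroaffine_sphere_transform: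
  fixes T :: "real^4 \<Rightarrow> real^4"
  assumes "blaschke_on V F C" and l: "l \<noteq> 0" and C_eq: "\<And>x. x \<in> V \<Longrightarrow> C x = - l *\<^sub>R (F x - b)"
    and T: "linear T" "bij T" "T \<circ> Jt = Jt \<circ> T"
    and tan: "\<And>x. x \<in> V \<Longrightarrow> Jt (C x) \<in> tangent_image F x"
    and inv: "\<And>X Y x. smooth_on V X \<Longrightarrow> smooth_on V Y \<Longrightarrow> (\<And>x. x \<in> V \<Longrightarrow> X x \<in> distr F x \<and> Y x \<in> distr F x)
      \<Longrightarrow> x \<in> V \<Longrightarrow> lie X Y x \<in> distr F x"
  shows "centroaffine_sphere (\<bar>l\<bar> ^ 5 / (det (matrix T))\<^sup>2) V (\<lambda>x. T (F x - b))"
    (is "centroaffine_sphere ?k V ?G")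
proof -
  have injT: "inj T" using T(2) by (simp add: bij_def)
  have TJ: "T (Jt w) = Jt (T w)" for w using fun_cong[OF T(3), of w] by simp
  have DG: "frechet_derivative ?G (at x) = (\<lambda>v. T (D x v))" if "x \<in> V" for x
    using frechet_derivative_at[OF has_derivative_linear_diff[OF T(1) smooth_on_has_derivative[OF smooth_F that], of b]]
    by simp
  have img: "tangent_image ?G x = T ` tangent_image F x" if "x \<in> V" for x
    unfolding tangent_image_def DG[OF that] by (simp add: image_image)
  have pdG: "pd j ?G x = T (pd j F x)" if "x \<in> V" for j x
    unfolding pd_def DG[OF that] ..
  have pdG2: "pd i (pd j ?G) x = T (pd i (pd j F) x)" if x: "x \<in> V" for i j x
  proof -
    have "((\<lambda>y. T (pd j F y - 0)) has_derivative (\<lambda>v. T (frechet_derivative (pd j F) (at x) v))) (at x)"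
      by (rule has_derivative_linear_diff[OF T(1) smooth_on_has_derivative[OF smooth_on_pd[OF smooth_F] x]])
    then have "(pd j ?G has_derivative (\<lambda>v. T (frechet_derivative (pd j F) (at x) v))) (at x)"
      by (rule has_derivative_transform_within_open[OF _ open_V x]) (use pdG in simp)
    from frechet_derivative_at[OF this] show ?thesis
      unfolding pd_def[of i] by (metis (no_types))
  qed
  have imJ: "Jt ` T ` R = T ` Jt ` R" for R by (simp add: image_image TJ)
  \<comment> \<open>Since T commutes with \<open>Jt\<close>, it maps the \<open>Jt\<close>-invariant
    part of one tangent space onto that of the other, and being injective it drops out of the
    preimage.\<close>
  have distr: "distr ?G x = distr F x" if "x \<in> V" for x
    unfolding distr_def img[OF that] imJ DG[OF that]
    by (simp only: vimage_def image_Int[OF injT, symmetric] inj_image_mem_iff[OF injT])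
  have smG: "smooth_on V ?G"
    by (rule smooth_on_bounded_linear[OF T(1)[unfolded linear_conv_bounded_linear] open_V])
      (intro smooth_on_diff open_V smooth_F smooth_on_const)
  have subs: "subspace (tangent_image F x)" if "x \<in> V" for x
    unfolding tangent_image_def by (rule linear_subspace_image[OF linear_D[OF that] subspace_UNIV])
  have FC: "F x - b = (- 1 / l) *\<^sub>R C x" if "x \<in> V" for x
    using C_eq[OF that] l by simp
  have nt: "F x - b \<notin> tangent_image F x" if "x \<in> V" for x
    using transv[OF that] C_eq[OF that] subspace_scale[OF subs[OF that], of "F x - b" "- l"] by metis
  have Jtan: "Jt (F x - b) \<in> tangent_image F x" if "x \<in> V" for x
    unfolding FC[OF that] linear_scale[OF linear_Jt] by (rule subspace_scale[OF subs[OF that] tan[OF that]])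
  have vol_eq: "\<bar>det h\<bar> = ?k * (rows4 (pd 1 ?G x) (pd 2 ?G x) (pd 3 ?G x) (?G x))\<^sup>2"
    if x: "x \<in> V" and h: "\<And>i j. pd i (pd j ?G) x - h $ i $ j *\<^sub>R ?G x \<in> tangent_image ?G x"
    for x and h :: "real^3^3"
  proof -
    have "transversal F C x (pd i (pd j F) x) = - h $ i $ j / l" for i j
    proof -
      have "T (pd i (pd j F) x - h $ i $ j *\<^sub>R (F x - b)) \<in> T ` tangent_image F x"
        using h[of i j] unfolding pdG2[OF x] img[OF x] by (simp add: linear_diff[OF T(1)] linear_scale[OF T(1)])
      then have "pd i (pd j F) x - h $ i $ j *\<^sub>R (F x - b) \<in> tangent_image F x"
        using injT by (simp add: inj_image_mem_iff)
      then obtain v where "pd i (pd j F) x - h $ i $ j *\<^sub>R (F x - b) = D x v"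
        unfolding tangent_image_def by blast
      then have "pd i (pd j F) x = D x v + (- h $ i $ j / l) *\<^sub>R C x"
        unfolding FC[OF x] by (simp add: algebra_simps)
      then show ?thesis by (rule transversal_eq[OF x])
    qed
    then have "(\<chi> i j. transversal F C x (pd i (pd j F) x) :: real^3^3) = (\<chi> i j. - h $ i $ j / l)"
      by (simp add: vec_eq_iff)
    then have dh: "det h = - (l ^ 3) * det (\<chi> i j. transversal F C x (pd i (pd j F) x) :: real^3^3)"
      using l by (simp add: det_3 field_simps power3_eq_cube)
    have "rows4 (pd 1 F x) (pd 2 F x) (pd 3 F x) (C x) =
        rows4 (pd 1 F x) (pd 2 F x) (pd 3 F x) (0 *\<^sub>R pd 1 F x + 0 *\<^sub>R pd 2 F x + 0 *\<^sub>R pd 3 F x + (- l) *\<^sub>R (F x - b))"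
      using C_eq[OF x] by simp
    also have "\<dots> = - l * rows4 (pd 1 F x) (pd 2 F x) (pd 3 F x) (F x - b)" by (rule rows4_row4)
    finally have v: "vol x = - l * rows4 (pd 1 F x) (pd 2 F x) (pd 3 F x) (F x - b)" .
    have vG: "rows4 (pd 1 ?G x) (pd 2 ?G x) (pd 3 ?G x) (?G x) =
        det (matrix T) * rows4 (pd 1 F x) (pd 2 F x) (pd 3 F x) (F x - b)"
      unfolding pdG[OF x] by (rule rows4_linear[OF T(1)])
    have dT: "det (matrix T) \<noteq> 0" using det_nz_iff_inj[OF T(1)] injT by simp
    have "\<bar>det h\<bar> = \<bar>l\<bar> ^ 3 * (l\<^sup>2 * (rows4 (pd 1 F x) (pd 2 F x) (pd 3 F x) (F x - b))\<^sup>2)"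
      unfolding dh abs_mult metric_det[OF assms(1) x] v by (simp add: power_abs power_mult_distrib)
    moreover have "\<bar>l\<bar> ^ 5 = \<bar>l\<bar> ^ 3 * l\<^sup>2"
      using power_add[of "\<bar>l\<bar>" 3 2] by simp
    ultimately show ?thesis unfolding vG using dT by (simp add: power_mult_distrib)
  qed
  have injG: "inj (frechet_derivative ?G (at x))" if "x \<in> V" for x
    unfolding DG[OF that] using inj_compose[OF injT inj_D[OF that]] by (simp add: comp_def)
  have GT: "?G x \<notin> tangent_image ?G x" "Jt (?G x) \<in> tangent_image ?G x" if "x \<in> V" for x
    unfolding img[OF that] TJ[symmetric] using nt[OF that] Jtan[OF that] injT
    by (simp_all add: inj_image_mem_iff)
  have invG: "lie X Y x \<in> distr ?G x"
    if "smooth_on V X" "smooth_on V Y" "\<forall>x\<in>V. X x \<in> distr ?G x \<and> Y x \<in> distr ?G x" "x \<in> V" for X Y x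
    using inv[OF that(1,2) _ that(4)] that(3) distr that(4) by blast
  show ?thesis
    unfolding centroaffine_sphere_def
    by (intro conjI ballI allI impI open_V smG injG GT vol_eq invG) auto
qed

section \<open>The normal form in adapted coordinates\<close>

text \<open>In terms of \<open>q = exp (- 4 b)\<close> the hypothesis says that \<open>\<Phi> = 2 q q'' - q'\<^sup>2\<close> has constant
  nonzero square, and \<open>\<Phi>' = 2 q q'''\<close>.\<close>

lemma exp_quadratic:
  fixes b b1 b2 b3 :: "real \<Rightarrow> real"
  assumes r: "r > 0"
    and d: "\<And>s. \<bar>s\<bar> < r \<Longrightarrow> (b has_real_derivative b1 s) (at s)"
      "\<And>s. \<bar>s\<bar> < r \<Longrightarrow> (b1 has_real_derivative b2 s) (at s)"
      "\<And>s. \<bar>s\<bar> < r \<Longrightarrow> (b2 has_real_derivative b3 s) (at s)"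
    and K: "K > 0" "\<And>s. \<bar>s\<bar> < r \<Longrightarrow> \<bar>b2 s - 2 * (b1 s)\<^sup>2\<bar> = K * exp (8 * b s)"
  obtains \<delta> \<beta> \<alpha> where "4 * \<alpha> * \<delta> - \<beta>\<^sup>2 \<noteq> 0"
    "\<And>s. \<bar>s\<bar> < r \<Longrightarrow> exp (- 4 * b s) = \<delta> + \<beta> * s + \<alpha> * s\<^sup>2"
proof -
  define q where "q s = exp (- 4 * b s)" for s
  define q1 where "q1 s = - 4 * b1 s * q s" for s
  define q2 where "q2 s = (- 4 * b2 s + 16 * b1 s * b1 s) * q s" for s
  define q3 where "q3 s = (- 4 * b3 s + 32 * b1 s * b2 s) * q s + (- 4 * b2 s + 16 * b1 s * b1 s) * q1 s" for s
  have dq: "(q has_real_derivative q1 s) (at s)" if "\<bar>s\<bar> < r" for s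
    unfolding q_def[abs_def] q1_def using d(1)[OF that] by (auto intro!: derivative_eq_intros simp: q_def)
  have dq1: "(q1 has_real_derivative q2 s) (at s)" if "\<bar>s\<bar> < r" for s
    unfolding q1_def[abs_def] q2_def using d(2)[OF that] dq[OF that]
    by (auto intro!: derivative_eq_intros simp: q1_def algebra_simps)
  have dq2: "(q2 has_real_derivative q3 s) (at s)" if "\<bar>s\<bar> < r" for s
    unfolding q2_def[abs_def] q3_def using d(2,3)[OF that] dq[OF that]
    by (auto intro!: derivative_eq_intros simp: algebra_simps)
  define \<Phi> where "\<Phi> s = 2 * q s * q2 s - (q1 s)\<^sup>2" for s
  have \<Phi>: "\<bar>\<Phi> s\<bar> = 8 * K" if "\<bar>s\<bar> < r" for s
  proof -
    have "\<Phi> s = - 8 * (b2 s - 2 * (b1 s)\<^sup>2) * (q s)\<^sup>2"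
      by (simp add: \<Phi>_def q2_def q1_def power2_eq_square algebra_simps)
    then have "\<bar>\<Phi> s\<bar> = 8 * \<bar>b2 s - 2 * (b1 s)\<^sup>2\<bar> * (q s)\<^sup>2"
      by (simp only: abs_mult) simp
    also have "\<dots> = 8 * (K * exp (8 * b s)) * (q s)\<^sup>2"
      by (simp only: K(2)[OF that])
    also have "\<dots> = 8 * K * (exp (8 * b s) * exp (- 8 * b s))"
      by (simp add: q_def power2_eq_square flip: exp_add)
    also have "\<dots> = 8 * K" by (simp flip: exp_add)
    finally show ?thesis .
  qed
  have q3_0: "q3 s = 0" if s: "\<bar>s\<bar> < r" for s
  proof -
    have "(\<Phi> has_real_derivative 2 * q s * q3 s) (at s)"
      unfolding \<Phi>_def[abs_def] using dq[OF s] dq1[OF s] dq2[OF s]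
      by (auto intro!: derivative_eq_intros simp: algebra_simps)
    \<comment> \<open>Only the absolute value of \<Phi> is known to be constant, so the derivative
      of the square is compared with 0.\<close>
    then have "((\<lambda>s. (\<Phi> s)\<^sup>2) has_real_derivative 2 * \<Phi> s * (2 * q s * q3 s)) (at s)"
      by (auto intro!: derivative_eq_intros)
    moreover have "((\<lambda>s. (\<Phi> s)\<^sup>2) has_real_derivative 0) (at s)"
    proof (rule has_field_derivative_transform_within_open[OF DERIV_const])
      show "open {-r<..<r}" "s \<in> {-r<..<r}" using s by auto
      show "(8 * K)\<^sup>2 = (\<Phi> t)\<^sup>2" if "t \<in> {-r<..<r}" for t
      proof -
        have "\<bar>t\<bar> < r" using that by auto
        from \<Phi>[OF this] show ?thesis by (metis power2_abs)
      qed
    qed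
    ultimately have "2 * \<Phi> s * (2 * q s * q3 s) = 0" by (rule DERIV_unique)
    moreover have "\<Phi> s \<noteq> 0" using \<Phi>[OF s] K(1) by auto
    moreover have "q s \<noteq> 0" by (simp add: q_def)
    ultimately show ?thesis by simp
  qed
  have const: "g s = g 0" if s: "\<bar>s\<bar> < r" and g: "\<And>s. \<bar>s\<bar> < r \<Longrightarrow> (g has_real_derivative 0) (at s)" for g s
  proof (rule has_field_derivative_zero_constant[of "{-r<..<r}" g, THEN exE])
    show "(g has_real_derivative 0) (at s within {-r<..<r})" if "s \<in> {-r<..<r}" for s
    proof -
      have "\<bar>s\<bar> < r" using that by auto
      from g[OF this] show ?thesis by (rule has_field_derivative_at_within)
    qed
    fix c assume "\<forall>x\<in>{-r<..<r}. g x = c"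
    moreover have "s \<in> {-r<..<r}" "0 \<in> {-r<..<r}" using s r by auto
    ultimately show "g s = g 0" by simp
  qed simp
  have q2c: "q2 s = q2 0" if "\<bar>s\<bar> < r" for s
    by (rule const[OF that]) (use dq2 q3_0 in metis)
  have d1: "((\<lambda>s. q1 s - q2 0 * s) has_real_derivative 0) (at s)" if "\<bar>s\<bar> < r" for s
  proof -
    have "((\<lambda>s. q1 s - q2 0 * s) has_real_derivative q2 s - q2 0 * 1) (at s)"
      by (intro DERIV_diff dq1[OF that] DERIV_cmult DERIV_ident)
    then show ?thesis by (simp only: q2c[OF that]) simp
  qed
  have q1c: "q1 s = q1 0 + q2 0 * s" if "\<bar>s\<bar> < r" for s
    using const[OF that, of "\<lambda>s. q1 s - q2 0 * s"] d1 by simp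
  have d2: "((\<lambda>s. q s - q1 0 * s - q2 0 / 2 * s\<^sup>2) has_real_derivative 0) (at s)" if "\<bar>s\<bar> < r" for s
  proof -
    have "((\<lambda>s. q s - q1 0 * s - q2 0 / 2 * s\<^sup>2) has_real_derivative q1 s - q1 0 * 1 - q2 0 / 2 * (2 * s)) (at s)"
      by (intro DERIV_diff dq[OF that] DERIV_cmult DERIV_ident) (auto intro!: derivative_eq_intros)
    then show ?thesis by (simp only: q1c[OF that]) simp
  qed
  have qc: "q s - q1 0 * s - q2 0 / 2 * s\<^sup>2 = q 0" if "\<bar>s\<bar> < r" for s
    using const[OF that, of "\<lambda>s. q s - q1 0 * s - q2 0 / 2 * s\<^sup>2"] d2 by simp
  have "q s = q 0 + q1 0 * s + q2 0 / 2 * s\<^sup>2" if "\<bar>s\<bar> < r" for s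
    using qc[OF that] by linarith
  \<comment> \<open>The left side is \<open>\<Phi> 0\<close>, whose absolute value is 8 K.\<close>
  moreover have "4 * (q2 0 / 2) * q 0 - (q1 0)\<^sup>2 \<noteq> 0"
    using \<Phi>[of 0] r K(1) by (auto simp: \<Phi>_def mult.commute mult.left_commute)
  ultimately show thesis using that[of "q2 0 / 2" "q 0" "q1 0"] unfolding q_def by blast
qed

section \<open>Functions on a ball that depend on few coordinates\<close>

lemma norm_scaleR_axis [simp]: "norm (s *\<^sub>R axis i (1::real)) = \<bar>s\<bar>"
  by (simp add: norm_axis_1)

lemma slice_derivative:
  fixes f :: "real^3 \<Rightarrow> real"
  assumes "smooth_on V f" "a + s *\<^sub>R axis i 1 \<in> V"
  shows "((\<lambda>s. f (a + s *\<^sub>R axis i 1)) has_real_derivative pd i f (a + s *\<^sub>R axis i 1)) (at s)"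
proof -
  let ?x = "a + s *\<^sub>R axis i 1"
  have "((\<lambda>s. a + s *\<^sub>R axis i 1) has_derivative (\<lambda>h. h *\<^sub>R axis i 1)) (at s)"
    by (auto intro!: derivative_eq_intros)
  from has_derivative_compose[OF this smooth_on_has_derivative[OF assms]]
  have "((\<lambda>s. f (a + s *\<^sub>R axis i 1)) has_derivative (\<lambda>h. frechet_derivative f (at ?x) (h *\<^sub>R axis i 1))) (at s)" .
  moreover have "frechet_derivative f (at ?x) (h *\<^sub>R axis i 1) = pd i f ?x * h" for h
    using linear_scale[OF smooth_on_linear_derivative[OF assms]] by (simp add: pd_def)
  ultimately show ?thesis by (simp add: has_field_derivative_def)
qed

lemma pd_cong:
  assumes "open V" "x \<in> V" "smooth_on V f" "\<And>y. y \<in> V \<Longrightarrow> f y = g y"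
  shows "pd i f x = pd i g x"
proof -
  have "f differentiable (at x)"
    using smooth_on_has_derivative[OF assms(3,2)] differentiable_def by blast
  from frechet_derivative_transform_within_open[OF this assms(1,2,4)] show ?thesis by (simp add: pd_def)
qed

lemma pd_zero:
  assumes "open V" "x \<in> V" "\<And>y. y \<in> V \<Longrightarrow> f y = 0"
  shows "pd i f x = 0"
  using pd_cong[of V x "\<lambda>_. 0" f i] assms by (simp add: pd_def)

lemma pd_symmetric:
  fixes f :: "real^3 \<Rightarrow> real"
  shows "open V \<Longrightarrow> smooth_on V f \<Longrightarrow> x \<in> V \<Longrightarrow> pd i (pd j f) x = pd j (pd i f) x"
  unfolding pd_def[abs_def] by (rule smooth_on_second_derivative_symmetric)

text \<open>Shrinking one coordinate does not increase the norm, so the segment from x to its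
  projection stays in the ball, and f is constant along it.\<close>

lemma drop_coordinate:
  fixes f :: "real^3 \<Rightarrow> real"
  assumes "smooth_on (ball 0 r) f" "\<And>x. x \<in> ball 0 r \<Longrightarrow> pd i f x = 0" "x \<in> ball 0 r"
  shows "f x = f (x - x $ i *\<^sub>R axis i 1)"
proof -
  let ?y = "\<lambda>s. x + s *\<^sub>R axis i 1"
  \<comment> \<open>The parameter 0 belongs to x, the parameter \<open>- x $ i\<close> to its
    projection.\<close>
  let ?S = "closed_segment (- x $ i) 0"
  have inb: "?y s \<in> ball 0 r" if "s \<in> ?S" for s
  proof -
    have "\<bar>x $ i + s\<bar> \<le> \<bar>x $ i\<bar>" using that by (auto simp: closed_segment_eq_real_ivl split: if_splits)
    then have "norm (?y s) \<le> norm x"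
      by (intro norm_le_componentwise_cart) (auto simp: axis_def)
    then show ?thesis using assms(3) by simp
  qed
  have "\<exists>c. \<forall>s\<in>?S. f (?y s) = c"
  proof (rule has_field_derivative_zero_constant)
    show "((\<lambda>s. f (?y s)) has_real_derivative 0) (at s within ?S)" if "s \<in> ?S" for s
      using slice_derivative[OF assms(1) inb[OF that]] assms(2)[OF inb[OF that]]
      by (simp add: has_field_derivative_at_within)
  qed simp
  then have "f (?y 0) = f (?y (- x $ i))" by (metis ends_in_segment)
  then show ?thesis by simp
qed

lemma single_coordinate:
  fixes f :: "real^3 \<Rightarrow> real"
  assumes "smooth_on (ball 0 r) f" "x \<in> ball 0 r"
    and "\<And>j x. j \<noteq> i \<Longrightarrow> x \<in> ball 0 r \<Longrightarrow> pd j f x = 0"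
  shows "f x = f (x $ i *\<^sub>R axis i 1)"
proof -
  obtain j k where jk: "j \<noteq> i" "k \<noteq> i" "j \<noteq> k" "x = x $ i *\<^sub>R axis i 1 + x $ j *\<^sub>R axis j 1 + x $ k *\<^sub>R axis k 1"
  proof -
    have e: "x = x $ 1 *\<^sub>R axis 1 1 + x $ 2 *\<^sub>R axis 2 1 + x $ 3 *\<^sub>R axis 3 1"
      by (simp add: vec_eq_iff forall_3 axis_def)
    from exhaust_3[of i] show thesis
      by (elim disjE) (use e in \<open>(intro that[of 2 3] that[of 1 3] that[of 1 2]; simp add: algebra_simps)+\<close>)
  qed
  let ?y = "x - x $ j *\<^sub>R axis j 1"
  have y: "norm ?y \<le> norm x" by (intro norm_le_componentwise_cart) (auto simp: axis_def)
  have "f x = f ?y" by (rule drop_coordinate[OF assms(1) assms(3)[OF jk(1)] assms(2)])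
  also have "\<dots> = f (?y - ?y $ k *\<^sub>R axis k 1)"
    by (rule drop_coordinate[OF assms(1) assms(3)[OF jk(2)]]) (use y assms(2) in auto)
  also have "?y $ k = x $ k" using jk(3) by (simp add: axis_def)
  also have "x - x $ j *\<^sub>R axis j 1 - x $ k *\<^sub>R axis k 1 = x $ i *\<^sub>R axis i 1"
    by (subst (1) jk(4)) (simp add: algebra_simps)
  finally show ?thesis .
qed

text \<open>Eigenvectors of \<open>Jt\<close>: \<open>plus_pt s\<close> is (1, s) in the eigenplane
  for 1, \<open>minus_pt t\<close> is (1, t) in the one for -1, and \<open>plus_dir\<close> and
  \<open>minus_dir\<close> are (0, 1) there. The factor 1/2 normalizes them for the coordinates x_i
  + y_i and x_i - y_i.\<close>

definition plus_pt :: "real \<Rightarrow> real^4" where "plus_pt s = vector [1/2, s/2, 1/2, s/2]"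
definition minus_pt :: "real \<Rightarrow> real^4" where "minus_pt t = vector [1/2, t/2, -1/2, -t/2]"
definition plus_dir :: "real^4" where "plus_dir = vector [0, 1/2, 0, 1/2]"
definition minus_dir :: "real^4" where "minus_dir = vector [0, 1/2, 0, -1/2]"

lemmas null_frame_defs = plus_pt_def minus_pt_def plus_dir_def minus_dir_def

lemma Jt_null_frame [simp]:
  "Jt (plus_pt s) = plus_pt s" "Jt (minus_pt t) = - minus_pt t" "Jt plus_dir = plus_dir" "Jt minus_dir = - minus_dir"
  by (simp_all add: Jt_def vec_eq_4 null_frame_defs)

text \<open>The rows are the coordinate frame of an adapted sphere and its position vector, with b1
  and b2 standing for derivatives of B. Their terms are multiples of the last row and drop
  out.\<close>

lemma rows4_null_frame:
  "rows4 (b1 *\<^sub>R (e1 *\<^sub>R plus_pt s + e2 *\<^sub>R minus_pt t) + e1 *\<^sub>R plus_dir)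
    (b2 *\<^sub>R (e1 *\<^sub>R plus_pt s + e2 *\<^sub>R minus_pt t) + e2 *\<^sub>R minus_dir)
    (e1 *\<^sub>R plus_pt s - e2 *\<^sub>R minus_pt t) (e1 *\<^sub>R plus_pt s + e2 *\<^sub>R minus_pt t) = - (e1\<^sup>2 * e2\<^sup>2 / 2)"
  by (simp add: det_4 null_frame_defs field_simps power2_eq_square)

lemma null_frame_independent:
  assumes "a *\<^sub>R plus_pt s + b *\<^sub>R plus_dir + c *\<^sub>R minus_pt t + d *\<^sub>R minus_dir =
    a' *\<^sub>R plus_pt s + b' *\<^sub>R plus_dir + c' *\<^sub>R minus_pt t + d' *\<^sub>R minus_dir"
  shows "a = a'" "b = b'" "c = c'" "d = d'"
proof -
  have e: "a/2 + c/2 = a'/2 + c'/2" "a/2 - c/2 = a'/2 - c'/2"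
    "a * s/2 + b/2 + c * t/2 + d/2 = a' * s/2 + b'/2 + c' * t/2 + d'/2"
    "a * s/2 + b/2 - c * t/2 - d/2 = a' * s/2 + b'/2 - c' * t/2 - d'/2"
    using assms by (simp_all add: vec_eq_4 null_frame_defs)
  show "a = a'" "c = c'" using e(1,2) by linarith+
  then show "b = b'" "d = d'" using e(3,4) by simp_all
qed

text \<open>The coordinates are the two slopes and half the logarithm of u_1 / v_1; B is the only
  remaining unknown.\<close>

locale adapted_sphere =
  fixes r k :: real and G :: "real^3 \<Rightarrow> real^4" and B :: "real^3 \<Rightarrow> real"
  assumes r: "r > 0" and k: "k > 0" and sphere: "centroaffine_sphere k (ball 0 r) G"
    and smooth_B: "smooth_on (ball 0 r) B"
    and G_eq: "\<And>x. x \<in> ball 0 r \<Longrightarrow> G x = exp (B x + x$3) *\<^sub>R plus_pt (x$1) + exp (B x - x$3) *\<^sub>R minus_pt (x$2)"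
begin

abbreviation V :: "(real^3) set" where "V \<equiv> ball 0 r"
abbreviation e1 where "e1 x \<equiv> exp (B x + x$3)"
abbreviation e2 where "e2 x \<equiv> exp (B x - x$3)"

lemma has_derivative_B: "x \<in> V \<Longrightarrow> (B has_derivative frechet_derivative B (at x)) (at x)"
  by (rule smooth_on_has_derivative[OF smooth_B])

lemma has_derivative_G:
  assumes "x \<in> V"
  shows "(G has_derivative (\<lambda>v. ((frechet_derivative B (at x) v + v$3) * e1 x) *\<^sub>R plus_pt (x$1) + (v$1 * e1 x) *\<^sub>R plus_dir
    + ((frechet_derivative B (at x) v - v$3) * e2 x) *\<^sub>R minus_pt (x$2) + (v$2 * e2 x) *\<^sub>R minus_dir)) (at x)"
proof -
  have 1: "((\<lambda>y. plus_pt (y$1)) has_derivative (\<lambda>v. v$1 *\<^sub>R plus_dir)) (at x)"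
  proof -
    have "plus_pt s = vector [1/2, 0, 1/2, 0] + s *\<^sub>R plus_dir" for s by (simp add: vec_eq_4 null_frame_defs)
    then show ?thesis by (auto intro!: derivative_eq_intros bounded_linear.has_derivative[OF bounded_linear_vec_nth])
  qed
  have 2: "((\<lambda>y. minus_pt (y$2)) has_derivative (\<lambda>v. v$2 *\<^sub>R minus_dir)) (at x)"
  proof -
    have "minus_pt s = vector [1/2, 0, -1/2, 0] + s *\<^sub>R minus_dir" for s by (simp add: vec_eq_4 null_frame_defs)
    then show ?thesis by (auto intro!: derivative_eq_intros bounded_linear.has_derivative[OF bounded_linear_vec_nth])
  qed
  have c: "((\<lambda>y::real^3. y$3) has_derivative (\<lambda>v. v$3)) (at x)"
    by (rule bounded_linear.has_derivative[OF bounded_linear_vec_nth has_derivative_ident])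
  have "((\<lambda>y. exp (B y + y$3) *\<^sub>R plus_pt (y$1) + exp (B y - y$3) *\<^sub>R minus_pt (y$2)) has_derivative
      (\<lambda>v. e1 x *\<^sub>R (v$1 *\<^sub>R plus_dir) + ((frechet_derivative B (at x) v + v$3) * e1 x) *\<^sub>R plus_pt (x$1)
      + (e2 x *\<^sub>R (v$2 *\<^sub>R minus_dir) + ((frechet_derivative B (at x) v - v$3) * e2 x) *\<^sub>R minus_pt (x$2)))) (at x)"
    by (intro has_derivative_add has_derivative_scaleR has_derivative_diff has_derivative_exp
        has_derivative_B[OF assms] c 1 2)
  then have "(G has_derivative
      (\<lambda>v. e1 x *\<^sub>R (v$1 *\<^sub>R plus_dir) + ((frechet_derivative B (at x) v + v$3) * e1 x) *\<^sub>R plus_pt (x$1)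
      + (e2 x *\<^sub>R (v$2 *\<^sub>R minus_dir) + ((frechet_derivative B (at x) v - v$3) * e2 x) *\<^sub>R minus_pt (x$2)))) (at x)"
    by (rule has_derivative_transform_within_open[OF _ open_ball assms]) (use G_eq in simp)
  then show ?thesis by (rule has_derivative_eq_rhs) (simp add: fun_eq_iff algebra_simps)
qed

lemma DG:
  assumes "x \<in> V"
  shows "frechet_derivative G (at x) v = ((frechet_derivative B (at x) v + v$3) * e1 x) *\<^sub>R plus_pt (x$1) + (v$1 * e1 x) *\<^sub>R plus_dir
    + ((frechet_derivative B (at x) v - v$3) * e2 x) *\<^sub>R minus_pt (x$2) + (v$2 * e2 x) *\<^sub>R minus_dir"
  using fun_cong[OF frechet_derivative_at[OF has_derivative_G[OF assms]], of v] by simp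

lemma not_tangent: "x \<in> V \<Longrightarrow> G x \<notin> tangent_image G x"
  and Jt_tangent: "x \<in> V \<Longrightarrow> Jt (G x) \<in> tangent_image G x"
  using sphere unfolding centroaffine_sphere_def by blast+

lemma smooth_G: "smooth_on V G"
  using sphere unfolding centroaffine_sphere_def by blast

lemma Jt_G: "x \<in> V \<Longrightarrow> Jt (G x) = e1 x *\<^sub>R plus_pt (x$1) - e2 x *\<^sub>R minus_pt (x$2)"
  by (simp add: G_eq linear_add[OF linear_Jt] linear_scale[OF linear_Jt])

text \<open>Let v be the tangent vector mapped to \<open>Jt\<close> G. Comparing coefficients in the
  eigenplanes, neither slope changes along v, and D B v + v_3 = 1 while D B v - v_3 = - 1. Hence v
  is the third unit vector and B is stationary along it.\<close>

lemma pd3_B: "x \<in> V \<Longrightarrow> pd 3 B x = 0"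
proof -
  assume x: "x \<in> V"
  obtain v where v: "Jt (G x) = frechet_derivative G (at x) v"
    using Jt_tangent[OF x] unfolding tangent_image_def by blast
  have "e1 x *\<^sub>R plus_pt (x$1) + 0 *\<^sub>R plus_dir + (- e2 x) *\<^sub>R minus_pt (x$2) + 0 *\<^sub>R minus_dir =
    ((frechet_derivative B (at x) v + v$3) * e1 x) *\<^sub>R plus_pt (x$1) + (v$1 * e1 x) *\<^sub>R plus_dir
    + ((frechet_derivative B (at x) v - v$3) * e2 x) *\<^sub>R minus_pt (x$2) + (v$2 * e2 x) *\<^sub>R minus_dir"
    using v unfolding DG[OF x] Jt_G[OF x] by simp
  from null_frame_independent[OF this]
  have "v$1 = 0" "v$2 = 0" "frechet_derivative B (at x) v + v$3 = 1"
    and "(frechet_derivative B (at x) v - v$3) * e2 x = - 1 * e2 x"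
    by auto
  moreover from this(4) have "frechet_derivative B (at x) v - v$3 = -1"
    unfolding mult_right_cancel[OF exp_not_eq_zero] .
  ultimately have "frechet_derivative B (at x) v = 0" "v = axis 3 1"
    by (auto simp: vec_eq_iff forall_3 axis_def)
  then show ?thesis by (simp add: pd_def)
qed

lemma pd_G:
  assumes "x \<in> V"
  shows "pd 1 G x = pd 1 B x *\<^sub>R G x + e1 x *\<^sub>R plus_dir"
    and "pd 2 G x = pd 2 B x *\<^sub>R G x + e2 x *\<^sub>R minus_dir"
    and "pd 3 G x = Jt (G x)"
proof -
  have "frechet_derivative B (at x) (axis i 1) = pd i B x" for i by (simp add: pd_def)
  note * = DG[OF assms, of "axis _ 1", unfolded this, folded pd_def]
  show "pd 1 G x = pd 1 B x *\<^sub>R G x + e1 x *\<^sub>R plus_dir"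
    "pd 2 G x = pd 2 B x *\<^sub>R G x + e2 x *\<^sub>R minus_dir"
    unfolding * G_eq[OF assms] by (simp_all add: axis_def algebra_simps)
  show "pd 3 G x = Jt (G x)"
    unfolding * Jt_G[OF assms] pd3_B[OF assms] by (simp add: axis_def)
qed

lemma smooth_pd_B: "smooth_on V (pd i B)"
  by (rule smooth_on_pd[OF smooth_B])

lemma pd3_pd_B: "x \<in> V \<Longrightarrow> pd 3 (pd i B) x = 0"
  using pd_symmetric[OF open_ball smooth_B, of x 3 i] pd_zero[where V = V and f = "pd 3 B" and i = i and x = x, OF open_ball _ pd3_B] by simp

lemma subspace_tangent: "x \<in> V \<Longrightarrow> subspace (tangent_image G x)"
  unfolding tangent_image_def
  by (rule linear_subspace_image[OF smooth_on_linear_derivative[OF smooth_G] subspace_UNIV])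

lemma pd_G_tangent: "x \<in> V \<Longrightarrow> pd i G x \<in> tangent_image G x"
  unfolding tangent_image_def pd_def by blast

text \<open>The fields \<open>X\<close> and \<open>Y\<close> below span \<open>\<D>\<close>: they are mapped into the two eigenspaces of \<open>Jt\<close>.\<close>

lemma pd12_B:
  assumes x: "x \<in> V"
  shows "pd 1 (pd 2 B) x = 0"
proof -
  \<comment> \<open>The third direction is mapped to \<open>Jt\<close> G. Adding the right multiple
    of it turns the multiple of G in \<open>pd_G\<close> into one of G + \<open>Jt\<close> G or of G
    - \<open>Jt\<close> G, which lies in a single eigenplane.\<close>
  define X Y :: "real^3 \<Rightarrow> real^3" where "X = (\<lambda>y. axis 1 1 + pd 1 B y *\<^sub>R axis 3 1)"
    and "Y = (\<lambda>y. axis 2 1 + (- pd 2 B y) *\<^sub>R axis 3 1)"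
  have sm: "smooth_on V X" "smooth_on V Y"
    unfolding X_def Y_def
    by (intro smooth_on_add smooth_on_scaleR smooth_on_minus smooth_pd_B smooth_on_const open_ball)+
  have lin: "linear (frechet_derivative G (at y))" if "y \<in> V" for y
    by (rule smooth_on_linear_derivative[OF smooth_G that])
  have GX: "frechet_derivative G (at y) (X y) = (2 * pd 1 B y * e1 y) *\<^sub>R plus_pt (y$1) + e1 y *\<^sub>R plus_dir" if y: "y \<in> V" for y
  proof -
    have "frechet_derivative G (at y) (X y) = pd 1 G y + pd 1 B y *\<^sub>R pd 3 G y"
      unfolding X_def linear_add[OF lin[OF y]] linear_scale[OF lin[OF y]] by (simp only: pd_def)
    then show ?thesis
      unfolding pd_G[OF y] Jt_G[OF y] by (simp add: G_eq[OF y] algebra_simps flip: scaleR_add_left)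
  qed
  have GY: "frechet_derivative G (at y) (Y y) = (2 * pd 2 B y * e2 y) *\<^sub>R minus_pt (y$2) + e2 y *\<^sub>R minus_dir" if y: "y \<in> V" for y
  proof -
    have "frechet_derivative G (at y) (Y y) = pd 2 G y + (- pd 2 B y) *\<^sub>R pd 3 G y"
      unfolding Y_def linear_add[OF lin[OF y]] linear_scale[OF lin[OF y]] by (simp only: pd_def)
    then show ?thesis
      unfolding pd_G[OF y] Jt_G[OF y] by (simp add: G_eq[OF y] algebra_simps flip: scaleR_add_left)
  qed
  have dX: "X y \<in> distr G y" if y: "y \<in> V" for y
  proof -
    have "Jt (frechet_derivative G (at y) (X y)) = frechet_derivative G (at y) (X y)"
      unfolding GX[OF y] by (simp add: linear_add[OF linear_Jt] linear_scale[OF linear_Jt])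
    then have "frechet_derivative G (at y) (X y) \<in> Jt ` tangent_image G y"
      unfolding tangent_image_def by (metis imageI rangeI)
    then show ?thesis by (simp add: distr_def tangent_image_def)
  qed
  have dY: "Y y \<in> distr G y" if y: "y \<in> V" for y
  proof -
    have "Jt (frechet_derivative G (at y) (- Y y)) = frechet_derivative G (at y) (Y y)"
      unfolding linear_neg[OF lin[OF y]] GY[OF y]
      by (simp add: linear_add[OF linear_Jt] linear_scale[OF linear_Jt] linear_neg[OF linear_Jt] linear_diff[OF linear_Jt])
    then have "frechet_derivative G (at y) (Y y) \<in> Jt ` tangent_image G y"
      unfolding tangent_image_def by (metis imageI rangeI)
    then show ?thesis by (simp add: distr_def tangent_image_def)
  qed
  have lie_in: "lie X Y x \<in> distr G x"
    using sphere sm dX dY x unfolding centroaffine_sphere_def by blast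
  define c where "c = - 2 * pd 1 (pd 2 B) x"
  have dB: "(pd j B has_derivative frechet_derivative (pd j B) (at x)) (at x)" for j
    by (rule smooth_on_has_derivative[OF smooth_pd_B x])
  have "(Y has_derivative (\<lambda>v. 0 + (- frechet_derivative (pd 2 B) (at x) v) *\<^sub>R axis 3 1)) (at x)"
    unfolding Y_def
    by (intro has_derivative_add has_derivative_const has_derivative_scaleR_left has_derivative_minus dB)
  from fun_cong[OF frechet_derivative_at[OF this]]
  have DY: "frechet_derivative Y (at x) v = - frechet_derivative (pd 2 B) (at x) v *\<^sub>R axis 3 1" for v
    by (metis add_0)
  have "(X has_derivative (\<lambda>v. 0 + (frechet_derivative (pd 1 B) (at x) v) *\<^sub>R axis 3 1)) (at x)"
    unfolding X_def
    by (intro has_derivative_add has_derivative_const has_derivative_scaleR_left dB)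
  from fun_cong[OF frechet_derivative_at[OF this]]
  have DX: "frechet_derivative X (at x) v = frechet_derivative (pd 1 B) (at x) v *\<^sub>R axis 3 1" for v
    by (metis add_0)
  have l2: "linear (frechet_derivative (pd j B) (at x))" for j
    by (rule smooth_on_linear_derivative[OF smooth_pd_B x])
  have "frechet_derivative (pd 2 B) (at x) (X x) = pd 1 (pd 2 B) x + pd 1 B x * pd 3 (pd 2 B) x"
    unfolding X_def linear_add[OF l2] linear_scale[OF l2] by (simp add: pd_def[of _ "pd 2 B"])
  then have a1: "frechet_derivative (pd 2 B) (at x) (X x) = pd 1 (pd 2 B) x"
    using pd3_pd_B[OF x] by simp
  have "frechet_derivative (pd 1 B) (at x) (Y x) = pd 2 (pd 1 B) x + - pd 2 B x * pd 3 (pd 1 B) x"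
    unfolding Y_def linear_add[OF l2] linear_scale[OF l2] by (simp add: pd_def[of _ "pd 1 B"])
  then have a2: "frechet_derivative (pd 1 B) (at x) (Y x) = pd 1 (pd 2 B) x"
    using pd3_pd_B[OF x] pd_symmetric[OF open_ball smooth_B x, of 2 1] by simp
  \<comment> \<open>Only the third components of X and Y vary, and neither depends on
    \<open>x $ 3\<close>; so the bracket points along the third axis.\<close>
  have lie: "lie X Y x = c *\<^sub>R axis 3 1"
    unfolding lie_def deriv_along_def DX DY a1 a2 c_def by (simp add: vec_eq_iff forall_3 axis_def)
  have "frechet_derivative G (at x) (lie X Y x) = c *\<^sub>R Jt (G x)"
    unfolding lie linear_scale[OF lin[OF x]] pd_G(3)[OF x, symmetric] by (simp only: pd_def)
  then have "Jt (c *\<^sub>R G x) \<in> Jt ` tangent_image G x"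
    using lie_in by (simp add: distr_def linear_scale[OF linear_Jt])
  \<comment> \<open>\<open>Jt\<close> is an involution, so c G itself is tangent, whereas G is
    transversal.\<close>
  then have cG: "c *\<^sub>R G x \<in> tangent_image G x" by (metis Jt_Jt imageE)
  have "c = 0"
  proof (rule ccontr)
    assume "c \<noteq> 0"
    then have "G x = (1 / c) *\<^sub>R (c *\<^sub>R G x)" by simp
    then have "G x \<in> tangent_image G x" using subspace_scale[OF subspace_tangent[OF x] cG] by metis
    then show False using not_tangent[OF x] by blast
  qed
  then show ?thesis by (simp add: c_def)
qed

text \<open>In the first two formulas the eigendirection from \<open>pd_G\<close> is written as a
  first derivative minus its multiple of G, so that the result is a combination of G and first
  derivatives, as the Gauss formula requires. The number \<open>axis i 1 $ 3\<close> is the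
  derivative of the third coordinate in direction i.\<close>

lemma pd_pd_G:
  assumes x: "x \<in> V"
  shows "pd i (pd 1 G) x = pd i (pd 1 B) x *\<^sub>R G x + pd 1 B x *\<^sub>R pd i G x
      + (pd i B x + axis i 1 $ 3) *\<^sub>R (pd 1 G x - pd 1 B x *\<^sub>R G x)"
    and "pd i (pd 2 G) x = pd i (pd 2 B) x *\<^sub>R G x + pd 2 B x *\<^sub>R pd i G x
      + (pd i B x - axis i 1 $ 3) *\<^sub>R (pd 2 G x - pd 2 B x *\<^sub>R G x)"
    and "pd i (pd 3 G) x = Jt (pd i G x)"
proof -
  have dB: "(pd j B has_derivative frechet_derivative (pd j B) (at x)) (at x)" for j
    by (rule smooth_on_has_derivative[OF smooth_pd_B x])
  have dG: "(G has_derivative frechet_derivative G (at x)) (at x)"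
    by (rule smooth_on_has_derivative[OF smooth_G x])
  have c: "((\<lambda>y::real^3. y$3) has_derivative (\<lambda>v. v$3)) (at x)"
    by (rule bounded_linear.has_derivative[OF bounded_linear_vec_nth has_derivative_ident])
  have "((\<lambda>y. pd 1 B y *\<^sub>R G y + e1 y *\<^sub>R plus_dir) has_derivative
      (\<lambda>v. pd 1 B x *\<^sub>R frechet_derivative G (at x) v + frechet_derivative (pd 1 B) (at x) v *\<^sub>R G x
        + ((frechet_derivative B (at x) v + v$3) * e1 x) *\<^sub>R plus_dir)) (at x)"
    by (intro has_derivative_add has_derivative_scaleR has_derivative_scaleR_left has_derivative_exp
        has_derivative_B[OF x] dB dG c)
  then have "(pd 1 G has_derivative
      (\<lambda>v. pd 1 B x *\<^sub>R frechet_derivative G (at x) v + frechet_derivative (pd 1 B) (at x) v *\<^sub>R G x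
        + ((frechet_derivative B (at x) v + v$3) * e1 x) *\<^sub>R plus_dir)) (at x)"
    by (rule has_derivative_transform_within_open[OF _ open_ball x]) (use pd_G in simp)
  from fun_cong[OF frechet_derivative_at[OF this], of "axis i 1"]
  have "pd i (pd 1 G) x = pd 1 B x *\<^sub>R pd i G x + pd i (pd 1 B) x *\<^sub>R G x
      + ((pd i B x + axis i 1 $ 3) * e1 x) *\<^sub>R plus_dir"
    by (simp only: pd_def)
  then show "pd i (pd 1 G) x = pd i (pd 1 B) x *\<^sub>R G x + pd 1 B x *\<^sub>R pd i G x
      + (pd i B x + axis i 1 $ 3) *\<^sub>R (pd 1 G x - pd 1 B x *\<^sub>R G x)"
    unfolding pd_G(1)[OF x] by simp
  have "((\<lambda>y. pd 2 B y *\<^sub>R G y + e2 y *\<^sub>R minus_dir) has_derivative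
      (\<lambda>v. pd 2 B x *\<^sub>R frechet_derivative G (at x) v + frechet_derivative (pd 2 B) (at x) v *\<^sub>R G x
        + ((frechet_derivative B (at x) v - v$3) * e2 x) *\<^sub>R minus_dir)) (at x)"
    by (intro has_derivative_add has_derivative_scaleR has_derivative_scaleR_left has_derivative_exp
        has_derivative_diff has_derivative_B[OF x] dB dG c)
  then have "(pd 2 G has_derivative
      (\<lambda>v. pd 2 B x *\<^sub>R frechet_derivative G (at x) v + frechet_derivative (pd 2 B) (at x) v *\<^sub>R G x
        + ((frechet_derivative B (at x) v - v$3) * e2 x) *\<^sub>R minus_dir)) (at x)"
    by (rule has_derivative_transform_within_open[OF _ open_ball x]) (use pd_G in simp)
  from fun_cong[OF frechet_derivative_at[OF this], of "axis i 1"]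
  have "pd i (pd 2 G) x = pd 2 B x *\<^sub>R pd i G x + pd i (pd 2 B) x *\<^sub>R G x
      + ((pd i B x - axis i 1 $ 3) * e2 x) *\<^sub>R minus_dir"
    by (simp only: pd_def)
  then show "pd i (pd 2 G) x = pd i (pd 2 B) x *\<^sub>R G x + pd 2 B x *\<^sub>R pd i G x
      + (pd i B x - axis i 1 $ 3) *\<^sub>R (pd 2 G x - pd 2 B x *\<^sub>R G x)"
    unfolding pd_G(2)[OF x] by simp
  have "((\<lambda>y. Jt (G y)) has_derivative (\<lambda>v. Jt (frechet_derivative G (at x) v))) (at x)"
    by (rule bounded_linear.has_derivative[OF linear_Jt[unfolded linear_conv_bounded_linear] dG])
  then have "(pd 3 G has_derivative (\<lambda>v. Jt (frechet_derivative G (at x) v))) (at x)"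
    by (rule has_derivative_transform_within_open[OF _ open_ball x]) (use pd_G in simp)
  from fun_cong[OF frechet_derivative_at[OF this], of "axis i 1"]
  show "pd i (pd 3 G) x = Jt (pd i G x)" by (simp only: pd_def)
qed

text \<open>The matrix h collects the coefficients of G in the second derivatives. Clearing its last
  row and column with the corner entry 1 leaves the diagonal entries B_11 - 2 B_1^2 and B_22 - 2
  B_2^2, since the mixed entry cancels. The volume is exp (4 B) / 2 up to sign; its square explains
  8 B and the factor 1/4.\<close>

lemma volume_B:
  assumes x: "x \<in> V"
  shows "\<bar>(pd 1 (pd 1 B) x - 2 * (pd 1 B x)\<^sup>2) * (pd 2 (pd 2 B) x - 2 * (pd 2 B x)\<^sup>2)\<bar> = k / 4 * exp (8 * B x)"
proof -
  let ?b1 = "pd 1 B x" and ?b2 = "pd 2 B x"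
  define h :: "real^3^3" where "h = vector [
    vector [pd 1 (pd 1 B) x - ?b1 * ?b1, - (?b1 * ?b2), - ?b1],
    vector [- (?b1 * ?b2), pd 2 (pd 2 B) x - ?b2 * ?b2, ?b2],
    vector [- ?b1, ?b2, 1]]"
  have b21: "pd 2 (pd 1 B) x = 0"
    using pd12_B[OF x] pd_symmetric[OF open_ball smooth_B x, of 2 1] by simp
  note sub = subspace_tangent[OF x]
  note t = pd_G_tangent[OF x]
  \<comment> \<open>To recognise c as an entry of h, the tangential remainder is exhibited; the
    values a1, a2, a3 supplied below are the coefficients of the induced connection.\<close>
  have comb: "w - c *\<^sub>R G x \<in> tangent_image G x"
    if "w = c *\<^sub>R G x + (a1 *\<^sub>R pd 1 G x + a2 *\<^sub>R pd 2 G x + a3 *\<^sub>R pd 3 G x)" for w c a1 a2 a3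
    unfolding that add_diff_cancel_left'
    by (intro subspace_add[OF sub] subspace_scale[OF sub] t)
  have ax: "axis (1::3) (1::real) $ 3 = 0" "axis (2::3) (1::real) $ 3 = 0" "axis (3::3) (1::real) $ 3 = 1"
    by (simp_all add: axis_def)
  have JG1: "Jt (pd 1 G x) = ?b1 *\<^sub>R pd 3 G x + (pd 1 G x - ?b1 *\<^sub>R G x)"
    unfolding pd_G[OF x] by (simp add: linear_add[OF linear_Jt] linear_scale[OF linear_Jt])
  have JG2: "Jt (pd 2 G x) = ?b2 *\<^sub>R pd 3 G x - (pd 2 G x - ?b2 *\<^sub>R G x)"
    unfolding pd_G[OF x] by (simp add: linear_add[OF linear_Jt] linear_scale[OF linear_Jt])
  have JG3: "Jt (pd 3 G x) = G x" by (simp add: pd_G[OF x])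
  have "pd i (pd j G) x - h $ i $ j *\<^sub>R G x \<in> tangent_image G x" for i j
  proof -
    have 1: "pd 1 (pd 1 G) x - h $ 1 $ 1 *\<^sub>R G x \<in> tangent_image G x"
      by (rule comb[of _ _ "2 * ?b1" 0 0]) (simp add: pd_pd_G[OF x] h_def ax vec_eq_iff algebra_simps)
    have 2: "pd 2 (pd 1 G) x - h $ 2 $ 1 *\<^sub>R G x \<in> tangent_image G x"
      by (rule comb[of _ _ "?b2" "?b1" 0]) (simp add: pd_pd_G[OF x] h_def ax b21 vec_eq_iff algebra_simps)
    have 3: "pd 3 (pd 1 G) x - h $ 3 $ 1 *\<^sub>R G x \<in> tangent_image G x"
      by (rule comb[of _ _ 1 0 "?b1"])
        (simp add: pd_pd_G[OF x] h_def ax pd3_pd_B[OF x] pd3_B[OF x] vec_eq_iff algebra_simps)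
    have 4: "pd 1 (pd 2 G) x - h $ 1 $ 2 *\<^sub>R G x \<in> tangent_image G x"
      by (rule comb[of _ _ "?b2" "?b1" 0]) (simp add: pd_pd_G[OF x] h_def ax pd12_B[OF x] vec_eq_iff algebra_simps)
    have 5: "pd 2 (pd 2 G) x - h $ 2 $ 2 *\<^sub>R G x \<in> tangent_image G x"
      by (rule comb[of _ _ 0 "2 * ?b2" 0]) (simp add: pd_pd_G[OF x] h_def ax vec_eq_iff algebra_simps)
    have 6: "pd 3 (pd 2 G) x - h $ 3 $ 2 *\<^sub>R G x \<in> tangent_image G x"
      by (rule comb[of _ _ 0 "-1" "?b2"])
        (simp add: pd_pd_G[OF x] h_def ax pd3_pd_B[OF x] pd3_B[OF x] vec_eq_iff algebra_simps)
    have 7: "pd 1 (pd 3 G) x - h $ 1 $ 3 *\<^sub>R G x \<in> tangent_image G x"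
      by (rule comb[of _ _ 1 0 "?b1"]) (simp add: pd_pd_G[OF x] h_def JG1 vec_eq_iff algebra_simps)
    have 8: "pd 2 (pd 3 G) x - h $ 2 $ 3 *\<^sub>R G x \<in> tangent_image G x"
      by (rule comb[of _ _ 0 "-1" "?b2"]) (simp add: pd_pd_G[OF x] h_def JG2 vec_eq_iff algebra_simps)
    have 9: "pd 3 (pd 3 G) x - h $ 3 $ 3 *\<^sub>R G x \<in> tangent_image G x"
      by (rule comb[of _ _ 0 0 0]) (simp add: pd_pd_G[OF x] h_def JG3)
    show ?thesis using exhaust_3[of i] exhaust_3[of j] 1 2 3 4 5 6 7 8 9 by (elim disjE) simp_all
  qed
  then have "\<bar>det h\<bar> = k * (rows4 (pd 1 G x) (pd 2 G x) (pd 3 G x) (G x))\<^sup>2"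
    using sphere x unfolding centroaffine_sphere_def by blast
  moreover have "det h = (pd 1 (pd 1 B) x - 2 * ?b1\<^sup>2) * (pd 2 (pd 2 B) x - 2 * ?b2\<^sup>2)"
    unfolding h_def by (simp add: det_3 power2_eq_square algebra_simps)
  moreover have "rows4 (pd 1 G x) (pd 2 G x) (pd 3 G x) (G x) = - ((e1 x)\<^sup>2 * (e2 x)\<^sup>2 / 2)"
    unfolding pd_G[OF x] Jt_G[OF x] unfolding G_eq[OF x] by (rule rows4_null_frame)
  moreover have "(- ((e1 x)\<^sup>2 * (e2 x)\<^sup>2 / 2))\<^sup>2 = exp (8 * B x) / 4"
    by (simp add: power2_eq_square flip: exp_add)
  ultimately show ?thesis by simp
qed

section \<open>Separation of the variables\<close>

lemma pd_single:
  assumes "x \<in> V" "i \<noteq> j" "i \<noteq> 3"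
  shows "pd j (pd i B) x = 0" "pd j (pd i (pd i B)) x = 0"
proof -
  have *: "pd j (pd i B) y = 0" if "y \<in> V" for y
  proof -
    consider "j = 3" | "i = 1" "j = 2" | "i = 2" "j = 1"
      using assms(2,3) exhaust_3[of i] exhaust_3[of j] by auto
    then show ?thesis
      using pd3_pd_B[OF that] pd12_B[OF that] pd_symmetric[OF open_ball smooth_B that, of 2 1] by cases auto
  qed
  show "pd j (pd i B) x = 0" by (rule *[OF assms(1)])
  show "pd j (pd i (pd i B)) x = 0"
    using pd_symmetric[OF open_ball smooth_pd_B assms(1), of j i i]
      pd_zero[where V = V and f = "pd j (pd i B)" and x = x and i = i, OF open_ball assms(1) *] by simp
qed

lemma axis_in_V: "\<bar>s\<bar> < r \<Longrightarrow> s *\<^sub>R axis i 1 \<in> V"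
  by simp

lemma B_single: "x \<in> V \<Longrightarrow> i \<noteq> 3 \<Longrightarrow> pd i B x = pd i B (x $ i *\<^sub>R axis i 1)"
  "x \<in> V \<Longrightarrow> i \<noteq> 3 \<Longrightarrow> pd i (pd i B) x = pd i (pd i B) (x $ i *\<^sub>R axis i 1)"
  by (rule single_coordinate[OF smooth_pd_B _ pd_single(1)], auto)
    (rule single_coordinate[OF smooth_on_pd[OF smooth_pd_B] _ pd_single(2)], auto)

text \<open>The derivative of B by the first coordinate does not depend on the second one, so the
  difference between B at the given second coordinate and B at second coordinate 0 is constant in
  the first.\<close>

lemma B_split:
  assumes x: "x \<in> V"
  shows "B x = B (x$1 *\<^sub>R axis 1 1) + B (x$2 *\<^sub>R axis 2 1) - B 0"
proof -
  let ?y = "x$1 *\<^sub>R axis 1 1 + x$2 *\<^sub>R axis 2 1 :: real^3"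
  have "x - x$3 *\<^sub>R axis 3 1 = ?y" by (simp add: vec_eq_iff forall_3 axis_def)
  then have B3: "B x = B ?y"
    using drop_coordinate[OF smooth_B pd3_B x] by simp
  have inV: "x$2 *\<^sub>R axis 2 1 + s *\<^sub>R axis 1 1 \<in> V" "0 + s *\<^sub>R axis 1 1 \<in> V"
    if "s \<in> closed_segment 0 (x$1)" for s
  proof -
    have s: "\<bar>s\<bar> \<le> \<bar>x$1\<bar>" using that by (auto simp: closed_segment_eq_real_ivl split: if_splits)
    have "norm (x$2 *\<^sub>R axis 2 1 + s *\<^sub>R axis 1 1 :: real^3) \<le> norm x" "norm (0 + s *\<^sub>R axis 1 1 :: real^3) \<le> norm x"
      by (rule norm_le_componentwise_cart; use s in \<open>auto simp: axis_def\<close>)+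
    then show "x$2 *\<^sub>R axis 2 1 + s *\<^sub>R axis 1 1 \<in> V" "0 + s *\<^sub>R axis 1 1 \<in> V" using x by auto
  qed
  let ?g = "\<lambda>s. B (x$2 *\<^sub>R axis 2 1 + s *\<^sub>R axis 1 1) - B (0 + s *\<^sub>R axis 1 1)"
  have "\<exists>c. \<forall>s\<in>closed_segment 0 (x$1). ?g s = c"
  proof (rule has_field_derivative_zero_constant)
    fix s assume s: "s \<in> closed_segment 0 (x$1)"
    have "pd 1 B (x$2 *\<^sub>R axis 2 1 + s *\<^sub>R axis 1 1) = pd 1 B (0 + s *\<^sub>R axis 1 1)"
      using B_single(1)[OF inV(1)[OF s], of 1] by (simp add: axis_def)
    then have "(?g has_real_derivative 0) (at s)"
      using DERIV_diff[OF slice_derivative[OF smooth_B inV(1)[OF s]] slice_derivative[OF smooth_B inV(2)[OF s]]] by simp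
    then show "(?g has_real_derivative 0) (at s within closed_segment 0 (x$1))"
      by (rule has_field_derivative_at_within)
  qed simp
  then have "?g 0 = ?g (x$1)" by (metis ends_in_segment)
  then show ?thesis unfolding B3 by (simp add: add.commute)
qed

lemma slice_quadratic:
  assumes "i \<noteq> 3" "K > 0"
    and "\<And>s. \<bar>s\<bar> < r \<Longrightarrow> \<bar>pd i (pd i B) (s *\<^sub>R axis i 1) - 2 * (pd i B (s *\<^sub>R axis i 1))\<^sup>2\<bar> = K * exp (8 * B (s *\<^sub>R axis i 1))"
  obtains \<delta> \<beta> \<alpha> where "4 * \<alpha> * \<delta> - \<beta>\<^sup>2 \<noteq> 0"
    "\<And>s. \<bar>s\<bar> < r \<Longrightarrow> exp (- 4 * B (s *\<^sub>R axis i 1)) = \<delta> + \<beta> * s + \<alpha> * s\<^sup>2"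
proof (rule exp_quadratic[OF r _ _ _ assms(2,3)])
  have "((\<lambda>s. f (s *\<^sub>R axis i 1)) has_real_derivative pd i f (s *\<^sub>R axis i 1)) (at s)"
    if "\<bar>s\<bar> < r" "smooth_on V f" for f s
    using slice_derivative[OF that(2), of 0 s i] that(1) by simp
  then show "((\<lambda>s. B (s *\<^sub>R axis i 1)) has_real_derivative pd i B (s *\<^sub>R axis i 1)) (at s)"
    "((\<lambda>s. pd i B (s *\<^sub>R axis i 1)) has_real_derivative pd i (pd i B) (s *\<^sub>R axis i 1)) (at s)"
    "((\<lambda>s. pd i (pd i B) (s *\<^sub>R axis i 1)) has_real_derivative pd i (pd i (pd i B)) (s *\<^sub>R axis i 1)) (at s)"
    if "\<bar>s\<bar> < r" for s
    using that smooth_B smooth_pd_B smooth_on_pd[OF smooth_pd_B] by blast+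
qed (assumption, rule that, assumption, blast)

text \<open>On either axis the factor P of the other variable is frozen at its value at 0. The
  volume equation then becomes the ordinary differential equation of \<open>exp_quadratic\<close>,
  with k / 4 divided by that value as its constant.\<close>

lemma quadratic_form:
  obtains \<delta>1 \<beta>1 \<alpha>1 \<delta>2 \<beta>2 \<alpha>2 where
    "4 * \<alpha>1 * \<delta>1 - \<beta>1\<^sup>2 \<noteq> 0" "4 * \<alpha>2 * \<delta>2 - \<beta>2\<^sup>2 \<noteq> 0"
    "\<And>s. \<bar>s\<bar> < r \<Longrightarrow> \<delta>1 + \<beta>1 * s + \<alpha>1 * s\<^sup>2 > 0" "\<And>s. \<bar>s\<bar> < r \<Longrightarrow> \<delta>2 + \<beta>2 * s + \<alpha>2 * s\<^sup>2 > 0"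
    "\<And>x. x \<in> V \<Longrightarrow> exp (- 4 * B x) = (\<delta>1 + \<beta>1 * x$1 + \<alpha>1 * (x$1)\<^sup>2) * (\<delta>2 + \<beta>2 * x$2 + \<alpha>2 * (x$2)\<^sup>2)"
proof -
  define P where "P i x = \<bar>pd i (pd i B) x - 2 * (pd i B x)\<^sup>2\<bar>" for i x
  have P: "P 1 x * P 2 x = k / 4 * exp (8 * B x)" if "x \<in> V" for x
    using volume_B[OF that] by (simp add: P_def abs_mult)
  have Pc: "P i x = P i (x $ i *\<^sub>R axis i 1)" if "x \<in> V" "i \<noteq> 3" for i x
    unfolding P_def using B_single[OF that] by simp
  have P0: "P 1 0 > 0" "P 2 0 > 0"
    using P[of 0] k r by (auto simp: P_def zero_less_mult_iff less_eq_real_def)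
  have P1: "P 1 (s *\<^sub>R axis 1 1) = k / 4 / P 2 0 * exp (8 * B (s *\<^sub>R axis 1 1))" if "\<bar>s\<bar> < r" for s
    using P[OF axis_in_V[OF that, of 1]] Pc[OF axis_in_V[OF that, of 1], of 2] P0 by (simp add: axis_def field_simps)
  have P2: "P 2 (s *\<^sub>R axis 2 1) = k / 4 / P 1 0 * exp (8 * B (s *\<^sub>R axis 2 1))" if "\<bar>s\<bar> < r" for s
    using P[OF axis_in_V[OF that, of 2]] Pc[OF axis_in_V[OF that, of 2], of 1] P0 by (simp add: axis_def field_simps)
  obtain \<delta>1 \<beta>1 \<alpha>1 where q1: "4 * \<alpha>1 * \<delta>1 - \<beta>1\<^sup>2 \<noteq> 0"
    "\<And>s. \<bar>s\<bar> < r \<Longrightarrow> exp (- 4 * B (s *\<^sub>R axis 1 1)) = \<delta>1 + \<beta>1 * s + \<alpha>1 * s\<^sup>2"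
    by (rule slice_quadratic[of 1 "k / 4 / P 2 0"]) (use P1 P0 k in \<open>auto simp: P_def\<close>)
  obtain \<delta>2 \<beta>2 \<alpha>2 where q2: "4 * \<alpha>2 * \<delta>2 - \<beta>2\<^sup>2 \<noteq> 0"
    "\<And>s. \<bar>s\<bar> < r \<Longrightarrow> exp (- 4 * B (s *\<^sub>R axis 2 1)) = \<delta>2 + \<beta>2 * s + \<alpha>2 * s\<^sup>2"
    by (rule slice_quadratic[of 2 "k / 4 / P 1 0"]) (use P2 P0 k in \<open>auto simp: P_def\<close>)
  \<comment> \<open>Compensates the term - B 0 of \<open>B_split\<close>. The second quadratic
    absorbs it, and its discriminant is multiplied by E^2.\<close>
  define E where "E = exp (4 * B 0)"
  show thesis
  proof (rule that[of \<alpha>1 \<delta>1 \<beta>1 "E * \<alpha>2" "E * \<delta>2" "E * \<beta>2"])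
    show "4 * (E * \<alpha>2) * (E * \<delta>2) - (E * \<beta>2)\<^sup>2 \<noteq> 0"
    proof -
      have "4 * (E * \<alpha>2) * (E * \<delta>2) - (E * \<beta>2)\<^sup>2 = E\<^sup>2 * (4 * \<alpha>2 * \<delta>2 - \<beta>2\<^sup>2)"
        by (simp add: power2_eq_square algebra_simps)
      then show ?thesis using q2(1) by (simp add: E_def)
    qed
    have E2: "E * \<delta>2 + E * \<beta>2 * s + E * \<alpha>2 * s\<^sup>2 = E * exp (- 4 * B (s *\<^sub>R axis 2 1))" if "\<bar>s\<bar> < r" for s
      unfolding q2(2)[OF that] by (simp add: algebra_simps)
    show "E * \<delta>2 + E * \<beta>2 * s + E * \<alpha>2 * s\<^sup>2 > 0" if "\<bar>s\<bar> < r" for s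
      unfolding E2[OF that] by (simp add: E_def)
    show "\<delta>1 + \<beta>1 * s + \<alpha>1 * s\<^sup>2 > 0" if "\<bar>s\<bar> < r" for s
      using q1(2)[OF that] by (metis exp_gt_zero)
    show "exp (- 4 * B x) = (\<delta>1 + \<beta>1 * x$1 + \<alpha>1 * (x$1)\<^sup>2) * (E * \<delta>2 + E * \<beta>2 * x$2 + E * \<alpha>2 * (x$2)\<^sup>2)"
      if "x \<in> V" for x
    proof -
      have c: "\<bar>x$1\<bar> < r" "\<bar>x$2\<bar> < r" using that component_le_norm_cart[of x] by (auto intro: order_le_less_trans)
      show ?thesis
        unfolding E2[OF c(2)] q1(2)[OF c(1), symmetric] B_split[OF that]
        by (simp add: E_def algebra_simps flip: exp_add)
    qed
  qed (rule q1(1))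
qed

end

section \<open>Conics and the model hypersurfaces\<close>

text \<open>Completing the square gives \<delta> ((1 + \<mu> s)^2 + \<kappa>^2 s^2), or the same
  with a minus sign. So an invertible linear map takes (1, s), divided by the root of the quadratic,
  to the unit circle or the unit hyperbola. The vector (a + b s, c + d s) is the image of (1, s)
  under that map, and \<xi> is the parameter on the conic.\<close>

lemma conic_parametrization:
  assumes r: "r > 0" and disc: "4 * \<alpha> * \<delta> - \<beta>\<^sup>2 \<noteq> 0"
    and pos: "\<And>s. \<bar>s\<bar> < r \<Longrightarrow> \<delta> + \<beta> * s + \<alpha> * s\<^sup>2 > 0"
  obtains \<rho> a b c d m :: real and \<xi> cs sn :: "real \<Rightarrow> real" where
    "0 < \<rho>" "\<rho> \<le> r" "a * d - b * c \<noteq> 0" "(cs, sn) \<in> {(cos, sin), (cosh, sinh)}"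
    "smooth_on {-\<rho><..<\<rho>} \<xi>" "(\<xi> has_real_derivative m) (at 0)" "m \<noteq> 0"
    "\<And>s. \<bar>s\<bar> < \<rho> \<Longrightarrow> sqrt (\<delta> + \<beta> * s + \<alpha> * s\<^sup>2) * cs (\<xi> s) = a + b * s"
    "\<And>s. \<bar>s\<bar> < \<rho> \<Longrightarrow> sqrt (\<delta> + \<beta> * s + \<alpha> * s\<^sup>2) * sn (\<xi> s) = c + d * s"
proof -
  have \<delta>: "\<delta> > 0" using pos[of 0] r by simp
  define \<mu> where "\<mu> = \<beta> / (2 * \<delta>)"
  define \<kappa> where "\<kappa> = sqrt \<bar>4 * \<alpha> * \<delta> - \<beta>\<^sup>2\<bar> / (2 * \<delta>)"
  \<comment> \<open>The second bound keeps 1 + \<mu> s positive; this puts the circular angle in the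
    range of arctan and selects the branch of the hyperbola on which cosh runs.\<close>
  define \<rho> where "\<rho> = min r (1 / (\<bar>\<mu>\<bar> + 1))"
  have \<kappa>: "\<kappa> > 0" using disc \<delta> by (simp add: \<kappa>_def)
  have \<rho>: "0 < \<rho>" "\<rho> \<le> r" using r by (auto simp: \<rho>_def)
  have lin_pos: "1 + \<mu> * s > 0" if "\<bar>s\<bar> < \<rho>" for s
  proof -
    have "\<bar>s\<bar> * (\<bar>\<mu>\<bar> + 1) < 1" using that by (simp add: \<rho>_def field_simps)
    then have "\<bar>\<mu> * s\<bar> < 1" by (simp add: abs_mult algebra_simps)
    then show ?thesis by linarith
  qed
  have \<kappa>2: "\<kappa>\<^sup>2 = \<bar>4 * \<alpha> * \<delta> - \<beta>\<^sup>2\<bar> / (4 * \<delta>\<^sup>2)"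
    by (simp add: \<kappa>_def power_divide power2_eq_square)
  have quad: "\<delta> + \<beta> * s + \<alpha> * s\<^sup>2 = \<delta> * ((1 + \<mu> * s)\<^sup>2 + (4 * \<alpha> * \<delta> - \<beta>\<^sup>2) / (4 * \<delta>\<^sup>2) * s\<^sup>2)" for s
    using \<delta> by (simp add: \<mu>_def field_simps power2_eq_square)
  have det: "sqrt \<delta> * (sqrt \<delta> * \<kappa>) - sqrt \<delta> * \<mu> * 0 \<noteq> 0" using \<delta> \<kappa> by simp
  have op: "open {-\<rho><..<\<rho>}" by simp
  have sm_lin: "smooth_on {-\<rho><..<\<rho>} (\<lambda>s. 1 + c * s)" for c :: real
    by (intro smooth_on_add smooth_on_mult smooth_on_ident smooth_on_const op)
  have sm_lin': "smooth_on {-\<rho><..<\<rho>} (\<lambda>s. c * s)" for c :: real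
    by (intro smooth_on_mult smooth_on_ident smooth_on_const op)
  have ne: "1 + \<mu> * s \<noteq> 0" if "s \<in> {-\<rho><..<\<rho>}" for s
    using lin_pos[of s] that by (auto simp: abs_less_iff)
  show thesis
  proof (cases "4 * \<alpha> * \<delta> - \<beta>\<^sup>2 > 0")
    case True
    define S where "S s = \<kappa> * s / (1 + \<mu> * s)" for s
    have q: "sqrt (\<delta> + \<beta> * s + \<alpha> * s\<^sup>2) = sqrt \<delta> * ((1 + \<mu> * s) * sqrt (1 + (S s)\<^sup>2))" if "\<bar>s\<bar> < \<rho>" for s
    proof -
      have "\<delta> + \<beta> * s + \<alpha> * s\<^sup>2 = \<delta> * ((1 + \<mu> * s)\<^sup>2 * (1 + (S s)\<^sup>2))"
        unfolding quad using True \<kappa>2 lin_pos[OF that] by (simp add: S_def power_divide power_mult_distrib distrib_left)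
      then show ?thesis using lin_pos[OF that] by (simp add: real_sqrt_mult)
    qed
    show thesis
    proof (rule that[of \<rho> "sqrt \<delta>" "sqrt \<delta> * \<kappa>" "sqrt \<delta> * \<mu>" 0 cos sin "\<lambda>s. arctan (S s)" \<kappa>])
      show "smooth_on {-\<rho><..<\<rho>} (\<lambda>s. arctan (S s))"
        unfolding S_def
        by (intro smooth_on_arctan smooth_on_divide sm_lin sm_lin' op ne)
      show "((\<lambda>s. arctan (S s)) has_real_derivative \<kappa>) (at 0)"
        unfolding S_def by (auto intro!: derivative_eq_intros)
      fix s assume s: "\<bar>s\<bar> < \<rho>"
      have n: "sqrt (1 + (S s)\<^sup>2) \<noteq> 0" by (smt (verit) real_sqrt_eq_0_iff zero_le_power2)
      show "sqrt (\<delta> + \<beta> * s + \<alpha> * s\<^sup>2) * cos (arctan (S s)) = sqrt \<delta> + sqrt \<delta> * \<mu> * s"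
        unfolding q[OF s] cos_arctan using n by (simp add: algebra_simps)
      show "sqrt (\<delta> + \<beta> * s + \<alpha> * s\<^sup>2) * sin (arctan (S s)) = 0 + sqrt \<delta> * \<kappa> * s"
        unfolding q[OF s] sin_arctan using n lin_pos[OF s] by (simp add: S_def)
    qed (use \<rho> det \<kappa> in auto)
  next
    case False
    \<comment> \<open>The real linear factors of the quadratic, up to \<delta>. Their product and
      their sum are positive, hence so is each of them.\<close>
    define P M where "P s = 1 + (\<mu> + \<kappa>) * s" and "M s = 1 + (\<mu> - \<kappa>) * s" for s
    have PM: "P s > 0 \<and> M s > 0 \<and> sqrt (\<delta> + \<beta> * s + \<alpha> * s\<^sup>2) = sqrt \<delta> * (sqrt (P s) * sqrt (M s))" if s: "\<bar>s\<bar> < \<rho>" for s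
    proof -
      have "\<delta> + \<beta> * s + \<alpha> * s\<^sup>2 = \<delta> * ((1 + \<mu> * s)\<^sup>2 - \<kappa>\<^sup>2 * s\<^sup>2)"
      proof -
        have "\<bar>4 * \<alpha> * \<delta> - \<beta>\<^sup>2\<bar> = - (4 * \<alpha> * \<delta> - \<beta>\<^sup>2)" using False by linarith
        then have "(4 * \<alpha> * \<delta> - \<beta>\<^sup>2) / (4 * \<delta>\<^sup>2) = - \<kappa>\<^sup>2"
          unfolding \<kappa>2 by (metis minus_divide_left minus_minus)
        then show ?thesis unfolding quad by simp
      qed
      then have e: "\<delta> + \<beta> * s + \<alpha> * s\<^sup>2 = \<delta> * (P s * M s)"
        by (simp add: P_def M_def power2_eq_square algebra_simps)
      have "\<delta> + \<beta> * s + \<alpha> * s\<^sup>2 > 0" using pos s \<rho> by simp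
      then have "P s * M s > 0" using e \<delta> by (simp add: zero_less_mult_iff)
      moreover have "P s + M s > 0" using lin_pos[OF s] by (simp add: P_def M_def algebra_simps)
      ultimately have "P s > 0 \<and> M s > 0" by (auto simp: zero_less_mult_iff)
      then show ?thesis using e by (simp add: real_sqrt_mult)
    qed
    \<comment> \<open>Solves exp \<xi> = sqrt (P / M); then sqrt (P M) times cosh \<xi> and sinh
      \<xi> is (P + M) / 2 and (P - M) / 2.\<close>
    define \<xi> where "\<xi> s = (ln (P s) - ln (M s)) * (1/2)" for s
    show thesis
    proof (rule that[of \<rho> "sqrt \<delta>" "sqrt \<delta> * \<kappa>" "sqrt \<delta> * \<mu>" 0 cosh sinh \<xi> \<kappa>])
      show "smooth_on {-\<rho><..<\<rho>} \<xi>"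
        unfolding \<xi>_def P_def M_def
        by (intro smooth_on_mult smooth_on_diff smooth_on_ln sm_lin op smooth_on_const)
          (use PM in \<open>auto simp: P_def M_def abs_less_iff\<close>)
      show "(\<xi> has_real_derivative \<kappa>) (at 0)"
        unfolding \<xi>_def P_def M_def by (auto intro!: derivative_eq_intros)
      fix s assume s: "\<bar>s\<bar> < \<rho>"
      note pm = PM[OF s]
      have e: "exp (\<xi> s) = sqrt (P s) / sqrt (M s)"
      proof -
        have "\<xi> s = ln (sqrt (P s)) - ln (sqrt (M s))" using pm by (simp add: \<xi>_def ln_sqrt algebra_simps)
        then show ?thesis using pm by (simp add: exp_diff)
      qed
      have sq: "sqrt (P s) * sqrt (P s) = P s" "sqrt (M s) * sqrt (M s) = M s" "sqrt (P s) > 0" "sqrt (M s) > 0"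
        using pm by auto
      have "sqrt (P s) * sqrt (M s) * cosh (\<xi> s) = (sqrt (P s) * sqrt (P s) + sqrt (M s) * sqrt (M s)) / 2"
        unfolding cosh_field_def e exp_minus using sq(3,4) by (simp add: field_simps del: real_sqrt_mult_self)
      also have "\<dots> = 1 + \<mu> * s" unfolding sq(1,2) by (simp add: P_def M_def algebra_simps)
      finally show "sqrt (\<delta> + \<beta> * s + \<alpha> * s\<^sup>2) * cosh (\<xi> s) = sqrt \<delta> + sqrt \<delta> * \<mu> * s"
        using pm by (simp add: algebra_simps)
      have "sqrt (P s) * sqrt (M s) * sinh (\<xi> s) = (sqrt (P s) * sqrt (P s) - sqrt (M s) * sqrt (M s)) / 2"
        unfolding sinh_field_def e exp_minus using sq(3,4) by (simp add: field_simps del: real_sqrt_mult_self)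
      also have "\<dots> = \<kappa> * s" unfolding sq(1,2) by (simp add: P_def M_def algebra_simps)
      finally show "sqrt (\<delta> + \<beta> * s + \<alpha> * s\<^sup>2) * sinh (\<xi> s) = 0 + sqrt \<delta> * \<kappa> * s"
        using pm by (simp add: algebra_simps)
    qed (use \<rho> det \<kappa> in auto)
  qed
qed

text \<open>In eigenplane coordinates this is the pair 2 exp (- z) (c1, s1), 2 exp z (c2, s2), a
  form in which the circular or hyperbolic functions are chosen separately in the two
  planes.\<close>

definition model :: "(real \<Rightarrow> real) \<Rightarrow> (real \<Rightarrow> real) \<Rightarrow> (real \<Rightarrow> real) \<Rightarrow> (real \<Rightarrow> real) \<Rightarrow> real \<Rightarrow> real \<Rightarrow> real \<Rightarrow> real^4" where
  "model c1 s1 c2 s2 x y z = vector [exp (- z) * c1 x + exp z * c2 y, exp (- z) * s1 x + exp z * s2 y,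
     exp (- z) * c1 x - exp z * c2 y, exp (- z) * s1 x - exp z * s2 y]"

lemma model_eq:
  "model cos sin cos sin = f1" "model cosh sinh cosh sinh = f2"
  "model cos sin cosh sinh = f3" "model cosh sinh cos sin = f4"
  by (simp_all add: fun_eq_iff vec_eq_4 model_def f1_def f2_def f3_def f4_def cosh_field_def[of "_::real"]
      sinh_field_def[of "_::real"]) (simp_all add: field_simps)

section \<open>Eigenplane coordinates and \<open>Jt\<close>-linear maps\<close>

abbreviation "um (w::real^4) \<equiv> w$1 + w$3"
abbreviation "un (w::real^4) \<equiv> w$2 + w$4"
abbreviation "vm (w::real^4) \<equiv> w$1 - w$3"
abbreviation "vn (w::real^4) \<equiv> w$2 - w$4"

text \<open>Two independent matrices act on (um, un) and (vm, vn); the halves recover a vector from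
  the sums and differences of its coordinates.\<close>

definition block_map :: "real \<Rightarrow> real \<Rightarrow> real \<Rightarrow> real \<Rightarrow> real \<Rightarrow> real \<Rightarrow> real \<Rightarrow> real \<Rightarrow> real^4 \<Rightarrow> real^4" where
  "block_map a b c d a' b' c' d' w = vector [
     ((a * um w + b * un w) + (a' * vm w + b' * vn w)) / 2, ((c * um w + d * un w) + (c' * vm w + d' * vn w)) / 2,
     ((a * um w + b * un w) - (a' * vm w + b' * vn w)) / 2, ((c * um w + d * un w) - (c' * vm w + d' * vn w)) / 2]"

lemma block_map_nth:
  "um (block_map a b c d a' b' c' d' w) = a * um w + b * un w"
  "un (block_map a b c d a' b' c' d' w) = c * um w + d * un w"
  "vm (block_map a b c d a' b' c' d' w) = a' * vm w + b' * vn w"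
  "vn (block_map a b c d a' b' c' d' w) = c' * vm w + d' * vn w"
  by (simp_all add: block_map_def field_simps)

definition Jt_linear :: "(real^4 \<Rightarrow> real^4) \<Rightarrow> bool" where
  "Jt_linear T \<longleftrightarrow> linear T \<and> bij T \<and> T \<circ> Jt = Jt \<circ> T"

lemma eq_null_coordinates: "v = w \<longleftrightarrow> um v = um w \<and> un v = un w \<and> vm v = vm w \<and> vn v = vn w"
  by (auto simp: vec_eq_4)

lemma Jt_linear_block_map:
  assumes "a * d - b * c \<noteq> 0" "a' * d' - b' * c' \<noteq> 0"
  shows "Jt_linear (block_map a b c d a' b' c' d')"
proof -
  let ?T = "block_map a b c d a' b' c' d'"
  have lin: "linear ?T"
    by (rule linearI) (simp_all add: block_map_def vec_eq_4 field_simps)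
  have "w = 0" if "?T w = 0" for w
  proof -
    have e: "a * um w + b * un w = 0" "c * um w + d * un w = 0" "a' * vm w + b' * vn w = 0" "c' * vm w + d' * vn w = 0"
      using that block_map_nth[of a b c d a' b' c' d' w] by simp_all
    have *: "x = 0 \<and> y = 0" if "p * x + q * y = 0" "r * x + s * y = 0" "p * s - q * r \<noteq> 0" for p q r s x y :: real
    proof -
      have "(p * s - q * r) * x = 0" "(p * s - q * r) * y = 0" using that(1,2) by algebra+
      then show ?thesis using that(3) by simp
    qed
    have "um w = 0 \<and> un w = 0" "vm w = 0 \<and> vn w = 0"
      using *[OF e(1,2) assms(1)] *[OF e(3,4) assms(2)] by auto
    then show ?thesis by (simp add: eq_null_coordinates[of w])
  qed
  then have inj: "inj ?T" using linear_injective_0[OF lin] by blast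
  then have "bij ?T" using linear_injective_imp_surjective[OF lin] by (simp add: bij_def)
  moreover have "?T \<circ> Jt = Jt \<circ> ?T"
    by (simp add: fun_eq_iff block_map_def Jt_def vec_eq_4 field_simps)
  ultimately show ?thesis using lin by (simp add: Jt_linear_def)
qed

lemma Jt_linear_compose: "Jt_linear S \<Longrightarrow> Jt_linear T \<Longrightarrow> Jt_linear (S \<circ> T)"
  unfolding Jt_linear_def by (auto intro: linear_compose bij_comp simp: fun_eq_iff)

text \<open>The construction maps f to a model, while the theorem asks for the map in the opposite
  direction.\<close>

lemma Jt_affine_inv:
  assumes "Jt_linear T"
  shows "Jt_affine (\<lambda>w. inv T w + b)"
proof -
  have T: "linear T" "bij T" "\<And>w. T (Jt w) = Jt (T w)"
    using assms by (auto simp: Jt_linear_def fun_eq_iff)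
  have "linear (inv T)" using T(1,2) by (simp add: inj_linear_imp_inv_linear bij_is_inj)
  moreover have "bij (inv T)" using T(2) by (rule bij_imp_bij_inv)
  moreover have "inv T (Jt w) = Jt (inv T w)" for w
    using T(2,3) by (metis bij_inv_eq_iff)
  ultimately show ?thesis unfolding Jt_affine_def by (auto simp: fun_eq_iff)
qed

section \<open>The classification\<close>

definition vec3 :: "real \<Rightarrow> real \<Rightarrow> real \<Rightarrow> real^3" where
  "vec3 a b c = a *\<^sub>R axis 1 1 + b *\<^sub>R axis 2 1 + c *\<^sub>R axis 3 1"

lemma vec3_nth [simp]: "vec3 a b c $ 1 = a" "vec3 a b c $ 2 = b" "vec3 a b c $ 3 = c"
  by (simp_all add: vec3_def axis_def)

lemma vec3_eq_0: "vec3 a b c = 0 \<longleftrightarrow> a = 0 \<and> b = 0 \<and> c = 0"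
  by (auto simp: vec_eq_iff forall_3)

lemma smooth_on_vec3:
  "open U \<Longrightarrow> smooth_on U a \<Longrightarrow> smooth_on U b \<Longrightarrow> smooth_on U c \<Longrightarrow> smooth_on U (\<lambda>x. vec3 (a x) (b x) (c x))"
  unfolding vec3_def by (intro smooth_on_add smooth_on_scaleR smooth_on_const)

lemma has_derivative_vec3:
  assumes "(a has_derivative a') (at x)" "(b has_derivative b') (at x)" "(c has_derivative c') (at x)"
  shows "((\<lambda>x. vec3 (a x) (b x) (c x)) has_derivative (\<lambda>v. vec3 (a' v) (b' v) (c' v))) (at x)"
  unfolding vec3_def by (intro has_derivative_add has_derivative_scaleR_left assms)

lemma inj_frechet_derivativeI:
  assumes "(f has_derivative f') (at x)" "\<And>v. f' v = 0 \<Longrightarrow> v = 0"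
  shows "inj (frechet_derivative f (at x))"
  using assms linear_injective_0[OF has_derivative_linear[OF assms(1)]]
  by (simp add: frechet_derivative_at[OF assms(1), symmetric])

text \<open>Invariant under positive multiples of w: the common scale is forgotten and reappears as
  the function B.\<close>

definition null_chart :: "real^4 \<Rightarrow> real^3" where
  "null_chart w = vec3 (un w / um w) (vn w / vm w) ((ln (um w) - ln (vm w)) / 2)"

lemma smooth_on_null_chart:
  assumes "open U" "smooth_on U G" "\<And>x. x \<in> U \<Longrightarrow> um (G x) > 0" "\<And>x. x \<in> U \<Longrightarrow> vm (G x) > 0"
  shows "smooth_on U (\<lambda>x::real^3. null_chart (G x))"
proof -
  note c = smooth_on_vec_nth[OF assms(1,2)]
  have "smooth_on U (\<lambda>x. (ln (um (G x)) - ln (vm (G x))) * (1 / 2))"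
    by (intro smooth_on_mult smooth_on_diff smooth_on_ln smooth_on_add smooth_on_const c assms)
  moreover have "smooth_on U (\<lambda>x. un (G x) / um (G x))" "smooth_on U (\<lambda>x. vn (G x) / vm (G x))"
    by (intro smooth_on_divide smooth_on_diff smooth_on_add c assms(1), metis assms(3) less_irrefl)
      (intro smooth_on_divide smooth_on_diff smooth_on_add c assms(1), metis assms(4) less_irrefl)
  ultimately show ?thesis unfolding null_chart_def by (intro smooth_on_vec3 assms(1)) simp_all
qed

text \<open>At the normalized base point the differential of \<open>null_chart\<close> kills only
  the radial direction, so a tangent vector in the kernel is mapped to a multiple of G. As G is
  transversal, that multiple is 0.\<close>

lemma inj_null_chart:
  assumes "smooth_on V G" "x \<in> V" "inj (frechet_derivative G (at x))" "G x \<notin> tangent_image G x"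
    and Gx: "um (G x) = 1" "un (G x) = 0" "vm (G x) = 1" "vn (G x) = 0"
  shows "inj (frechet_derivative (\<lambda>x. null_chart (G x)) (at x))"
proof -
  let ?D = "frechet_derivative G (at x)"
  have d: "((\<lambda>x. G x $ i) has_derivative (\<lambda>v. ?D v $ i)) (at x)" for i
    by (rule bounded_linear.has_derivative[OF bounded_linear_vec_nth smooth_on_has_derivative[OF assms(1,2)]])
  have 1: "((\<lambda>x. un (G x) / um (G x)) has_derivative (\<lambda>v. un (?D v))) (at x)"
    by (rule has_derivative_eq_rhs, (rule derivative_intros d)+) (use Gx in \<open>auto simp: fun_eq_iff\<close>)
  have 2: "((\<lambda>x. vn (G x) / vm (G x)) has_derivative (\<lambda>v. vn (?D v))) (at x)"
    by (rule has_derivative_eq_rhs, (rule derivative_intros d)+) (use Gx in \<open>auto simp: fun_eq_iff\<close>)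
  have 3: "((\<lambda>x. (ln (um (G x)) - ln (vm (G x))) / 2) has_derivative (\<lambda>v. (um (?D v) - vm (?D v)) / 2)) (at x)"
  proof -
    have lnd: "((\<lambda>x. ln (g x)) has_derivative g') (at x)" if "(g has_derivative g') (at x)" "g x = 1"
      for g :: "real^3 \<Rightarrow> real" and g'
      using that by (auto intro!: derivative_eq_intros)
    show ?thesis
      by (intro bounded_linear.has_derivative[OF bounded_linear_divide] has_derivative_diff lnd has_derivative_add d Gx)
  qed
  show ?thesis
    unfolding null_chart_def
  proof (rule inj_frechet_derivativeI[OF has_derivative_vec3[OF 1 2 3]])
    fix v assume "vec3 (un (?D v)) (vn (?D v)) ((um (?D v) - vm (?D v)) / 2) = 0"
    then have v: "un (?D v) = 0" "vn (?D v) = 0" "um (?D v) = vm (?D v)" by (auto simp: vec3_eq_0)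
    let ?c = "um (?D v)"
    have lin: "linear ?D" by (rule smooth_on_linear_derivative[OF assms(1,2)])
    have Dv: "?D v = ?c *\<^sub>R G x"
      unfolding eq_null_coordinates[of "?D v"] using v Gx by (simp flip: distrib_left right_diff_distrib)
    have "?c = 0"
    proof (rule ccontr)
      assume c: "?c \<noteq> 0"
      have "?D ((1 / ?c) *\<^sub>R v) = (1 / ?c) *\<^sub>R (?c *\<^sub>R G x)"
        unfolding linear_scale[OF lin] using Dv by metis
      then have "G x = ?D ((1 / ?c) *\<^sub>R v)" using c by simp
      then show False using assms(4) unfolding tangent_image_def by blast
    qed
    then have "?D v = ?D 0" using Dv linear_0[OF lin] by simp
    then show "v = 0" using assms(3) by (simp add: inj_def)
  qed
qed

lemma null_coordinates:
  "um (p *\<^sub>R plus_pt s + q *\<^sub>R minus_pt t) = p" "un (p *\<^sub>R plus_pt s + q *\<^sub>R minus_pt t) = p * s"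
  "vm (p *\<^sub>R plus_pt s + q *\<^sub>R minus_pt t) = q" "vn (p *\<^sub>R plus_pt s + q *\<^sub>R minus_pt t) = q * t"
  by (simp_all add: plus_pt_def minus_pt_def field_simps)

text \<open>The scale lost by \<open>null_chart\<close> is the geometric mean of um and vm, and B is
  its logarithm.\<close>

lemma null_chart_decompose:
  assumes "um w > 0" "vm w > 0"
  defines "B \<equiv> (ln (um w) + ln (vm w)) / 2" and "y \<equiv> null_chart w"
  shows "w = exp (B + y$3) *\<^sub>R plus_pt (y$1) + exp (B - y$3) *\<^sub>R minus_pt (y$2)"
proof -
  have "B + y$3 = ln (um w)" "B - y$3 = ln (vm w)"
    by (simp_all add: B_def y_def null_chart_def field_simps)
  then have e: "exp (B + y$3) = um w" "exp (B - y$3) = vm w" using assms(1,2) by simp_all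
  have "y$1 = un w / um w" "y$2 = vn w / vm w" by (simp_all add: y_def null_chart_def)
  then show ?thesis
    unfolding e eq_null_coordinates[of w] null_coordinates using assms(1,2) by simp
qed

text \<open>The last component is the z of the models: for B = - (ln p + ln q) / 4 one has exp (B +
  y_3) sqrt p = exp (- z) and exp (B - y_3) sqrt q = exp z.\<close>

definition final_chart :: "(real \<Rightarrow> real) \<Rightarrow> (real \<Rightarrow> real) \<Rightarrow> (real \<Rightarrow> real) \<Rightarrow> (real \<Rightarrow> real) \<Rightarrow> real^3 \<Rightarrow> real^3" where
  "final_chart \<xi> \<eta> p q y = vec3 (\<xi> (y$1)) (\<eta> (y$2)) ((ln (q (y$2)) - ln (p (y$1))) / 4 - y$3)"

text \<open>The differential at 0 is triangular with diagonal entries m, n and - 1, whatever the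
  logarithms contribute to the last row.\<close>

lemma inj_final_chart:
  assumes \<xi>: "(\<xi> has_real_derivative m) (at 0)" "m \<noteq> 0" and \<eta>: "(\<eta> has_real_derivative n) (at 0)" "n \<noteq> 0"
    and p: "(p has_real_derivative p') (at 0)" "p 0 > 0" and q: "(q has_real_derivative q') (at 0)" "q 0 > 0"
  shows "inj (frechet_derivative (final_chart \<xi> \<eta> p q) (at 0))"
proof -
  have nth: "((\<lambda>y::real^3. y$i) has_derivative (\<lambda>v. v$i)) (at 0)" for i
    by (rule bounded_linear.has_derivative[OF bounded_linear_vec_nth has_derivative_ident])
  have comp: "((\<lambda>y::real^3. g (y$i)) has_derivative (\<lambda>v. g' * v$i)) (at 0)"
    if "(g has_real_derivative g') (at 0)" for g g' i
    using has_derivative_compose[OF nth[of i], of g "\<lambda>h. g' * h"] that by (simp add: has_field_derivative_def)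
  have lnd: "((\<lambda>s. ln (g s)) has_real_derivative g' / g 0) (at 0)"
    if "(g has_real_derivative g') (at 0)" "g 0 > 0" for g :: "real \<Rightarrow> real" and g'
    using that by (auto intro!: derivative_eq_intros)
  have 3: "((\<lambda>y::real^3. (ln (q (y$2)) - ln (p (y$1))) / 4 - y$3) has_derivative
      (\<lambda>v. (q' / q 0 * v$2 - p' / p 0 * v$1) / 4 - v$3)) (at 0)"
    by (intro has_derivative_diff nth bounded_linear.has_derivative[OF bounded_linear_divide]
        comp[OF lnd[OF q]] comp[OF lnd[OF p]])
  show ?thesis
    unfolding final_chart_def
  proof (rule inj_frechet_derivativeI[OF has_derivative_vec3[OF comp[OF \<xi>(1)] comp[OF \<eta>(1)] 3]])
    fix v :: "real^3"
    assume "vec3 (m * v$1) (n * v$2) ((q' / q 0 * v$2 - p' / p 0 * v$1) / 4 - v$3) = 0"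
    then have "v$1 = 0" "v$2 = 0" "(q' / q 0 * v$2 - p' / p 0 * v$1) / 4 - v$3 = 0"
      using \<xi>(2) \<eta>(2) by (auto simp: vec3_eq_0)
    then show "v = 0" by (simp add: vec_eq_iff forall_3)
  qed
qed

lemma smooth_on_final_chart:
  fixes W :: "(real^3) set"
  assumes "open W" "open I" "open J" "smooth_on I \<xi>" "smooth_on J \<eta>" "smooth_on I p" "smooth_on J q"
    and "\<And>y. y \<in> W \<Longrightarrow> y$1 \<in> I \<and> y$2 \<in> J" "\<And>s. s \<in> I \<Longrightarrow> p s > 0" "\<And>s. s \<in> J \<Longrightarrow> q s > 0"
  shows "smooth_on W (final_chart \<xi> \<eta> p q)"
proof -
  note nth = smooth_on_vec_nth[OF assms(1) smooth_on_ident[OF assms(1)]]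
  have I: "smooth_on W (\<lambda>y. g (y$1))" if "smooth_on I g" for g :: "real \<Rightarrow> real"
    by (rule smooth_on_compose[where f = "\<lambda>y::real^3. y$1" and V = I, OF assms(1,2) nth that]) (use assms(8) in auto)
  have J: "smooth_on W (\<lambda>y. g (y$2))" if "smooth_on J g" for g :: "real \<Rightarrow> real"
    by (rule smooth_on_compose[where f = "\<lambda>y::real^3. y$2" and V = J, OF assms(1,3) nth that]) (use assms(8) in auto)
  have "smooth_on W (\<lambda>y. (ln (q (y$2)) - ln (p (y$1))) * (1/4) - y$3)"
    by (intro smooth_on_diff smooth_on_mult smooth_on_ln I J nth smooth_on_const assms) (use assms(8) in auto)
  then have "smooth_on W (\<lambda>y. (ln (q (y$2)) - ln (p (y$1))) / 4 - y$3)" by simp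
  then show ?thesis
    unfolding final_chart_def[abs_def] by (intro smooth_on_vec3 I J assms)
qed

text \<open>The matrix entries carry a factor 2 because the eigenplane components of
  \<open>model\<close> do.\<close>

lemma block_map_eq_model:
  fixes y :: "real^3"
  assumes "w = exp (B + y$3) *\<^sub>R plus_pt (y$1) + exp (B - y$3) *\<^sub>R minus_pt (y$2)"
    and pos: "p > 0" "q > 0" and B: "exp (- 4 * B) = p * q"
    and 1: "sqrt p * c1 x = a1 + b1 * y$1" "sqrt p * s1 x = a2 + b2 * y$1"
    and 2: "sqrt q * c2 x' = a3 + b3 * y$2" "sqrt q * s2 x' = a4 + b4 * y$2"
  shows "block_map (2 * a1) (2 * b1) (2 * a2) (2 * b2) (2 * a3) (2 * b3) (2 * a4) (2 * b4) w =
    model c1 s1 c2 s2 x x' ((ln q - ln p) / 4 - y$3)"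
proof -
  let ?z = "(ln q - ln p) / 4 - y$3"
  have "- 4 * B = ln p + ln q" using B pos by (metis ln_exp ln_mult_pos)
  then have B': "B = - (ln p + ln q) / 4" by simp
  have sq: "sqrt p = exp (ln p / 2)" "sqrt q = exp (ln q / 2)"
    using pos by (simp_all flip: ln_sqrt)
  have z1: "exp (- ?z) = exp (B + y$3) * sqrt p" unfolding sq B' by (simp add: field_simps flip: exp_add)
  have z2: "exp ?z = exp (B - y$3) * sqrt q" unfolding sq B' by (simp add: field_simps flip: exp_add)
  have w: "um w = exp (B + y$3)" "un w = exp (B + y$3) * y$1" "vm w = exp (B - y$3)" "vn w = exp (B - y$3) * y$2"
    unfolding assms(1) null_coordinates by (rule refl)+
  have m: "exp (- ?z) * c1 x = exp (B + y$3) * (a1 + b1 * y$1)" "exp (- ?z) * s1 x = exp (B + y$3) * (a2 + b2 * y$1)"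
    "exp ?z * c2 x' = exp (B - y$3) * (a3 + b3 * y$2)" "exp ?z * s2 x' = exp (B - y$3) * (a4 + b4 * y$2)"
    unfolding z1 z2 by (simp_all only: mult.assoc 1 2)
  show ?thesis
    unfolding model_def m block_map_def w by (simp add: vec_eq_4 field_simps)
qed

text \<open>In each plane, viewed as the complex numbers, the map is multiplication by the inverse
  of the given component: a rotation and a scaling with determinant 1 / (m^2 + n^2).\<close>

lemma normalizing_block_map:
  assumes "um w \<noteq> 0 \<or> un w \<noteq> 0" "vm w \<noteq> 0 \<or> vn w \<noteq> 0"
  obtains T where "Jt_linear T" "um (T w) = 1" "un (T w) = 0" "vm (T w) = 1" "vn (T w) = 0"
proof -
  let ?m = "um w" and ?n = "un w" and ?m' = "vm w" and ?n' = "vn w"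
  define u where "u = ?m\<^sup>2 + ?n\<^sup>2"
  define v where "v = ?m'\<^sup>2 + ?n'\<^sup>2"
  have uv: "u \<noteq> 0" "v \<noteq> 0" using assms by (auto simp: u_def v_def sum_power2_eq_zero_iff)
  let ?T = "block_map (?m / u) (?n / u) (- ?n / u) (?m / u) (?m' / v) (?n' / v) (- ?n' / v) (?m' / v)"
  have det: "m / k * (m / k) - n / k * (- n / k) = (m\<^sup>2 + n\<^sup>2) / (k * k)" for m n k :: real
    by (simp add: power2_eq_square add_divide_distrib)
  have i1: "m / k * m + n / k * n = (m\<^sup>2 + n\<^sup>2) / k" for m n k :: real
    by (simp add: power2_eq_square add_divide_distrib)
  have i2: "- n / k * m + m / k * n = 0" for m n k :: real by simp
  have "?m / u * (?m / u) - ?n / u * (- ?n / u) \<noteq> 0" "?m' / v * (?m' / v) - ?n' / v * (- ?n' / v) \<noteq> 0"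
    unfolding det u_def[symmetric] v_def[symmetric] using uv by simp_all
  then have "Jt_linear ?T" by (rule Jt_linear_block_map)
  moreover have "um (?T w) = u / u" "un (?T w) = 0" "vm (?T w) = v / v" "vn (?T w) = 0"
    unfolding block_map_nth i1 i2 by (simp_all only: u_def v_def)
  ultimately show thesis using that[of ?T] uv by simp
qed

text \<open>D (C + l f) = 0 yields a constant only on a connected set, so the chart is cut down
  until its old coordinates lie in a ball. The centre b is that constant divided by l.\<close>

lemma hypersphere_centre:
  fixes \<A> :: "('m::{t2_space,second_countable_topology}, 3) chart set"
  assumes S: "smooth_structure \<A>" and H: "Jt_tangent_affine_hypersphere \<A> f"
  obtains c b C l where "c \<in> \<A>" "p \<in> fst c" "l \<noteq> 0" "\<And>q. q \<in> fst c \<Longrightarrow> C q = - l *\<^sub>R (f q - b)"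
    "\<And>d. d \<in> \<A> \<Longrightarrow> transversal_immersion (coord_dom d) (in_chart d f) (in_chart d C)"
    "\<And>d. d \<in> \<A> \<Longrightarrow> blaschke_on (coord_dom d) (in_chart d f) (in_chart d C)"
    "\<And>d x. d \<in> \<A> \<Longrightarrow> x \<in> coord_dom d \<Longrightarrow> Jt (in_chart d C x) \<in> tangent_image (in_chart d f) x"
proof -
  have charts: "is_chart d" if "d \<in> \<A>" for d
    using S that by (auto simp: smooth_structure_def)
  obtain C l where C: "blaschke_field \<A> f C" "shape_is_scalar \<A> f C l" "Jt_tangent_field \<A> f C" and imm: "immersion \<A> f"
    using H unfolding Jt_tangent_affine_hypersphere_def by blast
  have ti: "transversal_immersion (coord_dom d) (in_chart d f) (in_chart d C)" if d: "d \<in> \<A>" for d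
    using chart_open(2)[OF charts[OF d]] C(1) imm d
    unfolding transversal_immersion_def immersion_def smooth_map_def blaschke_field_def blaschke_on_def by blast
  have bl: "blaschke_on (coord_dom d) (in_chart d f) (in_chart d C)" if "d \<in> \<A>" for d
    using C(1) that by (simp add: blaschke_field_def)
  have tan: "Jt (in_chart d C x) \<in> tangent_image (in_chart d f) x" if "d \<in> \<A>" "x \<in> coord_dom d" for d x
    using C(3) that by (simp add: Jt_tangent_field_def)
  have dC: "frechet_derivative (in_chart d C) (at x) v = - l *\<^sub>R frechet_derivative (in_chart d f) (at x) v"
    if d: "d \<in> \<A>" and x: "x \<in> coord_dom d" for d x v
    by (rule transversal_immersion.derivative_C[OF ti[OF d] bl[OF d] x])
      (use C(2) d in \<open>auto simp: shape_is_scalar_def\<close>)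
  obtain c0 where c0: "c0 \<in> \<A>" "p \<in> fst c0"
    using S unfolding smooth_structure_def by (metis UNIV_I UN_E)
  note ch = charts[OF c0(1)]
  let ?x = "snd c0 p"
  have x: "?x \<in> coord_dom c0" using c0(2) by (simp add: coord_dom_def)
  have l: "l \<noteq> 0"
    using transversal_immersion.C_not_parallel[OF ti[OF c0(1)] bl[OF c0(1)] x tan[OF c0(1)]] dC[OF c0(1) x] by fastforce
  obtain e where e: "e > 0" "ball ?x e \<subseteq> coord_dom c0" using chart_open(2)[OF ch] x openE by blast
  \<comment> \<open>With the identity as change of coordinates, \<open>new_chart\<close> merely
    shrinks the chart.\<close>
  have id: "smooth_on (ball ?x e) (\<lambda>x. x)" by (rule smooth_on_ident) simp
  obtain c r where c: "c \<in> \<A>" "p \<in> fst c" "fst c \<subseteq> fst c0" "snd c0 ` fst c \<subseteq> ball ?x e"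
    by (rule new_chart[OF S c0(1,2) open_ball _ e(2) id]) (use e in auto)
  define g where "g y = in_chart c0 C y + l *\<^sub>R in_chart c0 f y" for y
  have dg: "(g has_derivative (\<lambda>v. 0)) (at y)" if y: "y \<in> coord_dom c0" for y
  proof -
    note t = ti[OF c0(1), unfolded transversal_immersion_def]
    have "(g has_derivative (\<lambda>v. frechet_derivative (in_chart c0 C) (at y) v + l *\<^sub>R frechet_derivative (in_chart c0 f) (at y) v)) (at y)"
      unfolding g_def[abs_def] using t y
      by (intro has_derivative_add has_derivative_scaleR_right smooth_on_has_derivative[OF _ y]) blast+
    then show ?thesis unfolding dC[OF c0(1) y] by simp
  qed
  have "\<exists>k. \<forall>y\<in>ball ?x e. g y = k"
    by (rule has_derivative_zero_constant[OF convex_ball])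
      (metis dg e(2) subsetD has_derivative_at_withinI)
  then obtain k where k: "\<And>y. y \<in> ball ?x e \<Longrightarrow> g y = k" by blast
  have "C q = - l *\<^sub>R (f q - (1 / l) *\<^sub>R k)" if q: "q \<in> fst c" for q
  proof -
    have "q \<in> fst c0" "snd c0 q \<in> ball ?x e" using q c(3,4) by auto
    then have "C q + l *\<^sub>R f q = k" using k[of "snd c0 q"] by (simp add: g_def in_chart_apply[OF ch])
    then show ?thesis using l by (simp add: algebra_simps)
  qed
  from that[OF c(1,2) l this ti bl tan] show thesis by blast
qed

theorem theorem4p9:
  fixes \<A> :: "('m::{t2_space,second_countable_topology}, 3) chart set"
    and f :: "'m \<Rightarrow> real^4"
  assumes "smooth_structure \<A>"
    and "connected (UNIV :: 'm set)"
    and "orientable \<A>"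
    and "Jt_tangent_affine_hypersphere \<A> f"
    and "involutive_distr \<A> f"
  shows "\<forall>p. \<exists>(U, \<phi>)\<in>\<A>. p \<in> U \<and>
           (\<exists>A. Jt_affine A \<and>
              (\<exists>g\<in>{f1, f2, f3, f4}. \<forall>q\<in>U. f q = A (g (\<phi> q $ 1) (\<phi> q $ 2) (\<phi> q $ 3))))"
proof
  fix p :: 'm
  have charts: "is_chart d" if "d \<in> \<A>" for d
    using assms(1) that by (auto simp: smooth_structure_def)
  obtain c b C l where c: "c \<in> \<A>" "p \<in> fst c" "l \<noteq> 0" "\<And>q. q \<in> fst c \<Longrightarrow> C q = - l *\<^sub>R (f q - b)"
    and ti: "\<And>d. d \<in> \<A> \<Longrightarrow> transversal_immersion (coord_dom d) (in_chart d f) (in_chart d C)"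
    and bl: "\<And>d. d \<in> \<A> \<Longrightarrow> blaschke_on (coord_dom d) (in_chart d f) (in_chart d C)"
    and tan: "\<And>d x. d \<in> \<A> \<Longrightarrow> x \<in> coord_dom d \<Longrightarrow> Jt (in_chart d C x) \<in> tangent_image (in_chart d f) x"
    by (rule hypersphere_centre[OF assms(1,4), of p]) blast
  \<comment> \<open>Stated for every chart inside the domain of c, so that it can be used again
    after the coordinates have changed; centre and constant stay the same.\<close>
  have sphere: "centroaffine_sphere (\<bar>l\<bar> ^ 5 / (det (matrix T))\<^sup>2) (coord_dom d) (\<lambda>x. T (in_chart d f x - b))"
    if d: "d \<in> \<A>" "fst d \<subseteq> fst c" and T: "Jt_linear T" for d T
  proof (rule transversal_immersion.centroaffine_sphere_transform[OF ti[OF d(1)] bl[OF d(1)] c(3) _ _ _ _ tan[OF d(1)]])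
    show "in_chart d C x = - l *\<^sub>R (in_chart d f x - b)" if "x \<in> coord_dom d" for x
      using c(4) chart_inv(2)[OF charts[OF d(1)] that] d(2) by (auto simp: in_chart_def)
    show "lie X Y x \<in> distr (in_chart d f) x"
      if "smooth_on (coord_dom d) X" "smooth_on (coord_dom d) Y"
        "\<And>x. x \<in> coord_dom d \<Longrightarrow> X x \<in> distr (in_chart d f) x \<and> Y x \<in> distr (in_chart d f) x"
        "x \<in> coord_dom d" for X Y x
      using assms(5) d(1) that unfolding involutive_distr_def by blast
  qed (use T in \<open>auto simp: Jt_linear_def\<close>)
  note cc = charts[OF c(1)]
  define x where "x = snd c p"
  have x: "x \<in> coord_dom c" using c(2) by (simp add: x_def coord_dom_def)
  have fx: "in_chart c f x = f p" using in_chart_apply[OF cc c(2)] by (simp add: x_def)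
  \<comment> \<open>With the identity in place of T, \<open>sphere\<close> gives the transversality
    of f - b and the tangency of its image under \<open>Jt\<close>, from which the normalizing map
    is then obtained.\<close>
  have Jid: "Jt_linear (\<lambda>w. w)"
    by (simp add: Jt_linear_def linear_id[unfolded id_def] bij_id[unfolded id_def] fun_eq_iff)
  obtain T where T: "Jt_linear T" "um (T (f p - b)) = 1" "un (T (f p - b)) = 0" "vm (T (f p - b)) = 1" "vn (T (f p - b)) = 0"
  proof (rule normalizing_block_map)
    let ?w = "f p - b"
    have s: "?w \<notin> tangent_image (\<lambda>x. in_chart c f x - b) x" "Jt ?w \<in> tangent_image (\<lambda>x. in_chart c f x - b) x"
      using sphere[OF c(1) subset_refl Jid] x fx unfolding centroaffine_sphere_def by metis+
    have sub: "subspace (tangent_image (\<lambda>x. in_chart c f x - b) x)"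
      unfolding tangent_image_def
      by (rule linear_subspace_image[OF smooth_on_linear_derivative[OF _ x] subspace_UNIV])
        (use sphere[OF c(1) subset_refl Jid] in \<open>auto simp: centroaffine_sphere_def\<close>)
    \<comment> \<open>If either eigencomponent vanished, f - b would be an eigenvector of
      \<open>Jt\<close> and hence tangent like \<open>Jt\<close> (f - b), against
      transversality.\<close>
    show "um ?w \<noteq> 0 \<or> un ?w \<noteq> 0"
    proof (rule ccontr)
      assume "\<not> ?thesis"
      then have "?w = - Jt ?w" by (auto simp: vec_eq_4 Jt_def)
      then show False using s subspace_neg[OF sub s(2)] by simp
    qed
    show "vm ?w \<noteq> 0 \<or> vn ?w \<noteq> 0"
    proof (rule ccontr)
      assume "\<not> ?thesis"
      then have "?w = Jt ?w" by (auto simp: vec_eq_4 Jt_def)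
      then show False using s by simp
    qed
  qed
  define k where "k = \<bar>l\<bar> ^ 5 / (det (matrix T))\<^sup>2"
  have k: "k > 0"
    using T(1) c(3) det_nz_iff_inj[of T] by (simp add: k_def Jt_linear_def bij_def)
  define G where "G = (\<lambda>q. T (f q - b))"
  have in_G: "in_chart d G = (\<lambda>x. T (in_chart d f x - b))" for d
    by (simp add: in_chart_def G_def fun_eq_iff)
  have sphG: "centroaffine_sphere k (coord_dom d) (in_chart d G)" if "d \<in> \<A>" "fst d \<subseteq> fst c" for d
    unfolding in_G k_def by (rule sphere[OF that T(1)])
  let ?G = "in_chart c G"
  have Gx: "?G x = T (f p - b)" by (simp add: in_G fx)
  have smG: "smooth_on (coord_dom c) ?G" and oc: "open (coord_dom c)"
    using sphG[OF c(1) subset_refl] by (auto simp: centroaffine_sphere_def)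
  \<comment> \<open>The region where \<open>null_chart\<close> is smooth along G; normalization has
    put the base point into it.\<close>
  define W where "W = {y \<in> coord_dom c. 0 < um (?G y) \<and> 0 < vm (?G y)}"
  have contG: "continuous_on (coord_dom c) ?G" by (rule smooth_on_continuous_on[OF smG])
  have "open (coord_dom c \<inter> ?G -` {w. 0 < um w \<and> 0 < vm w})"
    by (intro continuous_open_preimage contG oc open_Collect_conj open_Collect_less continuous_intros)
  moreover have "W = coord_dom c \<inter> ?G -` {w. 0 < um w \<and> 0 < vm w}" by (auto simp: W_def)
  ultimately have oW: "open W" by simp
  have xW: "x \<in> W" using x T(2-5) by (simp add: W_def Gx)
  have WV: "W \<subseteq> coord_dom c" by (auto simp: W_def)
  have sm1: "smooth_on W (\<lambda>y. null_chart (?G y))"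
    by (rule smooth_on_null_chart[OF oW smooth_on_subset[OF smG WV]]) (auto simp: W_def)
  have inj1: "inj (frechet_derivative (\<lambda>y. null_chart (?G y)) (at x))"
    by (rule inj_null_chart[OF smG x]) (use sphG[OF c(1) subset_refl] x T(2-5) in \<open>auto simp: centroaffine_sphere_def Gx\<close>)
  \<comment> \<open>The new chart is thus centred at 0, as the restriction of B to the coordinate
    axes requires.\<close>
  have nx: "null_chart (?G x) = 0" unfolding Gx null_chart_def using T(2-5) by (simp add: vec3_eq_0)
  obtain d r where d: "d \<in> \<A>" "p \<in> fst d" "fst d \<subseteq> fst c" "snd c ` fst d \<subseteq> W"
    "snd d = (\<lambda>y. null_chart (?G y)) \<circ> snd c" "r > 0" "coord_dom d = ball 0 r"
    by (rule new_chart[OF assms(1) c(1,2) oW _ WV sm1]) (use xW inj1 nx in \<open>auto simp: x_def\<close>)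
  have dG: "snd d q = null_chart (G q) \<and> um (G q) > 0 \<and> vm (G q) > 0" if "q \<in> fst d" for q
  proof -
    have "q \<in> fst c" "snd c q \<in> W" using that d(3,4) by auto
    then show ?thesis using in_chart_apply[OF cc, of q G] by (simp add: d(5) W_def)
  qed
  note cd = charts[OF d(1)]
  define H where "H = in_chart d G"
  \<comment> \<open>The coordinates of a point in d are its \<open>null_chart\<close> values, so
    \<open>null_chart\<close> after H is the identity of the ball.\<close>
  have H: "y = null_chart (H y)" "um (H y) > 0" "vm (H y) > 0" if "y \<in> ball 0 r" for y
    using dG[OF chart_inv(2)[OF cd]] chart_inv(3)[OF cd] that d(7) by (simp_all add: H_def in_chart_def)
  define B where "B y = (ln (um (H y)) + ln (vm (H y))) / 2" for y
  have smH: "smooth_on (ball 0 r) H"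
    using sphG[OF d(1,3)] unfolding centroaffine_sphere_def d(7) H_def by blast
  have smB: "smooth_on (ball 0 r) B"
  proof -
    have "smooth_on (ball 0 r) (\<lambda>y. (ln (um (H y)) + ln (vm (H y))) * (1 / 2))"
      by (intro smooth_on_mult smooth_on_add smooth_on_diff smooth_on_ln smooth_on_const open_ball
          smooth_on_vec_nth[OF open_ball smH] H)
    then show ?thesis by (simp add: B_def[abs_def])
  qed
  have Heq: "H y = exp (B y + y$3) *\<^sub>R plus_pt (y$1) + exp (B y - y$3) *\<^sub>R minus_pt (y$2)" if "y \<in> ball 0 r" for y
    using null_chart_decompose[OF H(2,3)[OF that]] unfolding H(1)[OF that, symmetric] B_def .
  have sphH: "centroaffine_sphere k (ball 0 r) H"
    using sphG[OF d(1,3)] unfolding d(7) H_def .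
  interpret S: adapted_sphere r k H B
    by (rule adapted_sphere.intro[OF d(6) k sphH smB Heq])
  obtain \<delta>1 \<beta>1 \<alpha>1 \<delta>2 \<beta>2 \<alpha>2 where q:
    "4 * \<alpha>1 * \<delta>1 - \<beta>1\<^sup>2 \<noteq> 0" "4 * \<alpha>2 * \<delta>2 - \<beta>2\<^sup>2 \<noteq> 0"
    "\<And>s. \<bar>s\<bar> < r \<Longrightarrow> \<delta>1 + \<beta>1 * s + \<alpha>1 * s\<^sup>2 > 0" "\<And>s. \<bar>s\<bar> < r \<Longrightarrow> \<delta>2 + \<beta>2 * s + \<alpha>2 * s\<^sup>2 > 0"
    "\<And>x. x \<in> ball 0 r \<Longrightarrow> exp (- 4 * B x) = (\<delta>1 + \<beta>1 * x$1 + \<alpha>1 * (x$1)\<^sup>2) * (\<delta>2 + \<beta>2 * x$2 + \<alpha>2 * (x$2)\<^sup>2)"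
  proof (rule S.quadratic_form, goal_cases)
    case 1
    show thesis by (rule 1(1)[OF 1(2-)])
  qed
  define q1 where "q1 s = \<delta>1 + \<beta>1 * s + \<alpha>1 * s\<^sup>2" for s
  define q2 where "q2 s = \<delta>2 + \<beta>2 * s + \<alpha>2 * s\<^sup>2" for s
  obtain \<rho>1 a1 b1 a2 b2 m1 \<xi> cs1 sn1 where \<xi>: "0 < \<rho>1" "\<rho>1 \<le> r" "a1 * b2 - b1 * a2 \<noteq> 0"
    "(cs1, sn1) \<in> {(cos, sin), (cosh, sinh)}" "smooth_on {-\<rho>1<..<\<rho>1} \<xi>" "(\<xi> has_real_derivative m1) (at 0)" "m1 \<noteq> 0"
    "\<And>s. \<bar>s\<bar> < \<rho>1 \<Longrightarrow> sqrt (q1 s) * cs1 (\<xi> s) = a1 + b1 * s"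
    "\<And>s. \<bar>s\<bar> < \<rho>1 \<Longrightarrow> sqrt (q1 s) * sn1 (\<xi> s) = a2 + b2 * s"
  proof (rule conic_parametrization[OF d(6) q(1,3), folded q1_def], goal_cases)
    case 1
    show ?case by (rule 1(2))
  next
    case 2
    show thesis by (rule 2(1)[OF 2(2-)])
  qed
  obtain \<rho>2 a3 b3 a4 b4 m2 \<eta> cs2 sn2 where \<eta>: "0 < \<rho>2" "\<rho>2 \<le> r" "a3 * b4 - b3 * a4 \<noteq> 0"
    "(cs2, sn2) \<in> {(cos, sin), (cosh, sinh)}" "smooth_on {-\<rho>2<..<\<rho>2} \<eta>" "(\<eta> has_real_derivative m2) (at 0)" "m2 \<noteq> 0"
    "\<And>s. \<bar>s\<bar> < \<rho>2 \<Longrightarrow> sqrt (q2 s) * cs2 (\<eta> s) = a3 + b3 * s"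
    "\<And>s. \<bar>s\<bar> < \<rho>2 \<Longrightarrow> sqrt (q2 s) * sn2 (\<eta> s) = a4 + b4 * s"
  proof (rule conic_parametrization[OF d(6) q(2,4), folded q2_def], goal_cases)
    case 1
    show ?case by (rule 1(2))
  next
    case 2
    show thesis by (rule 2(1)[OF 2(2-)])
  qed
  define W2 where "W2 = {y \<in> ball (0::real^3) r. \<bar>y$1\<bar> < \<rho>1 \<and> \<bar>y$2\<bar> < \<rho>2}"
  have "open (ball (0::real^3) r \<inter> {y. \<bar>y$1\<bar> < \<rho>1 \<and> \<bar>y$2\<bar> < \<rho>2})"
    by (intro open_Int open_ball open_Collect_conj open_Collect_less continuous_intros)
  moreover have "W2 = ball (0::real^3) r \<inter> {y. \<bar>y$1\<bar> < \<rho>1 \<and> \<bar>y$2\<bar> < \<rho>2}" by (auto simp: W2_def)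
  ultimately have oW2: "open W2" by simp
  have smq: "smooth_on {-\<rho><..<\<rho>} (\<lambda>s. u + v * s + w * s\<^sup>2)" for \<rho> u v w :: real
    unfolding power2_eq_square
    by (intro smooth_on_add smooth_on_mult smooth_on_const smooth_on_ident open_greaterThanLessThan)
  have qpos: "q1 s > 0" "q2 s > 0" if "\<bar>s\<bar> < r" for s using q(3,4) that by (auto simp: q1_def q2_def)
  have sm2: "smooth_on W2 (final_chart \<xi> \<eta> q1 q2)"
  proof (rule smooth_on_final_chart[OF oW2 _ _ \<xi>(5) \<eta>(5)])
    show "smooth_on {-\<rho>1<..<\<rho>1} q1" "smooth_on {-\<rho>2<..<\<rho>2} q2"
      using smq by (simp_all add: q1_def[abs_def] q2_def[abs_def])
    show "q1 s > 0" if "s \<in> {-\<rho>1<..<\<rho>1}" for s using that \<xi>(2) by (intro qpos) auto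
    show "q2 s > 0" if "s \<in> {-\<rho>2<..<\<rho>2}" for s using that \<eta>(2) by (intro qpos) auto
  qed (auto simp: W2_def)
  have x0: "snd d p = 0" using d(5) nx by (simp add: x_def)
  have inj2: "inj (frechet_derivative (final_chart \<xi> \<eta> q1 q2) (at (snd d p)))"
    unfolding x0
  proof (rule inj_final_chart[OF \<xi>(6,7) \<eta>(6,7)])
    show "(q1 has_real_derivative \<beta>1) (at 0)" "(q2 has_real_derivative \<beta>2) (at 0)"
      unfolding q1_def[abs_def] q2_def[abs_def] by (auto intro!: derivative_eq_intros)
  qed (use qpos[of 0] d(6) in auto)
  obtain e r' where e: "e \<in> \<A>" "p \<in> fst e" "fst e \<subseteq> fst d" "snd d ` fst e \<subseteq> W2"
    "snd e = final_chart \<xi> \<eta> q1 q2 \<circ> snd d"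
    by (rule new_chart[OF assms(1) d(1,2) oW2 _ _ sm2 inj2])
      (use x0 \<xi>(1) \<eta>(1) d(6,7) in \<open>auto simp: W2_def\<close>)
  let ?R = "block_map (2 * a1) (2 * b1) (2 * a2) (2 * b2) (2 * a3) (2 * b3) (2 * a4) (2 * b4)"
  have R: "Jt_linear ?R"
    using \<xi>(3) \<eta>(3) by (intro Jt_linear_block_map) (simp_all add: algebra_simps)
  have RT: "Jt_linear (?R \<circ> T)" by (rule Jt_linear_compose[OF R T(1)])
  \<comment> \<open>\<open>?R \<circ> T\<close> carries f - b to the model; its inverse followed by
    the translation by b is the affine map sought.\<close>
  have key: "f q = inv (?R \<circ> T) (model cs1 sn1 cs2 sn2 (snd e q $ 1) (snd e q $ 2) (snd e q $ 3)) + b"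
    if q': "q \<in> fst e" for q
  proof -
    let ?y = "snd d q"
    have qd: "q \<in> fst d" and yW: "?y \<in> W2" using q' e(3,4) by auto
    then have y: "?y \<in> ball 0 r" "\<bar>?y$1\<bar> < \<rho>1" "\<bar>?y$2\<bar> < \<rho>2" by (auto simp: W2_def)
    have "H ?y = G q" unfolding H_def by (rule in_chart_apply[OF cd qd])
    moreover have "?R (H ?y) = model cs1 sn1 cs2 sn2 (\<xi> (?y$1)) (\<eta> (?y$2)) ((ln (q2 (?y$2)) - ln (q1 (?y$1))) / 4 - ?y$3)"
    proof (rule block_map_eq_model[OF Heq[OF y(1)]])
      show "0 < q1 (?y$1)" "0 < q2 (?y$2)" using y(2,3) \<xi>(2) \<eta>(2) by (auto intro!: qpos)
      show "exp (- 4 * B ?y) = q1 (?y$1) * q2 (?y$2)" using q(5)[OF y(1)] by (simp add: q1_def q2_def)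
    qed (use \<xi>(8,9)[OF y(2)] \<eta>(8,9)[OF y(3)] in auto)
    ultimately have "(?R \<circ> T) (f q - b) = model cs1 sn1 cs2 sn2 (snd e q $ 1) (snd e q $ 2) (snd e q $ 3)"
      by (simp add: e(5) final_chart_def G_def)
    moreover have "bij (?R \<circ> T)" using RT by (simp add: Jt_linear_def)
    ultimately have "inv (?R \<circ> T) (model cs1 sn1 cs2 sn2 (snd e q $ 1) (snd e q $ 2) (snd e q $ 3)) = f q - b"
      by (metis bij_is_inj inv_f_f)
    then show ?thesis by simp
  qed
  have "model cs1 sn1 cs2 sn2 \<in> {f1, f2, f3, f4}"
    using \<xi>(4) \<eta>(4) model_eq by auto
  then have "\<exists>g\<in>{f1, f2, f3, f4}. \<forall>q\<in>fst e. f q = (\<lambda>w. inv (?R \<circ> T) w + b) (g (snd e q $ 1) (snd e q $ 2) (snd e q $ 3))"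
    using key by blast
  then show "\<exists>(U, \<phi>)\<in>\<A>. p \<in> U \<and> (\<exists>A. Jt_affine A \<and>
      (\<exists>g\<in>{f1, f2, f3, f4}. \<forall>q\<in>U. f q = A (g (\<phi> q $ 1) (\<phi> q $ 2) (\<phi> q $ 3))))"
    using e(1,2) Jt_affine_inv[OF RT, of b] by (intro bexI[of _ e]) (auto split: prod.split)
qed

end
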